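(* Let $K, L\subset\mathbb{R}^3$ be convex bodies. If $K$ is in $\mathfrak{R}_1$ class with respect to $L$, then $$\int_{S^2}\log\left(\frac{h_L}{h_K}\right)\,\mathrm{d}V_K\ \ge\ V(K)\log\left(\frac{V(L)}{V(K)}\right)^{\frac13},$$ where $\log(x)^{1/3}$ means $\log(x^{1/3})$. Equality holds when $K$ and $L$ are dilates.
   Context: A convex body in $\mathbb{R}^3$ is a compact convex set with non-empty interior; $\mathcal{K}^3$ is the set of all of them. $V$ is volume (Lebesgue measure). The support function of $K$ is $h_K(x)=\max\{x\cdot y: y\in K\}$. $S_K$ is the surface area measure of $K$: for Borel $\omega\subseteq S^2$, $S_K(\omega)=\mathcal{H}^2(\nu_K^{-1}(\omega))$, where $\nu_K$ is the Gauss map (outer unit normal), defined on the set of points of $\partial K$ having a unique outer unit normal. For $K$ containing the origin $o$ in its interior, the cone-volume measure $V_K$ is the Borel measure on $S^2$ given by $\mathrm{d}V_K=\frac13 h_K\,\mathrm{d}S_K$; its total mass is $V(K)$. $K$ and $L$ are dilates if $K=cL$ for some $c>0$. Relative quermassintegrals: for convex bodies $K,L$ in $\mathbb{R}^3$, the numbers $W_i(K,L)$, $i=0,1,2,3$, are the coefficients defined by $V(K+tL)=\sum_{i=0}^3\binom{3}{i}W_i(K,L)t^i$ for all $t\ge 0$ ($+$ is Minkowski sum). In particular $W_0(K,L)=V(K)$ and $W_3(K,L)=V(L)$. The $0$-th relative Bonnesen function is $\mathcal{B}_{0;K,L}(r)=2W_1(K,L)r-W_0(K,L)-W_2(K,L)r^2$.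 When $o\in\mathrm{int}(K\cap L)$ put $r_o(K,L)=\max\{t\ge0: tL\subseteq K\}=\min_{u\in S^2}\frac{h_K(u)}{h_L(u)}$ and $R_o(K,L)=\min\{t>0: tL\supseteq K\}=\max_{u\in S^2}\frac{h_K(u)}{h_L(u)}$. Definition: $K$ is in $\mathfrak{R}_1$ class with respect to $L$ if $o\in\mathrm{int}(K\cap L)$ and $\mathcal{B}_{0;K,L}(r)\ge0$ for all $r\in[r_o(K,L),R_o(K,L)]$. *)

theory Defs
  imports "HOL-Analysis.Analysis"
begin

definition convex_body :: "(real^3) set \<Rightarrow> bool" where
  "convex_body K \<longleftrightarrow> compact K \<and> convex K \<and> interior K \<noteq> {}"

definition vol :: "(real^3) set \<Rightarrow> real" where
  "vol K = measure lebesgue K"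

definition support_fun :: "(real^3) set \<Rightarrow> real^3 \<Rightarrow> real" where
  "support_fun K x = (SUP y\<in>K. x \<bullet> y)"

definition dilates :: "(real^3) set \<Rightarrow> (real^3) set \<Rightarrow> bool" where
  "dilates K L \<longleftrightarrow> (\<exists>c>0. K = (*\<^sub>R) c ` L)"

(* The d-dimensional Hausdorff (outer) measure. The factor unit_ball_vol d / 2 ^ d is the usual
   normalisation under which it agrees with d-dimensional Lebesgue measure in R^d. Covering sets
   are required to be bounded because diameter is unspecified on unbounded sets; the empty set
   is treated separately so that it contributes 0 also for d = 0. *)
definition hausdorff_premeasure :: "nat \<Rightarrow> real \<Rightarrow> 'a::metric_space set \<Rightarrow> ennreal" where
  "hausdorff_premeasure d \<delta> A =
     (INF U \<in> {U :: nat \<Rightarrow> 'a set. (\<forall>i. bounded (U i) \<and> diameter (U i) \<le> \<delta>) \<and> A \<subseteq> (\<Union>i. U i)}.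
        \<Sum>i. if U i = {} then 0
             else ennreal (unit_ball_vol (real d) / 2 ^ d * diameter (U i) ^ d))"

definition hausdorff_measure :: "nat \<Rightarrow> 'a::metric_space set \<Rightarrow> ennreal" where
  "hausdorff_measure d A = (SUP \<delta>\<in>{0<..}. hausdorff_premeasure d \<delta> A)"

definition outer_unit_normal :: "(real^3) set \<Rightarrow> real^3 \<Rightarrow> real^3 \<Rightarrow> bool" where
  "outer_unit_normal K x u \<longleftrightarrow> norm u = 1 \<and> (\<forall>y\<in>K. u \<bullet> y \<le> u \<bullet> x)"

definition regular_boundary :: "(real^3) set \<Rightarrow> (real^3) set" where
  "regular_boundary K = {x \<in> frontier K. \<exists>!u. outer_unit_normal K x u}"

definition gauss_map :: "(real^3) set \<Rightarrow> real^3 \<Rightarrow> real^3" where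
  "gauss_map K x = (THE u. outer_unit_normal K x u)"

definition surface_area_measure :: "(real^3) set \<Rightarrow> (real^3) measure" where
  "surface_area_measure K =
     measure_of (sphere 0 1) (sets (restrict_space borel (sphere 0 1)))
       (\<lambda>\<omega>. hausdorff_measure 2 {x \<in> regular_boundary K. gauss_map K x \<in> \<omega>})"

definition cone_volume_measure :: "(real^3) set \<Rightarrow> (real^3) measure" where
  "cone_volume_measure K =
     density (surface_area_measure K) (\<lambda>u. ennreal (support_fun K u / 3))"

(* The coefficients of the relative Steiner polynomial; requiring them to vanish beyond the
   degree makes the sequence unique. *)
definition quermass :: "nat \<Rightarrow> (real^3) set \<Rightarrow> (real^3) set \<Rightarrow> real" where
  "quermass i K L =
     (THE w :: nat \<Rightarrow> real. (\<forall>j>3. w j = 0) \<and>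
        (\<forall>t\<ge>0. vol {x + t *\<^sub>R y | x y. x \<in> K \<and> y \<in> L}
               = (\<Sum>j\<le>3. real (3 choose j) * w j * t ^ j))) i"

definition bonnesen0 :: "(real^3) set \<Rightarrow> (real^3) set \<Rightarrow> real \<Rightarrow> real" where
  "bonnesen0 K L r = 2 * quermass 1 K L * r - quermass 0 K L - quermass 2 K L * r\<^sup>2"

definition inradius_o :: "(real^3) set \<Rightarrow> (real^3) set \<Rightarrow> real" where
  "inradius_o K L = Sup {t. 0 \<le> t \<and> (*\<^sub>R) t ` L \<subseteq> K}"

definition circumradius_o :: "(real^3) set \<Rightarrow> (real^3) set \<Rightarrow> real" where
  "circumradius_o K L = Inf {t. 0 < t \<and> K \<subseteq> (*\<^sub>R) t ` L}"

definition class_R1 :: "(real^3) set \<Rightarrow> (real^3) set \<Rightarrow> bool" where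
  "class_R1 K L \<longleftrightarrow> 0 \<in> interior (K \<inter> L) \<and>
     (\<forall>r\<in>{inradius_o K L..circumradius_o K L}. 0 \<le> bonnesen0 K L r)"

end

theory Submission
  imports Defs
begin

text \<open>
  Put \<open>x = h\<^sub>L / h\<^sub>K\<close> on the sphere. Inserting \<open>r = 1 / x\<close> into the Bonnesen function shows that \<open>x\<close>
  lies between the roots of \<open>W\<^sub>0 x\<^sup>2 - 2 W\<^sub>1 x + W\<^sub>2\<close>, which have arithmetic mean \<open>W\<^sub>1 / W\<^sub>0\<close> and
  product \<open>W\<^sub>2 / W\<^sub>0\<close>. The integral of \<open>x\<close> with respect to the cone-volume measure is at least
  \<open>W\<^sub>1\<close>, so replacing the concave function \<open>ln\<close> by its chord between the roots bounds the integral of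
  \<open>ln x\<close> from below by \<open>V(K) / 2 \<cdot> ln (W\<^sub>2 / W\<^sub>0)\<close>. Minkowski's inequality
  \<open>W\<^sub>2\<^sup>3 \<ge> W\<^sub>0 W\<^sub>3\<^sup>2\<close>, a consequence of the Brunn-Minkowski inequality, finishes the proof.

  That \<open>V(K + t L)\<close> is a cubic polynomial follows from the change of variables formula: if
  \<open>f\<^sub>K(x) = ln (\<integral> exp (x \<bullet> y) dy)\<close> with integration over \<open>K\<close>, then \<open>\<nabla>f\<^sub>K + t \<nabla>f\<^sub>L\<close> maps the space
  injectively onto \<open>K + t L\<close> up to boundary points, and its Jacobian determinant is a cubic polynomial
  in \<open>t\<close>. The cone-volume measure is the image of Lebesgue measure on \<open>K\<close> under \<open>y \<mapsto>\<close> the normal at the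
  radial projection of \<open>y\<close>; this rests on comparing Hausdorff measure on the boundary with Lebesgue
  measure on tangent planes, by the isodiametric inequality in one direction and by Vitali's covering
  theorem in the other.
\<close>

section \<open>The Brunn-Minkowski and isodiametric inequalities\<close>

text \<open>The midpoint makes the argument close: at the arithmetic mean of the two roots the chord
  takes the value of \<open>ln\<close> at their geometric mean. The slope of the chord is
  nonnegative, so a lower bound for the integral of \<open>x\<close> suffices. Most of the length is
  forced by the definitions. \<open>quermass\<close> is a definite description and says nothing
  until the volume of \<open>K + t L\<close> is known to be a polynomial, for bodies without any
  smoothness; the gradient maps are smooth for every body. \<open>surface_area_measure\<close> is
  built by \<open>measure_of\<close>, which yields the zero measure unless the Hausdorff set
  function is countably additive on the Borel sets of the sphere. It is therefore identified with an
  explicit image of a measure on \<open>K\<close>. Corners and edges of the boundary are avoided by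
  working at the points where the gauge of \<open>K\<close> is differentiable, a cone that fills the
  space up to a null set. Homogeneity of the gauge replaces a surface patch by the solid cone over
  it, and hence surface integrals by volume integrals.\<close>

definition msum :: "'a::real_vector set \<Rightarrow> 'a set \<Rightarrow> 'a set" where
  "msum A B = {x + y | x y. x \<in> A \<and> y \<in> B}"

lemma msum_commute: "msum A B = msum B A"
  by (auto simp: msum_def) (metis add.commute)+

lemma msum_mono: "A \<subseteq> A' \<Longrightarrow> B \<subseteq> B' \<Longrightarrow> msum A B \<subseteq> msum A' B'"
  by (auto simp: msum_def)

lemma open_msum:
  fixes A B :: "'a::real_normed_vector set"
  assumes "open A" shows "open (msum A B)"
proof -
  have "msum A B = (\<Union>y\<in>B. (+) y ` A)"
    by (auto simp: msum_def image_iff add.commute) (metis add.commute)+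
  then show ?thesis using assms by (auto intro!: open_translation)
qed

lemma bounded_msum:
  fixes A B :: "'a::real_normed_vector set"
  assumes "bounded A" "bounded B" shows "bounded (msum A B)"
  using bounded_plus [OF assms] unfolding msum_def
  by (rule bounded_subset) auto

section \<open>Finite unions of disjoint open boxes and their cuts by coordinate hyperplanes\<close>

definition box_family :: "'a::euclidean_space set set \<Rightarrow> bool" where
  "box_family F \<longleftrightarrow> finite F \<and> F \<noteq> {} \<and> disjoint F \<and> (\<forall>X\<in>F. X \<noteq> {} \<and> (\<exists>a b. X = box a b))"

text \<open>Open half-spaces cut open boxes into open boxes and lose only part of a hyperplane.
  Empty pieces are removed so that the cardinality falls when a box misses the half-space; this
  number drives the induction.\<close>

definition cut :: "'a set set \<Rightarrow> 'a set \<Rightarrow> 'a set set" where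
  "cut F H = ((\<lambda>X. X \<inter> H) ` F) - {{}}"

lemma Union_cut: "\<Union>(cut F H) = \<Union>F \<inter> H"
  by (auto simp: cut_def)

lemma card_cut_le: "finite F \<Longrightarrow> card (cut F H) \<le> card F"
  unfolding cut_def by (meson card_Diff1_le card_image_le finite_imageI le_trans)

lemma card_cut_less:
  assumes "finite F" "X \<in> F" "X \<inter> H = {}"
  shows "card (cut F H) < card F"
proof -
  have "cut F H \<subseteq> (\<lambda>X. X \<inter> H) ` (F - {X})"
    using assms by (auto simp: cut_def)
  then have "card (cut F H) \<le> card (F - {X})"
    by (meson assms(1) card_image_le card_mono finite_Diff finite_imageI le_trans)
  also have "\<dots> < card F"
    using assms by (metis card_Diff1_less)
  finally show ?thesis .
qed

lemma box_Int_lower: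
  fixes a b :: "'a::euclidean_space"
  assumes "i \<in> Basis"
  shows "box a b \<inter> {x. x \<bullet> i < c} = box a (\<Sum>j\<in>Basis. (if j = i then min (b \<bullet> i) c else b \<bullet> j) *\<^sub>R j)"
proof -
  have eq: "y < (if j = i then min (b \<bullet> i) c else b \<bullet> j) \<longleftrightarrow> y < b \<bullet> j \<and> (j = i \<longrightarrow> y < c)" for y j
    by auto
  show ?thesis using assms by (auto simp: mem_box eq)
qed

lemma box_Int_upper:
  fixes a b :: "'a::euclidean_space"
  assumes "i \<in> Basis"
  shows "box a b \<inter> {x. c < x \<bullet> i} = box (\<Sum>j\<in>Basis. (if j = i then max (a \<bullet> i) c else a \<bullet> j) *\<^sub>R j) b"
proof -
  have eq: "(if j = i then max (a \<bullet> i) c else a \<bullet> j) < y \<longleftrightarrow> a \<bullet> j < y \<and> (j = i \<longrightarrow> c < y)" for y j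
    by auto
  show ?thesis using assms by (auto simp: mem_box eq)
qed

lemma box_family_cut:
  fixes F :: "'a::euclidean_space set set"
  assumes F: "box_family F" and i: "i \<in> Basis" and ne: "\<Union>F \<inter> H \<noteq> {}"
    and H: "H = {x. x \<bullet> i < c} \<or> H = {x. c < x \<bullet> i}"
  shows "box_family (cut F H)"
proof -
  have "disjoint (cut F H)"
  proof (rule disjointI)
    fix P Q assume "P \<in> cut F H" "Q \<in> cut F H" "P \<noteq> Q"
    then obtain X Y where XY: "X \<in> F" "Y \<in> F" "P = X \<inter> H" "Q = Y \<inter> H" "X \<noteq> Y"
      by (auto simp: cut_def)
    then have "X \<inter> Y = {}" using F by (auto simp: box_family_def disjoint_def)
    then show "P \<inter> Q = {}" using XY by blast
  qed
  moreover have "\<exists>a b. X \<inter> H = box a b" if "X \<in> F" for X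
  proof -
    have "\<exists>a b. X = box a b" using F that unfolding box_family_def by simp
    then obtain a b where X: "X = box a b" by blast
    from H show ?thesis
    proof
      assume H: "H = {x. x \<bullet> i < c}"
      show ?thesis unfolding H X box_Int_lower[OF i] by blast
    next
      assume H: "H = {x. c < x \<bullet> i}"
      show ?thesis unfolding H X box_Int_upper[OF i] by blast
    qed
  qed
  moreover have "cut F H \<noteq> {}" using ne Union_cut [of F H] by auto
  moreover have "finite (cut F H)" using F unfolding box_family_def cut_def by blast
  ultimately show ?thesis
    unfolding box_family_def by (auto simp: cut_def)
qed

lemma box_family_measure:
  assumes "box_family F"
  shows "open (\<Union>F)" "bounded (\<Union>F)" "\<Union>F \<in> lmeasurable" "measure lebesgue (\<Union>F) > 0"
proof -
  show o: "open (\<Union>F)" and b: "bounded (\<Union>F)"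
    using assms unfolding box_family_def by (auto intro!: open_Union bounded_Union)
  show l: "\<Union>F \<in> lmeasurable" using o b by (simp add: lmeasurable_open)
  have "\<Union>F \<noteq> {}" using assms unfolding box_family_def by blast
  then have "\<not> negligible (\<Union>F)" using o open_not_negligible by blast
  then show "measure lebesgue (\<Union>F) > 0"
    using l by (metis less_eq_real_def measure_nonneg negligible_iff_measure0)
qed

lemma disjoint_boxes_separated:
  fixes a b c d :: "'a::euclidean_space"
  assumes "box a b \<inter> box c d = {}" "box a b \<noteq> {}" "box c d \<noteq> {}"
  obtains i s where "i \<in> Basis"
    "box a b \<subseteq> {x. x \<bullet> i < s} \<and> box c d \<subseteq> {x. s < x \<bullet> i} \<or>
     box c d \<subseteq> {x. x \<bullet> i < s} \<and> box a b \<subseteq> {x. s < x \<bullet> i}"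
proof -
  obtain i where i: "i \<in> Basis"
    "b \<bullet> i \<le> a \<bullet> i \<or> d \<bullet> i \<le> c \<bullet> i \<or> b \<bullet> i \<le> c \<bullet> i \<or> d \<bullet> i \<le> a \<bullet> i"
    using assms(1) unfolding disjoint_interval by blast
  have "a \<bullet> i < b \<bullet> i" "c \<bullet> i < d \<bullet> i" using assms i(1) by (auto simp: box_ne_empty)
  \<comment> \<open>The first two alternatives for \<open>i\<close> would make one of the boxes
    empty.\<close>
  with i consider "b \<bullet> i \<le> c \<bullet> i" | "d \<bullet> i \<le> a \<bullet> i" by linarith
  then show ?thesis
  proof cases
    case 1 show ?thesis
      by (rule that[of i "b \<bullet> i"]) (use 1 i(1) in \<open>force simp: mem_box\<close>)+
  next
    case 2 show ?thesis
      by (rule that[of i "d \<bullet> i"]) (use 2 i(1) in \<open>force simp: mem_box\<close>)+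
  qed
qed

section \<open>Cutting a set by a hyperplane in a prescribed volume ratio\<close>

lemma halfspace_measure_continuous:
  fixes B :: "'a::euclidean_space set"
  assumes B: "B \<in> lmeasurable" and i: "i \<in> Basis"
  shows "continuous_on UNIV (\<lambda>d. measure lebesgue (B \<inter> {x. x \<bullet> i < d}))"
proof -
  have m: "{x::'a. x \<bullet> i < d} \<in> sets lebesgue" for d
    by (simp add: open_halfspace_component_lt)
  have eq: "measure lebesgue (B \<inter> {x. x \<bullet> i < d}) = (LINT x|lebesgue. indicator (B \<inter> {x. x \<bullet> i < d}) x)" for d
    by simp
  have "(\<lambda>n. measure lebesgue (B \<inter> {x. x \<bullet> i < X n})) \<longlonglongrightarrow> measure lebesgue (B \<inter> {x. x \<bullet> i < d})"
    if X: "X \<longlonglongrightarrow> d" for X :: "nat \<Rightarrow> real" and d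
    unfolding eq
  \<comment> \<open>The indicators converge off the hyperplane \<open>x \<bullet> i = d\<close>,
    which is a null set, and the indicator of \<open>B\<close> dominates them.\<close>
  proof (rule integral_dominated_convergence[where w="indicator B"])
    show "AE x in lebesgue. (\<lambda>n. indicator (B \<inter> {x. x \<bullet> i < X n}) x :: real) \<longlonglongrightarrow> indicator (B \<inter> {x. x \<bullet> i < d}) x"
    proof (rule AE_I')
      show "{x. x \<bullet> i = d} \<in> null_sets lebesgue"
        using negligible_standard_hyperplane[OF i, of d] negligible_iff_null_sets by blast
      show "{x \<in> space lebesgue. \<not> (\<lambda>n. indicator (B \<inter> {x. x \<bullet> i < X n}) x :: real) \<longlonglongrightarrow> indicator (B \<inter> {x.
          x \<bullet> i < d}) x} \<subseteq> {x. x \<bullet> i = d}"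
      proof (rule subsetI, rule CollectI, rule ccontr)
        fix x assume "x \<in> {x \<in> space lebesgue. \<not> (\<lambda>n. indicator (B \<inter> {x. x \<bullet> i < X n}) x :: real) \<longlonglongrightarrow>
            indicator (B \<inter> {x. x \<bullet> i < d}) x}" "x \<bullet> i \<noteq> d"
        then have *: "\<not> (\<lambda>n. indicator (B \<inter> {x. x \<bullet> i < X n}) x :: real) \<longlonglongrightarrow> indicator (B \<inter> {x. x \<bullet> i < d})
            x" "x \<bullet> i \<noteq> d"
          by blast+
        have "eventually (\<lambda>n. (x \<bullet> i < X n) = (x \<bullet> i < d)) sequentially"
        proof (cases "x \<bullet> i < d")
          case True
          then show ?thesis using order_tendstoD(1)[OF X True] by (auto elim: eventually_mono)
        next
          case False
          then have "x \<bullet> i > d" using * by auto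
          then show ?thesis using order_tendstoD(2)[OF X \<open>x \<bullet> i > d\<close>] by (auto elim!: eventually_mono)
        qed
        then have "eventually (\<lambda>n. indicator (B \<inter> {x. x \<bullet> i < X n}) x = (indicator (B \<inter> {x. x \<bullet> i < d}) x
            :: real)) sequentially"
          by (rule eventually_mono) (auto simp: indicator_def)
        from *(1) tendsto_eventually[OF this] show False by (rule notE)
      qed
    qed
    show "integrable lebesgue (indicator B :: 'a \<Rightarrow> real)"
      using fmeasurableD[OF B] fmeasurableD2[OF B] by (intro integrable_real_indicator) (simp_all add: less_top)
    show "indicator (B \<inter> {x. x \<bullet> i < d}) \<in> borel_measurable lebesgue"
      "\<And>n. indicator (B \<inter> {x. x \<bullet> i < X n}) \<in> borel_measurable lebesgue"
      using B m by (auto intro!: borel_measurable_indicator)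
    show "\<And>n. AE x in lebesgue. norm (indicator (B \<inter> {x. x \<bullet> i < X n}) x::real) \<le> indicator B x"
      by (auto simp: indicator_def)
  qed
  then show ?thesis
    unfolding continuous_on_sequentially by (auto simp: o_def)
qed

lemma halfspace_split:
  fixes B :: "'a::euclidean_space set"
  assumes B: "B \<in> lmeasurable" and i: "i \<in> Basis"
  shows "measure lebesgue B = measure lebesgue (B \<inter> {x. x \<bullet> i < d}) + measure lebesgue (B \<inter> {x. d < x \<bullet> i})"
proof -
  have m: "B \<inter> {x::'a. x \<bullet> i < d} \<in> lmeasurable" "B \<inter> {x::'a. d < x \<bullet> i} \<in> lmeasurable"
    using B by (auto intro!: fmeasurable_Int_fmeasurable simp: open_halfspace_component_lt
        open_halfspace_component_gt)
  have "measure lebesgue B = measure lebesgue (B \<inter> {x. x \<bullet> i < d} \<union> B \<inter> {x. d < x \<bullet> i})"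
  proof (rule measure_negligible_symdiff[symmetric])
    show "B \<in> lmeasurable" using B by auto
    show "negligible (sym_diff B (B \<inter> {x. x \<bullet> i < d} \<union> B \<inter> {x. d < x \<bullet> i}))"
      by (rule negligible_subset[OF negligible_standard_hyperplane[OF i, of d]]) auto
  qed
  also have "\<dots> = measure lebesgue (B \<inter> {x. x \<bullet> i < d}) + measure lebesgue (B \<inter> {x. d < x \<bullet> i})"
  proof -
    have "B \<inter> {x. x \<bullet> i < d} \<inter> (B \<inter> {x. d < x \<bullet> i}) = {}" by auto
    then show ?thesis using m by (simp add: measure_Un3)
  qed
  finally show ?thesis .
qed

text \<open>Intermediate value theorem in the position of the hyperplane: as it moves from
  \<open>-R\<close> to \<open>R\<close>, the half-space captures at first none and finally all of
  the bounded set.\<close>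

lemma halfspace_bisect:
  fixes B :: "'a::euclidean_space set"
  assumes B: "B \<in> lmeasurable" "bounded B" and i: "i \<in> Basis" and th: "0 < \<theta>" "\<theta> < 1"
  obtains d where "measure lebesgue (B \<inter> {x. x \<bullet> i < d}) = \<theta> * measure lebesgue B"
proof -
  obtain R where R: "R > 0" "\<And>x. x \<in> B \<Longrightarrow> norm x < R" using B(2) bounded_pos_less by blast
  have R': "\<bar>x \<bullet> i\<bar> < R" if "x \<in> B" for x
    using R(2)[OF that] Basis_le_norm[OF i, of x] by linarith
  have 1: "B \<inter> {x. x \<bullet> i < -R} = {}" using R' by force
  have 2: "B \<inter> {x. x \<bullet> i < R} = B" using R' by force
  have "\<exists>d\<ge>-R. d \<le> R \<and> measure lebesgue (B \<inter> {x. x \<bullet> i < d}) = \<theta> * measure lebesgue B"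
  proof (rule IVT')
    show "measure lebesgue (B \<inter> {x. x \<bullet> i < -R}) \<le> \<theta> * measure lebesgue B"
      using th unfolding 1 by simp
    show "\<theta> * measure lebesgue B \<le> measure lebesgue (B \<inter> {x. x \<bullet> i < R})"
      unfolding 2 using th mult_right_mono[of \<theta> 1 "measure lebesgue B"] by simp
    show "continuous_on {-R..R} (\<lambda>d. measure lebesgue (B \<inter> {x. x \<bullet> i < d}))"
      using halfspace_measure_continuous[OF B(1) i] continuous_on_subset by blast
  qed (use R in auto)
  then show ?thesis using that by blast
qed

text \<open>This is Brunn-Minkowski for two boxes with side lengths \<open>a\<close> and
  \<open>b\<close>. With \<open>c i = a i + b i\<close>, the arithmetic-geometric mean inequality
  bounds the roots of the products of \<open>a i / c i\<close> and of \<open>b i / c i\<close> by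
  two arithmetic means whose sum is 1.\<close>

lemma root_prod_superadditive:
  fixes a b :: "'a \<Rightarrow> real"
  assumes S: "finite S" "S \<noteq> {}" and a: "\<And>i. i \<in> S \<Longrightarrow> a i > 0" and b: "\<And>i. i \<in> S \<Longrightarrow> b i > 0"
  shows "(root (card S) (prod a S) + root (card S) (prod b S)) ^ card S \<le> (\<Prod>i\<in>S. a i + b i)"
proof -
  define n where "n = card S"
  have n: "n > 0" using S by (simp add: n_def card_gt_0_iff)
  define c where "c i = a i + b i" for i
  have c: "c i > 0" if "i \<in> S" for i using a b that by (simp add: c_def add_pos_pos)
  have P: "prod a S > 0" "prod b S > 0" "prod c S > 0" using a b c by (auto intro!: prod_pos)
  have ag: "root n (\<Prod>i\<in>S. x i) \<le> (\<Sum>i\<in>S. x i / n)" if x: "\<And>i. i \<in> S \<Longrightarrow> x i > 0" for x :: "'a \<Rightarrow> real"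
  proof -
    have "prod x S > 0" using x by (auto intro!: prod_pos)
    then show ?thesis
      using arith_geom_mean[OF S, of x] x n root_powr_inverse[OF n, of "prod x S"] by (force simp: n_def)
  qed
  have "root n (prod a S / prod c S) + root n (prod b S / prod c S)
        \<le> (\<Sum>i\<in>S. (a i / c i) / n) + (\<Sum>i\<in>S. (b i / c i) / n)"
    using ag[of "\<lambda>i. a i / c i"] ag[of "\<lambda>i. b i / c i"] a b c
    by (intro add_mono) (auto simp: prod_dividef)
  also have "\<dots> = (\<Sum>i\<in>S. (a i / c i + b i / c i) / n)" by (simp add: sum.distrib add_divide_distrib)
  also have "\<dots> = (\<Sum>i\<in>S. 1 / n)"
    using c by (intro sum.cong) (auto simp: add_divide_distrib[symmetric] c_def less_imp_neq[THEN not_sym])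
  also have "\<dots> = 1" using n by (simp add: n_def)
  finally have "(root n (prod a S) + root n (prod b S)) / root n (prod c S) \<le> 1"
    by (simp add: real_root_divide add_divide_distrib)
  then have "root n (prod a S) + root n (prod b S) \<le> root n (prod c S)"
    using P n by (simp add: divide_simps real_root_gt_zero split: if_splits)
  then have "(root n (prod a S) + root n (prod b S)) ^ n \<le> root n (prod c S) ^ n"
    using P n by (intro power_mono) (auto intro!: add_nonneg_nonneg real_root_ge_zero)
  also have "\<dots> = prod c S" using P n by simp
  finally show ?thesis by (simp add: n_def c_def)
qed

section \<open>Brunn-Minkowski for boxes, box families and bounded open sets\<close>

definition bm_ineq :: "'a::euclidean_space set \<Rightarrow> 'a set \<Rightarrow> bool" where
  "bm_ineq A B \<longleftrightarrow> (root DIM('a) (measure lebesgue A) + root DIM('a) (measure lebesgue B)) ^ DIM('a)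
     \<le> measure lebesgue (msum A B)"

lemma bm_ineq_commute: "bm_ineq A B \<longleftrightarrow> bm_ineq B A"
  unfolding bm_ineq_def by (simp add: msum_commute[of A B] add.commute)

lemma msum_box:
  fixes a b c d :: "'a::euclidean_space"
  assumes "box a b \<noteq> {}" "box c d \<noteq> {}"
  shows "box (a + c) (b + d) \<subseteq> msum (box a b) (box c d)"
proof
  fix x assume x: "x \<in> box (a + c) (b + d)"
  have ab: "a \<bullet> i < b \<bullet> i" "c \<bullet> i < d \<bullet> i" if "i \<in> Basis" for i using assms that by (auto simp: box_ne_empty)
  \<comment> \<open>Relative position of \<open>x\<close> along the \<open>i\<close>-th side of the
    large box; the same ratio is used in both summands.\<close>
  define t where "t i = (x \<bullet> i - a \<bullet> i - c \<bullet> i) / (b \<bullet> i - a \<bullet> i + (d \<bullet> i - c \<bullet> i))" for i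
  define y where "y = (\<Sum>i\<in>Basis. (a \<bullet> i + t i * (b \<bullet> i - a \<bullet> i)) *\<^sub>R i)"
  have t: "0 < t i" "t i < 1" if "i \<in> Basis" for i
  proof -
    have "a \<bullet> i + c \<bullet> i < x \<bullet> i" "x \<bullet> i < b \<bullet> i + d \<bullet> i"
      using x that by (auto simp: mem_box inner_add_left)
    moreover have "b \<bullet> i - a \<bullet> i + (d \<bullet> i - c \<bullet> i) > 0" using ab[OF that] by linarith
    ultimately show "0 < t i" "t i < 1" unfolding t_def by (intro divide_pos_pos, simp_all)
  qed
  have yi: "y \<bullet> i = a \<bullet> i + t i * (b \<bullet> i - a \<bullet> i)" if "i \<in> Basis" for i using that by (simp add: y_def)
  have zi: "(x - y) \<bullet> i = c \<bullet> i + t i * (d \<bullet> i - c \<bullet> i)" if "i \<in> Basis" for i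
  proof -
    have "t i * (b \<bullet> i - a \<bullet> i + (d \<bullet> i - c \<bullet> i)) = x \<bullet> i - a \<bullet> i - c \<bullet> i"
      using ab[OF that] by (simp add: t_def)
    then show ?thesis using yi[OF that] by (simp add: inner_diff_left algebra_simps)
  qed
  have in_seg: "l < l + s * (u - l) \<and> l + s * (u - l) < u" if "0 < s" "s < 1" "l < u" for l s u :: real
  proof -
    define w where "w = s * (u - l)"
    have "w < 1 * (u - l)" unfolding w_def by (rule mult_strict_right_mono) (use that in auto)
    moreover have "w > 0" using that by (simp add: w_def)
    ultimately show ?thesis unfolding w_def[symmetric] by simp
  qed
  have "y \<in> box a b" unfolding mem_box using yi in_seg t ab by simp
  moreover have "x - y \<in> box c d" unfolding mem_box using zi in_seg t ab by simp
  moreover have "x = y + (x - y)" by simp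
  ultimately show "x \<in> msum (box a b) (box c d)" unfolding msum_def by blast
qed

lemma bm_ineq_box:
  fixes a b c d :: "'a::euclidean_space"
  assumes "box a b \<noteq> {}" "box c d \<noteq> {}"
  shows "bm_ineq (box a b) (box c d)"
proof -
  have ab: "a \<bullet> i < b \<bullet> i" "c \<bullet> i < d \<bullet> i" if "i \<in> Basis" for i using assms that by (auto simp: box_ne_empty)
  have m: "measure lebesgue (box a b) = (\<Prod>i\<in>Basis. (b - a) \<bullet> i)"
      "measure lebesgue (box c d) = (\<Prod>i\<in>Basis. (d - c) \<bullet> i)"
    using ab by (auto simp: measure_lborel_box_eq less_imp_le)
  have "(root DIM('a) (measure lebesgue (box a b)) + root DIM('a) (measure lebesgue (box c d))) ^ DIM('a)
     \<le> (\<Prod>i\<in>Basis. (b - a) \<bullet> i + (d - c) \<bullet> i)"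
    unfolding m using ab by (intro root_prod_superadditive) (auto simp: inner_diff_left)
  also have "\<dots> = measure lebesgue (box (a + c) (b + d))"
    using ab by (auto simp: measure_lborel_box_eq inner_simps less_imp_le add_mono intro!: prod.cong)
  also have "\<dots> \<le> measure lebesgue (msum (box a b) (box c d))"
    by (intro measure_mono_fmeasurable msum_box assms lmeasurable_open bounded_msum open_msum bounded_box
        open_box) auto
  finally show ?thesis unfolding bm_ineq_def .
qed

text \<open>
  Hadwiger and Ohmann: cut the first figure by a hyperplane that separates two of its boxes, and the
  second one by a parallel hyperplane in the same volume ratio. The sums of corresponding parts
  are disjoint subsets of the whole sum, and both pairs consist of fewer boxes.
\<close>
lemma bm_ineq_step:
  fixes F G :: "'a::euclidean_space set set"
  assumes F: "box_family F" and G: "box_family G" and c: "card F \<ge> 2"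
    and IH: "\<And>F' G' :: 'a set set. box_family F' \<Longrightarrow> box_family G' \<Longrightarrow> card F' + card G' < card F + card G \<Longrightarrow>
        bm_ineq (\<Union>F') (\<Union>G')"
  shows "bm_ineq (\<Union>F) (\<Union>G)"
proof -
  let ?n = "DIM('a)" let ?m = "measure lebesgue"
  obtain X Y where XY: "X \<in> F" "Y \<in> F" "X \<noteq> Y"
  proof -
    obtain T where "T \<subseteq> F" "card T = 2" using c by (meson obtain_subset_with_card_n)
    then show ?thesis using that by (auto simp: card_2_iff)
  qed
  then have disj: "X \<inter> Y = {}" and ne: "X \<noteq> {}" "Y \<noteq> {}" and "\<exists>a b. X = box a b" "\<exists>c d. Y = box c d"
    using F unfolding box_family_def disjoint_def by metis+
  then obtain i s where i: "i \<in> Basis" and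
    "X \<subseteq> {x. x \<bullet> i < s} \<and> Y \<subseteq> {x. s < x \<bullet> i} \<or> Y \<subseteq> {x. x \<bullet> i < s} \<and> X \<subseteq> {x. s < x \<bullet> i}"
    by (metis disjoint_boxes_separated)
  then have "\<exists>X Y. X \<in> F \<and> Y \<in> F \<and> X \<subseteq> {x. x \<bullet> i < s} \<and> Y \<subseteq> {x. s < x \<bullet> i} \<and> X \<noteq> {} \<and> Y \<noteq> {}"
    using XY(1,2) ne by blast
  then obtain X Y where XY: "X \<in> F" "Y \<in> F" "X \<subseteq> {x. x \<bullet> i < s}" "Y \<subseteq> {x. s < x \<bullet> i}" "X \<noteq> {}" "Y \<noteq> {}"
    by blast
  define A B where "A = \<Union>F" and "B = \<Union>G"
  note A = box_family_measure[OF F, folded A_def] and B = box_family_measure[OF G, folded B_def]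
  define L U where "L t = {x::'a. x \<bullet> i < t}" and "U t = {x::'a. t < x \<bullet> i}" for t
  have neA: "A \<inter> L s \<noteq> {}" "A \<inter> U s \<noteq> {}" using XY unfolding A_def L_def U_def by blast+
  have FL: "box_family (cut F (L s))" and FU: "box_family (cut F (U s))"
    using neA by (auto intro!: box_family_cut[OF F i] simp: A_def L_def U_def)
  have posA: "?m (A \<inter> L s) > 0" "?m (A \<inter> U s) > 0"
    using box_family_measure(4)[OF FL] box_family_measure(4)[OF FU] by (auto simp: Union_cut A_def)
  have sA: "?m A = ?m (A \<inter> L s) + ?m (A \<inter> U s)" unfolding L_def U_def by (rule halfspace_split[OF A(3) i])
  define \<theta> where "\<theta> = ?m (A \<inter> L s) / ?m A"
  have th: "0 < \<theta>" "\<theta> < 1" using posA sA by (auto simp: \<theta>_def divide_simps)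
  have mA: "?m (A \<inter> L s) = \<theta> * ?m A" "?m (A \<inter> U s) = (1 - \<theta>) * ?m A"
  proof -
    show "?m (A \<inter> L s) = \<theta> * ?m A" using A(4) by (simp add: \<theta>_def)
    then show "?m (A \<inter> U s) = (1 - \<theta>) * ?m A" using sA by (simp add: algebra_simps)
  qed
  obtain d where d: "?m (B \<inter> L d) = \<theta> * ?m B"
    using halfspace_bisect[OF B(3,2) i th] unfolding L_def by blast
  have mB: "?m (B \<inter> U d) = (1 - \<theta>) * ?m B"
    using halfspace_split[OF B(3) i, of d] d unfolding L_def U_def by (simp add: algebra_simps)
  have neB: "B \<inter> L d \<noteq> {}" "B \<inter> U d \<noteq> {}" using d mB th B(4) by (auto dest!: sym[of "measure _ _"])
  have GL: "box_family (cut G (L d))" and GU: "box_family (cut G (U d))"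
    using neB by (auto intro!: box_family_cut[OF G i] simp: B_def L_def U_def)
  have fin: "finite F" "finite G" using F G unfolding box_family_def by auto
  \<comment> \<open>The box on the far side of the hyperplane disappears from each half, so the
    number of boxes of \<open>F\<close> drops strictly, while that of \<open>G\<close> cannot
    grow.\<close>
  have cl: "card (cut F (L s)) < card F" by (rule card_cut_less[OF fin(1) XY(2)]) (use XY in \<open>force simp: L_def\<close>)
  have cu: "card (cut F (U s)) < card F" by (rule card_cut_less[OF fin(1) XY(1)]) (use XY in \<open>force simp: U_def\<close>)
  have "bm_ineq (A \<inter> L s) (B \<inter> L d)"
    using IH[OF FL GL] cl card_cut_le[OF fin(2), of "L d"] by (simp add: Union_cut A_def B_def)
  \<comment> \<open>Equal ratios let the \<open>n\<close>-th root of \<open>\<theta>\<close> factor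
    out of both roots. Together with the factor \<open>1 - \<theta>\<close> of the upper halves, the
    two lower bounds add up to the bound for the whole.\<close>
  then have 1: "\<theta> * (root ?n (?m A) + root ?n (?m B)) ^ ?n \<le> ?m (msum (A \<inter> L s) (B \<inter> L d))"
    unfolding bm_ineq_def mA d using th by (simp add: real_root_mult distrib_left[symmetric] power_mult_distrib)
  have "bm_ineq (A \<inter> U s) (B \<inter> U d)"
    using IH[OF FU GU] cu card_cut_le[OF fin(2), of "U d"] by (simp add: Union_cut A_def B_def)
  then have 2: "(1 - \<theta>) * (root ?n (?m A) + root ?n (?m B)) ^ ?n \<le> ?m (msum (A \<inter> U s) (B \<inter> U d))"
    unfolding bm_ineq_def mA mB using th by (simp add: real_root_mult distrib_left[symmetric] power_mult_distrib)
  have o: "open (L t)" "open (U t)" for t unfolding L_def U_def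
    by (auto simp: open_halfspace_component_lt open_halfspace_component_gt)
  have lm: "msum (A \<inter> L s) (B \<inter> L d) \<in> lmeasurable" "msum (A \<inter> U s) (B \<inter> U d) \<in> lmeasurable" "msum A B \<in> lmeasurable"
    using A B o by (auto intro!: lmeasurable_open open_msum bounded_msum)
  have "(root ?n (?m A) + root ?n (?m B)) ^ ?n \<le> ?m (msum (A \<inter> L s) (B \<inter> L d)) + ?m (msum (A \<inter> U s) (B \<inter> U d))"
    using 1 2 by (simp add: algebra_simps)
  also have "\<dots> = ?m (msum (A \<inter> L s) (B \<inter> L d) \<union> msum (A \<inter> U s) (B \<inter> U d))"
  proof -
    have "x \<bullet> i < s + d" if "x \<in> msum (A \<inter> L s) (B \<inter> L d)" for x
      using that by (auto simp: msum_def L_def inner_add_left)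
    moreover have "x \<bullet> i > s + d" if "x \<in> msum (A \<inter> U s) (B \<inter> U d)" for x
      using that by (auto simp: msum_def U_def inner_add_left)
    ultimately have "msum (A \<inter> L s) (B \<inter> L d) \<inter> msum (A \<inter> U s) (B \<inter> U d) = {}" by force
    then show ?thesis using lm by (simp add: measure_Un3)
  qed
  also have "\<dots> \<le> ?m (msum A B)"
    using lm by (intro measure_mono_fmeasurable) (auto simp: msum_def)
  finally show ?thesis unfolding bm_ineq_def A_def B_def .
qed

lemma bm_ineq_box_family:
  fixes F G :: "'a::euclidean_space set set"
  assumes "box_family F" "box_family G"
  shows "bm_ineq (\<Union>F) (\<Union>G)"
  using assms
proof (induction "card F + card G" arbitrary: F G rule: less_induct)
  case less
  have c: "card F \<ge> 1" "card G \<ge> 1"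
    using less.prems by (auto simp: box_family_def Suc_le_eq card_gt_0_iff)
  consider "card F = 1" "card G = 1" | "card F \<ge> 2" | "card G \<ge> 2" using c by linarith
  then show ?case
  proof cases
    case 1
    then obtain X Y where "F = {X}" "G = {Y}" by (meson card_1_singletonE)
    then show ?thesis using less.prems bm_ineq_box unfolding box_family_def
      by (metis ccpo_Sup_singleton singletonI)
  next
    case 2
    show ?thesis by (rule bm_ineq_step[OF less.prems 2]) (use less.hyps in blast)
  next
    case 3
    have "bm_ineq (\<Union>G) (\<Union>F)"
      by (rule bm_ineq_step[OF less.prems(2,1) 3]) (use less.hyps in \<open>simp add: add.commute\<close>)
    then show ?thesis by (simp add: bm_ineq_commute)
  qed
qed

text \<open>An open set is a countable union of closed boxes, and finite initial unions exhaust its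
  volume. Dividing such a union into non-overlapping boxes and passing to their interiors loses only
  finitely many null frontiers.\<close>

lemma open_inner_box_family:
  fixes S :: "'a::euclidean_space set"
  assumes S: "open S" "bounded S" "S \<noteq> {}" and e: "e > 0"
  obtains F where "box_family F" "\<Union>F \<subseteq> S" "measure lebesgue (\<Union>F) > measure lebesgue S - e"
proof -
  have lS: "S \<in> lmeasurable" using S by (simp add: lmeasurable_open)
  have mS: "measure lebesgue S > 0"
    using lS S open_not_negligible by (metis less_eq_real_def measure_nonneg negligible_iff_measure0)
  obtain D where D: "countable D" "D \<subseteq> Pow S" "\<And>X. X \<in> D \<Longrightarrow> \<exists>a b. X = cbox a b" "\<Union>D = S"
    using open_countable_Union_open_cbox[OF S(1)] by metis
  have Dne: "D \<noteq> {}" using D S by auto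
  define T where "T n = (\<Union>k\<le>n. from_nat_into D k)" for n :: nat
  have inD: "from_nat_into D k \<in> D" for k using Dne by (simp add: from_nat_into)
  have U: "(\<Union>n. T n) = S"
  proof -
    have "(\<Union>n. T n) = \<Union>(range (from_nat_into D))" unfolding T_def by blast
    then show ?thesis using D(4) range_from_nat_into[OF Dne D(1)] by simp
  qed
  have "(\<lambda>n. measure lebesgue (T n)) \<longlonglongrightarrow> measure lebesgue (\<Union>n. T n)"
  proof (rule Lim_measure_incseq)
    show "range T \<subseteq> sets lebesgue" unfolding T_def using inD D(3)
      by (auto intro!: sets.finite_UN) (metis lmeasurable_cbox fmeasurableD)+
    show "incseq T" unfolding T_def incseq_def by (auto intro: order_trans)
    show "emeasure lebesgue (\<Union>n. T n) \<noteq> \<infinity>" using fmeasurableD2[OF lS] unfolding U by simp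
  qed
  then have "eventually (\<lambda>n. measure lebesgue (T n) > max 0 (measure lebesgue S - e)) sequentially"
    unfolding U by (rule order_tendstoD) (use e mS in auto)
  then obtain n where n: "measure lebesgue (T n) > max 0 (measure lebesgue S - e)"
    by (auto simp: eventually_sequentially)
  have "finite (from_nat_into D ` {..n})" "\<And>X. X \<in> from_nat_into D ` {..n} \<Longrightarrow> \<exists>a b. X = cbox a b"
    using inD D(3) by auto
  then obtain p where p: "p division_of (\<Union>(from_nat_into D ` {..n}))"
    by (rule elementary_unions_intervals)
  then have p: "p division_of (T n)" by (simp add: T_def)
  define F where "F = (interior ` p) - {{}}"
  have Tn: "T n = \<Union>p" using p by auto
  have "T n - \<Union>F \<subseteq> (\<Union>X\<in>p. frontier X)"
  proof
    fix x assume x: "x \<in> T n - \<Union>F"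
    then obtain X where X: "X \<in> p" "x \<in> X" unfolding Tn by blast
    with x have "x \<notin> interior X" unfolding F_def by blast
    then have "x \<in> frontier X" using X closure_subset by (auto simp: frontier_def)
    then show "x \<in> (\<Union>X\<in>p. frontier X)" using X by blast
  qed
  moreover have "negligible (\<Union>X\<in>p. frontier X)"
  proof (rule negligible_Union)
    show "finite (frontier ` p)" using p by (simp add: division_of_finite)
    show "negligible t" if "t \<in> frontier ` p" for t
      using that division_ofD(4)[OF p] negligible_convex_frontier convex_box(1) by blast
  qed
  ultimately have neg: "negligible (T n - \<Union>F)" using negligible_subset by blast
  have sub: "\<Union>F \<subseteq> T n" unfolding Tn F_def using interior_subset by auto
  have TS: "T n \<subseteq> S" unfolding T_def using inD D(2) by auto
  have mT: "T n \<in> lmeasurable" using lmeasurable_division[OF p] by auto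
  have eq: "measure lebesgue (\<Union>F) = measure lebesgue (T n)"
    by (rule measure_negligible_symdiff[OF mT]) 
       (use neg sub in \<open>simp add: Diff_eq_empty_iff[THEN iffD2]\<close>)
  have "box_family F"
    unfolding box_family_def
  proof (intro conjI ballI)
    show "finite F" using p by (auto simp: F_def division_of_finite)
    show "F \<noteq> {}" using eq n by auto
    show "disjoint F" unfolding disjoint_def F_def using division_ofD(5)[OF p] by fastforce
    show "X \<noteq> {}" if "X \<in> F" for X using that by (simp add: F_def)
    show "\<exists>a b. X = box a b" if "X \<in> F" for X using that division_ofD(4)[OF p] by (force simp: F_def interior_cbox)
  qed
  moreover have "\<Union>F \<subseteq> S" using sub TS by auto
  moreover have "measure lebesgue (\<Union>F) > measure lebesgue S - e" using eq n by auto
  ultimately show ?thesis by (rule that)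
qed

text \<open>Box families inside \<open>A\<close> and \<open>B\<close> lose less than
  \<open>1 / (n + 1)\<close> of the volume each, while their sum stays inside
  \<open>msum A B\<close>; continuity of \<open>root\<close> removes the loss.\<close>

theorem brunn_minkowski_open:
  fixes A B :: "'a::euclidean_space set"
  assumes A: "open A" "bounded A" "A \<noteq> {}" and B: "open B" "bounded B" "B \<noteq> {}"
  shows "(root DIM('a) (measure lebesgue A) + root DIM('a) (measure lebesgue B)) ^ DIM('a)
     \<le> measure lebesgue (msum A B)"
proof -
  have "\<exists>F. box_family F \<and> \<Union>F \<subseteq> A \<and> measure lebesgue (\<Union>F) > measure lebesgue A - inverse (real (Suc n))" for n
    by (rule open_inner_box_family[OF A, of "inverse (real (Suc n))"]) auto
  then obtain F where F: "\<And>n. box_family (F n)" "\<And>n. \<Union>(F n) \<subseteq> A" "\<And>n. measure lebesgue (\<Union>(F n)) > measure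
      lebesgue A - inverse (real (Suc n))"
    by metis
  have "\<exists>F. box_family F \<and> \<Union>F \<subseteq> B \<and> measure lebesgue (\<Union>F) > measure lebesgue B - inverse (real (Suc n))" for n
    by (rule open_inner_box_family[OF B, of "inverse (real (Suc n))"]) auto
  then obtain G where G: "\<And>n. box_family (G n)" "\<And>n. \<Union>(G n) \<subseteq> B" "\<And>n. measure lebesgue (\<Union>(G n)) > measure
      lebesgue B - inverse (real (Suc n))"
    by metis
  have lm: "msum A B \<in> lmeasurable" using A B by (auto intro!: lmeasurable_open open_msum bounded_msum)
  have "(root DIM('a) (measure lebesgue A - inverse (real (Suc n))) + root DIM('a) (measure lebesgue B -
      inverse (real (Suc n)))) ^ DIM('a)
     \<le> measure lebesgue (msum A B)" 
    if n: "inverse (real (Suc n)) < measure lebesgue A" "inverse (real (Suc n)) < measure lebesgue B" for n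
  proof -
    have "(root DIM('a) (measure lebesgue A - inverse (real (Suc n))) + root DIM('a) (measure lebesgue B
        - inverse (real (Suc n)))) ^ DIM('a)
      \<le> (root DIM('a) (measure lebesgue (\<Union>(F n))) + root DIM('a) (measure lebesgue (\<Union>(G n)))) ^ DIM('a)"
      using F(3)[of n] G(3)[of n] n by (intro power_mono add_mono) (auto intro!: add_nonneg_nonneg real_root_ge_zero)
    also have "\<dots> \<le> measure lebesgue (msum (\<Union>(F n)) (\<Union>(G n)))"
      using bm_ineq_box_family[OF F(1) G(1)] unfolding bm_ineq_def .
    also have "\<dots> \<le> measure lebesgue (msum A B)"
      using F(1,2) G(1,2) by (intro measure_mono_fmeasurable lm msum_mono fmeasurableD[OF
          lmeasurable_open] open_msum bounded_msum box_family_measure)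
    finally show ?thesis .
  qed
  moreover have pos: "measure lebesgue A > 0" "measure lebesgue B > 0"
    using A B open_not_negligible by (metis less_eq_real_def lmeasurable_open measure_nonneg negligible_iff_measure0)+
  have ev: "eventually (\<lambda>n. inverse (real (Suc n)) < measure lebesgue A \<and> inverse (real (Suc n)) <
      measure lebesgue B) sequentially"
    using order_tendstoD(2)[OF LIMSEQ_inverse_real_of_nat] pos by (intro eventually_conj) blast+
  ultimately have ev2: "eventually (\<lambda>n. (root DIM('a) (measure lebesgue A - inverse (real (Suc n))) +
      root DIM('a) (measure lebesgue B - inverse (real (Suc n)))) ^ DIM('a)
     \<le> measure lebesgue (msum A B)) sequentially"
    by (auto elim: eventually_mono)
  have "(\<lambda>n. (root DIM('a) (measure lebesgue A - inverse (real (Suc n))) + root DIM('a) (measure lebesgue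
      B - inverse (real (Suc n)))) ^ DIM('a))
    \<longlonglongrightarrow> (root DIM('a) (measure lebesgue A - 0) + root DIM('a) (measure lebesgue B - 0)) ^ DIM('a)"
    by (intro tendsto_intros LIMSEQ_inverse_real_of_nat)
  from tendsto_upperbound[OF this ev2] show ?thesis by simp
qed

text \<open>Brunn-Minkowski for a set and its reflection: both have the same volume, and their sum
  lies in a ball whose radius is the diameter bound. Fattening by \<open>e\<close> makes the set
  open, adds \<open>2 * e\<close> to the bound and disappears in the limit.\<close>

lemma isodiametric:
  fixes S :: "'a::euclidean_space set"
  assumes S: "S \<in> sets lebesgue" "bounded S" and d: "\<And>x y. x \<in> S \<Longrightarrow> y \<in> S \<Longrightarrow> dist x y \<le> d" and d0: "0 \<le> d"
  shows "measure lebesgue S \<le> unit_ball_vol (real DIM('a)) / 2 ^ DIM('a) * d ^ DIM('a)"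
proof (cases "S = {}")
  case True
  then show ?thesis using d0 by simp
next
  case False
  let ?n = "DIM('a)"
  have main: "measure lebesgue S \<le> unit_ball_vol (real ?n) / 2 ^ ?n * (d + 2 * e) ^ ?n" if e: "e > 0" for e
  proof -
    define A where "A = (\<Union>x\<in>S. ball x e)"
    have oA: "open A" by (auto simp: A_def)
    have nA: "A \<noteq> {}" "S \<subseteq> A" using False e by (auto simp: A_def)
    have dA: "dist x y < d + 2 * e" if xy: "x \<in> A" "y \<in> A" for x y
    proof -
      obtain x' y' where "x' \<in> S" "y' \<in> S" "dist x' x < e" "dist y' y < e" using xy by (auto simp: A_def)
      moreover have "dist x y \<le> dist x x' + dist x' y' + dist y' y"
        by (meson add_right_mono dist_triangle dist_triangle_le order_trans)
      ultimately show ?thesis using d[of x' y'] by (simp add: dist_commute)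
    qed
    have bA: "bounded A" 
    proof -
      obtain x where "x \<in> A" using nA by auto
      then have "A \<subseteq> ball x (d + 2 * e)" using dA by auto
      then show ?thesis using bounded_ball bounded_subset by blast
    qed
    have lA: "A \<in> lmeasurable" using oA bA by (simp add: lmeasurable_open)
    define A' where "A' = uminus ` A"
    have A': "open A'" "bounded A'" "A' \<noteq> {}" using oA bA nA by (auto simp: A'_def open_negations)
    have mA': "measure lebesgue A' = measure lebesgue A"
      unfolding A'_def using measure_lebesgue_affine[of "-1" 0 A] by simp
    have "msum A A' \<subseteq> ball 0 (d + 2 * e)"
      using dA by (auto simp: msum_def A'_def dist_norm)
    then have "measure lebesgue (msum A A') \<le> measure lebesgue (ball (0::'a) (d + 2 * e))"
      using oA by (intro measure_mono_fmeasurable) (auto simp: open_msum)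
    also have "\<dots> = unit_ball_vol (real ?n) * (d + 2 * e) ^ ?n"
      using d0 e by (simp add: content_ball)
    finally have "(root ?n (measure lebesgue A) + root ?n (measure lebesgue A)) ^ ?n \<le> unit_ball_vol
        (real ?n) * (d + 2 * e) ^ ?n"
      using brunn_minkowski_open[OF oA bA nA(1) A'] mA' by simp
    then have "2 ^ ?n * measure lebesgue A \<le> unit_ball_vol (real ?n) * (d + 2 * e) ^ ?n"
      by (simp add: mult_2[symmetric] power_mult_distrib)
    moreover have "measure lebesgue S \<le> measure lebesgue A"
      using S lA nA by (intro measure_mono_fmeasurable) auto
    ultimately have "2 ^ ?n * measure lebesgue S \<le> unit_ball_vol (real ?n) * (d + 2 * e) ^ ?n"
      by (meson mult_left_mono order_trans zero_le_numeral zero_le_power)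
    then show ?thesis by (simp add: divide_simps mult.commute)
  qed
  have "((\<lambda>e. unit_ball_vol (real ?n) / 2 ^ ?n * (d + 2 * e) ^ ?n) \<longlongrightarrow> unit_ball_vol (real ?n) / 2 ^ ?n *
      (d + 2 * 0) ^ ?n) (at_right 0)"
    by (intro tendsto_intros)
  moreover have "eventually (\<lambda>e. measure lebesgue S \<le> unit_ball_vol (real ?n) / 2 ^ ?n * (d + 2 * e) ^
      ?n) (at_right 0)"
    using main by (auto intro: eventually_mono[OF eventually_at_right_less])
  ultimately have "measure lebesgue S \<le> unit_ball_vol (real ?n) / 2 ^ ?n * (d + 2 * 0) ^ ?n"
    by (rule tendsto_lowerbound) (simp add: trivial_limit_at_right_real)
  then show ?thesis by simp
qed

section \<open>Tilted means of a convex body\<close>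

text \<open>Exponential moments with a weight \<open>w\<close>. Differentiation in \<open>x\<close>
  only multiplies the weight by \<open>v \<bullet> y\<close>, so a single lemma differentiates both
  the partition function and the vector-valued first moment.\<close>

definition expint :: "'a::euclidean_space set \<Rightarrow> 'a \<Rightarrow> ('a \<Rightarrow> 'b::euclidean_space) \<Rightarrow> 'b" where
  "expint K x w = (LINT y|lborel. indicator K y *\<^sub>R (exp (x \<bullet> y) *\<^sub>R w y))"

lemma expint_integrable:
  fixes K :: "'a::euclidean_space set" and w :: "'a \<Rightarrow> 'b::euclidean_space"
  assumes "compact K" "continuous_on K w"
  shows "integrable lborel (\<lambda>y. indicator K y *\<^sub>R (exp (x \<bullet> y) *\<^sub>R w y))"
proof -
  have "continuous_on K (\<lambda>y. exp (x \<bullet> y) *\<^sub>R w y)" by (intro continuous_intros assms)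
  from borel_integrable_compact[OF assms(1) this] show ?thesis .
qed

lemma expint_add:
  assumes "compact K" "continuous_on K u" "continuous_on K w"
  shows "expint K x (\<lambda>y. u y + w y) = expint K x u + expint K x w"
  unfolding expint_def scaleR_add_right using assms by (intro Bochner_Integration.integral_add expint_integrable)

lemma expint_scaleR: "expint K x (\<lambda>y. c *\<^sub>R w y) = c *\<^sub>R expint K x w"
proof -
  have "expint K x (\<lambda>y. c *\<^sub>R w y) = (LINT y|lborel. c *\<^sub>R (indicator K y *\<^sub>R (exp (x \<bullet> y) *\<^sub>R w y)))"
    unfolding expint_def by (intro Bochner_Integration.integral_cong) (auto simp: mult_ac)
  also have "\<dots> = c *\<^sub>R expint K x w"
    unfolding expint_def by (rule integral_scaleR_right)
  finally show ?thesis .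
qed

lemma expint_inner:
  assumes "compact K" "continuous_on K w"
  shows "expint K x (\<lambda>y. v \<bullet> w y) = v \<bullet> expint K x w"
proof -
  have "expint K x (\<lambda>y. v \<bullet> w y) = (LINT y|lborel. v \<bullet> (indicator K y *\<^sub>R (exp (x \<bullet> y) *\<^sub>R w y)))"
    unfolding expint_def by (intro Bochner_Integration.integral_cong) auto
  also have "\<dots> = v \<bullet> expint K x w"
    unfolding expint_def by (intro integral_inner_right expint_integrable assms)
  finally show ?thesis .
qed

lemma expint_cong: "(\<And>y. y \<in> K \<Longrightarrow> u y = w y) \<Longrightarrow> expint K x u = expint K x w"
  unfolding expint_def by (intro Bochner_Integration.integral_cong) (auto simp: indicator_def)

lemma expint_nonneg:
  fixes w :: "'a::euclidean_space \<Rightarrow> real"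
  shows "(\<And>y. y \<in> K \<Longrightarrow> 0 \<le> w y) \<Longrightarrow> 0 \<le> expint K x w"
  unfolding expint_def by (intro Bochner_Integration.integral_nonneg) (auto simp: indicator_def)

text \<open>If the integral vanished, so would the integrand almost everywhere, and the nonempty
  interior of \<open>K\<close> would be covered by two null sets.\<close>

lemma expint_pos:
  fixes w :: "'a::euclidean_space \<Rightarrow> real"
  assumes K: "compact K" "interior K \<noteq> {}" and w: "continuous_on K w" "\<And>y. y \<in> K \<Longrightarrow> 0 \<le> w y"
    and neg: "negligible {y \<in> K. w y = 0}"
  shows "0 < expint K x w"
proof -
  have "expint K x w \<noteq> 0"
  proof
    assume "expint K x w = 0"
    then have "AE y in lborel. indicator K y *\<^sub>R (exp (x \<bullet> y) *\<^sub>R w y) = 0"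
      unfolding expint_def
      by (subst (asm) integral_nonneg_eq_0_iff_AE)
         (use expint_integrable[OF K(1) w(1)] w(2) in \<open>auto simp: indicator_def\<close>)
    then have "AE y in lebesgue. indicator K y *\<^sub>R (exp (x \<bullet> y) *\<^sub>R w y) = 0"
      by (rule AE_completion)
    then have "AE y in lebesgue. y \<notin> K \<or> w y = 0"
      by (rule AE_mp) (auto simp: indicator_def split: if_splits)
    then have "negligible {y. \<not> (y \<notin> K \<or> w y = 0)}"
      by (simp add: completion.AE_iff_null_sets negligible_iff_null_sets null_sets_completion_subset
          eventually_ae_filter)
        (metis (no_types, lifting) null_sets_completion_subset)
    then have "negligible ({y. \<not> (y \<notin> K \<or> w y = 0)} \<union> {y \<in> K. w y = 0})"
      using neg by (rule negligible_Un)
    moreover have "interior K \<subseteq> {y. \<not> (y \<notin> K \<or> w y = 0)} \<union> {y \<in> K. w y = 0}"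
      using interior_subset by auto
    ultimately show False using K(2) negligible_subset open_interior open_not_negligible by blast
  qed
  then show ?thesis using expint_nonneg[of K w x, OF w(2)] by simp
qed

lemma exp_Taylor_bound:
  fixes s :: real assumes "\<bar>s\<bar> \<le> M"
  shows "\<bar>exp s - 1 - s\<bar> \<le> exp M * s\<^sup>2"
proof -
  obtain t where t: "\<bar>t\<bar> \<le> \<bar>s\<bar>" "exp s = (\<Sum>m<2. (s ^ m) / fact m) + (exp t / fact 2) * s ^ 2"
    using Maclaurin_exp_le by blast
  then have "exp s - 1 - s = exp t / 2 * s\<^sup>2" by (simp add: numeral_2_eq_2)
  then have "\<bar>exp s - 1 - s\<bar> = exp t / 2 * s\<^sup>2" by (simp only: abs_mult) simp
  also have "\<dots> \<le> exp M * s\<^sup>2"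
  proof (rule mult_right_mono)
    have "exp t \<le> exp M" using t(1) assms by simp
    then show "exp t / 2 \<le> exp M" using exp_ge_zero[of t] by linarith
  qed simp
  finally show ?thesis .
qed

text \<open>The increment of the integrand is \<open>exp (x \<bullet> y) *\<^sub>R w y\<close> times
  \<open>exp (v \<bullet> y) - 1\<close>. On the compact set \<open>v \<bullet> y\<close> is bounded
  for \<open>norm v \<le> 1\<close>, so Taylor's remainder is uniformly quadratic in
  \<open>v\<close>.\<close>

lemma expint_has_derivative:
  fixes K :: "'a::euclidean_space set" and w :: "'a \<Rightarrow> 'b::euclidean_space"
  assumes K: "compact K" and w: "continuous_on K w"
  shows "((\<lambda>x. expint K x w) has_derivative (\<lambda>v. expint K x (\<lambda>y. (v \<bullet> y) *\<^sub>R w y))) (at x)"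
proof -
  obtain M where M: "M > 0" "\<And>y. y \<in> K \<Longrightarrow> norm y \<le> M"
    using compact_imp_bounded[OF K] bounded_pos by blast
  obtain B where B: "B > 0" "\<And>y. y \<in> K \<Longrightarrow> norm (exp (x \<bullet> y) *\<^sub>R w y) \<le> B"
  proof -
    have "compact ((\<lambda>y. exp (x \<bullet> y) *\<^sub>R w y) ` K)"
      using K w by (intro compact_continuous_image continuous_intros)
    then show ?thesis using that compact_imp_bounded bounded_pos by (metis (no_types, lifting) imageI)
  qed
  have cw: "continuous_on K (\<lambda>y. (v \<bullet> y) *\<^sub>R w y)" for v using w by (intro continuous_intros)
  define C where "C = exp M * M\<^sup>2 * B * measure lborel K"
  have bnd: "norm (expint K (x + v) w - expint K x w - expint K x (\<lambda>y. (v \<bullet> y) *\<^sub>R w y)) \<le> C * (norm v)\<^sup>2"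
    if v: "norm v \<le> 1" for v
  proof -
    let ?f = "\<lambda>y. indicator K y *\<^sub>R (exp ((x + v) \<bullet> y) *\<^sub>R w y) - indicator K y *\<^sub>R (exp (x \<bullet> y) *\<^sub>R w y)
      - indicator K y *\<^sub>R (exp (x \<bullet> y) *\<^sub>R ((v \<bullet> y) *\<^sub>R w y))"
    have fi: "integrable lborel ?f"
      using expint_integrable[OF K w] expint_integrable[OF K cw] by (intro Bochner_Integration.integrable_diff)
    have ik: "integrable lborel (indicator K :: 'a \<Rightarrow> real)"
      using emeasure_compact_finite[OF K] K by (intro integrable_real_indicator) (auto simp: compact_imp_closed)
    have "expint K (x + v) w - expint K x w - expint K x (\<lambda>y. (v \<bullet> y) *\<^sub>R w y) = integral\<^sup>L lborel ?f"
      unfolding expint_def using expint_integrable[OF K w] expint_integrable[OF K cw] by simp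
    then have "norm (expint K (x + v) w - expint K x w - expint K x (\<lambda>y. (v \<bullet> y) *\<^sub>R w y)) = norm
        (integral\<^sup>L lborel ?f)"
      by (rule arg_cong)
    also have "\<dots> \<le> (LINT y|lborel. norm (?f y))"
      by (rule integral_norm_bound)
    also have "\<dots> \<le> (LINT y|lborel. (exp M * M\<^sup>2 * B * (norm v)\<^sup>2) * indicator K y)"
    proof (rule integral_mono)
      show "integrable lborel (\<lambda>y. norm (?f y))" using fi by (rule integrable_norm)
      show "integrable lborel (\<lambda>y. (exp M * M\<^sup>2 * B * (norm v)\<^sup>2) * indicator K y)"
        using ik by simp
      fix y
      show "norm (?f y) \<le> (exp M * M\<^sup>2 * B * (norm v)\<^sup>2) * indicator K y"
      proof (cases "y \<in> K")
        case True
        have "?f y = (exp (v \<bullet> y) - 1 - v \<bullet> y) *\<^sub>R (exp (x \<bullet> y) *\<^sub>R w y)"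
        proof -
          have "exp ((x + v) \<bullet> y) *\<^sub>R w y = exp (v \<bullet> y) *\<^sub>R (exp (x \<bullet> y) *\<^sub>R w y)"
            by (simp add: inner_add_left exp_add mult.commute)
          moreover have "(v \<bullet> y) *\<^sub>R (exp (x \<bullet> y) *\<^sub>R w y) = exp (x \<bullet> y) *\<^sub>R ((v \<bullet> y) *\<^sub>R w y)"
            by (simp add: mult.commute)
          ultimately show ?thesis
            using True by (simp only: scaleR_left_diff_distrib scaleR_one indicator_simps)
        qed
        then have "norm (?f y) = \<bar>exp (v \<bullet> y) - 1 - v \<bullet> y\<bar> * norm (exp (x \<bullet> y) *\<^sub>R w y)"
          by (simp only: norm_scaleR)
        also have "\<dots> \<le> (exp M * (norm v * M)\<^sup>2) * B"
        proof (rule mult_mono[OF _ B(2)[OF True]])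
          have vy: "\<bar>v \<bullet> y\<bar> \<le> norm v * M"
            using Cauchy_Schwarz_ineq2[of v y] mult_left_mono[OF M(2)[OF True], of "norm v"] by simp
          have "norm v * M \<le> M" using v M(1) by (intro mult_left_le_one_le) auto
          with vy have "\<bar>v \<bullet> y\<bar> \<le> M" by linarith
          then have "\<bar>exp (v \<bullet> y) - 1 - v \<bullet> y\<bar> \<le> exp M * (v \<bullet> y)\<^sup>2" by (rule exp_Taylor_bound)
          also have "\<dots> \<le> exp M * (norm v * M)\<^sup>2"
            using vy M(1) by (intro mult_left_mono) (simp_all add: abs_le_square_iff[symmetric] abs_mult)
          finally show "\<bar>exp (v \<bullet> y) - 1 - v \<bullet> y\<bar> \<le> exp M * (norm v * M)\<^sup>2" .
        qed auto
        finally have "norm (?f y) \<le> (exp M * (norm v * M)\<^sup>2) * B" .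
        moreover have "(exp M * (norm v * M)\<^sup>2) * B = (exp M * M\<^sup>2 * B * (norm v)\<^sup>2) * indicator K y"
          using True by (simp add: power_mult_distrib)
        ultimately show ?thesis by (simp only:)
      qed simp
    qed
    also have "\<dots> = C * (norm v)\<^sup>2" by (simp add: C_def mult_ac)
    finally show ?thesis .
  qed
  have lin: "linear (\<lambda>v. expint K x (\<lambda>y. (v \<bullet> y) *\<^sub>R w y))"
  proof (rule linearI)
    fix u v :: 'a and c :: real
    show "expint K x (\<lambda>y. ((u + v) \<bullet> y) *\<^sub>R w y) = expint K x (\<lambda>y. (u \<bullet> y) *\<^sub>R w y) + expint K x (\<lambda>y. (v
        \<bullet> y) *\<^sub>R w y)"
      unfolding inner_add_left scaleR_add_left by (intro expint_add K cw)
    show "expint K x (\<lambda>y. ((c *\<^sub>R u) \<bullet> y) *\<^sub>R w y) = c *\<^sub>R expint K x (\<lambda>y. (u \<bullet> y) *\<^sub>R w y)"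
      unfolding expint_scaleR[symmetric] by simp
  qed
  show ?thesis
  proof (rule has_derivativeI_sandwich[where e=1 and H="\<lambda>y. C * norm (y - x)"])
    show "bounded_linear (\<lambda>v. expint K x (\<lambda>y. (v \<bullet> y) *\<^sub>R w y))"
      using lin by (simp add: linear_conv_bounded_linear)
    show "((\<lambda>y. C * norm (y - x)) \<longlongrightarrow> 0) (at x)"
      by (auto intro!: tendsto_eq_intros)
    fix z assume z: "z \<noteq> x" "dist z x < 1"
    show "norm (expint K z w - expint K x w - expint K x (\<lambda>y. ((z - x) \<bullet> y) *\<^sub>R w y)) / norm (z - x) \<le> C
        * norm (z - x)"
      using bnd[of "z - x"] z by (simp add: dist_norm divide_simps power2_eq_square mult_ac)
  qed auto
qed

section \<open>Partition function, tilted mean and covariance\<close>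

definition partition_fun :: "'a::euclidean_space set \<Rightarrow> 'a \<Rightarrow> real" where
  "partition_fun K x = expint K x (\<lambda>y. 1)"

text \<open>
  The mean and the covariance of the probability measure on \<open>K\<close> with density proportional to
  \<open>exp (x \<bullet> y)\<close> are the gradient and the Hessian of \<open>ln (partition_fun K x)\<close>. The gradient map
  will serve as an injective differentiable parametrization of \<open>K\<close> up to its boundary.
\<close>
definition tilted_mean :: "'a::euclidean_space set \<Rightarrow> 'a \<Rightarrow> 'a" where
  "tilted_mean K x = inverse (partition_fun K x) *\<^sub>R expint K x (\<lambda>y. y)"

definition tilted_cov :: "'a::euclidean_space set \<Rightarrow> 'a \<Rightarrow> 'a \<Rightarrow> 'a" where
  "tilted_cov K x v = inverse (partition_fun K x) *\<^sub>R expint K x (\<lambda>y. (v \<bullet> y) *\<^sub>R y)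
     - ((v \<bullet> tilted_mean K x)) *\<^sub>R tilted_mean K x"

context
  fixes K :: "'a::euclidean_space set"
  assumes K: "compact K" "convex K" "interior K \<noteq> {}"
begin

lemma partition_fun_pos: "partition_fun K x > 0"
  unfolding partition_fun_def using K by (intro expint_pos) auto

lemma partition_fun_deriv:
  "(partition_fun K has_derivative (\<lambda>v. partition_fun K x * (v \<bullet> tilted_mean K x))) (at x)"
proof -
  have "partition_fun K = (\<lambda>x. expint K x (\<lambda>y. 1::real))" by (auto simp: partition_fun_def)
  moreover have "expint K x (\<lambda>y. (v \<bullet> y) *\<^sub>R (1::real)) = partition_fun K x * (v \<bullet> tilted_mean K x)" for v
    using expint_inner[OF K(1), of "\<lambda>y. y" x v] partition_fun_pos[of x]
    by (simp add: tilted_mean_def less_imp_neq[THEN not_sym])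
  ultimately show ?thesis
    using expint_has_derivative[OF K(1), of "\<lambda>y. 1::real" x] by simp
qed

lemma ln_partition_fun_deriv:
  "((\<lambda>x. ln (partition_fun K x)) has_derivative (\<lambda>v. v \<bullet> tilted_mean K x)) (at x)"
  using has_derivative_ln[OF partition_fun_pos partition_fun_deriv, of x] partition_fun_pos[of x]
  by (simp add: field_simps)

lemma tilted_mean_deriv: "(tilted_mean K has_derivative tilted_cov K x) (at x)"
proof -
  have Z: "partition_fun K x \<noteq> 0" using partition_fun_pos[of x] by simp
  have eq: "tilted_mean K = (\<lambda>x. inverse (partition_fun K x) *\<^sub>R expint K x (\<lambda>y. y))"
    by (auto simp: tilted_mean_def)
  have "((\<lambda>x. inverse (partition_fun K x) *\<^sub>R expint K x (\<lambda>y. y)) has_derivative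
     (\<lambda>v. inverse (partition_fun K x) *\<^sub>R expint K x (\<lambda>y. (v \<bullet> y) *\<^sub>R y) +
      (- (inverse (partition_fun K x) * (partition_fun K x * (v \<bullet> tilted_mean K x)) * inverse
          (partition_fun K x))) *\<^sub>R expint K x (\<lambda>y. y))) (at x)"
    by (rule has_derivative_scaleR[OF Deriv.has_derivative_inverse[OF Z partition_fun_deriv]
        expint_has_derivative[OF K(1) continuous_on_id]])
  moreover have "(\<lambda>v. inverse (partition_fun K x) *\<^sub>R expint K x (\<lambda>y. (v \<bullet> y) *\<^sub>R y) +
      (- (inverse (partition_fun K x) * (partition_fun K x * (v \<bullet> tilted_mean K x)) * inverse
          (partition_fun K x))) *\<^sub>R expint K x (\<lambda>y. y)) = tilted_cov K x"
    using Z by (auto simp: fun_eq_iff tilted_cov_def tilted_mean_def)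
  ultimately show ?thesis by (simp add: eq)
qed

text \<open>The quadratic form of the covariance is the variance of the functional
  \<open>v \<bullet> y\<close>. It could vanish only if the functional were constant almost
  everywhere on \<open>K\<close>, but its level sets are hyperplanes, hence null.\<close>

lemma tilted_cov_pos:
  assumes "v \<noteq> 0" shows "v \<bullet> tilted_cov K x v > 0"
proof -
  define Z where "Z = partition_fun K x"
  define c where "c = v \<bullet> tilted_mean K x"
  have Z: "Z > 0" unfolding Z_def by (rule partition_fun_pos)
  have "0 < expint K x (\<lambda>y. (v \<bullet> y - c)\<^sup>2)"
  proof (rule expint_pos[OF K(1,3)])
    show "continuous_on K (\<lambda>y. (v \<bullet> y - c)\<^sup>2)" by (intro continuous_intros)
    show "negligible {y \<in> K. (v \<bullet> y - c)\<^sup>2 = 0}"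
    proof (rule negligible_subset)
      show "negligible {y. v \<bullet> y = c}" using assms by (simp add: negligible_hyperplane)
    qed auto
  qed auto
  also have "expint K x (\<lambda>y. (v \<bullet> y - c)\<^sup>2) = expint K x (\<lambda>y. (v \<bullet> y) * (v \<bullet> y) + ((- 2 * c) *\<^sub>R (v \<bullet> y)
      + c\<^sup>2 *\<^sub>R 1))"
    by (intro expint_cong) (simp add: power2_eq_square algebra_simps)
  also have "\<dots> = expint K x (\<lambda>y. (v \<bullet> y) * (v \<bullet> y)) + ((- 2 * c) *\<^sub>R expint K x (\<lambda>y. v \<bullet> y) + c\<^sup>2 *\<^sub>R
      expint K x (\<lambda>y. 1))"
    using K(1) by (simp only: expint_scaleR expint_add continuous_intros)
  also have "expint K x (\<lambda>y. (v \<bullet> y) * (v \<bullet> y)) = v \<bullet> expint K x (\<lambda>y. (v \<bullet> y) *\<^sub>R y)"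
    using expint_inner[OF K(1), of "\<lambda>y. (v \<bullet> y) *\<^sub>R y" x v] by (simp add: continuous_intros)
  also have "expint K x (\<lambda>y. v \<bullet> y) = c * Z"
    using expint_inner[OF K(1), of "\<lambda>y. y" x v] Z unfolding c_def Z_def tilted_mean_def by (simp add:
        continuous_intros)
  also have "expint K x (\<lambda>y. 1) = Z" by (simp add: Z_def partition_fun_def)
  finally have "v \<bullet> expint K x (\<lambda>y. (v \<bullet> y) *\<^sub>R y) - c\<^sup>2 * Z > 0"
    by (simp add: power2_eq_square algebra_simps)
  then have "(v \<bullet> expint K x (\<lambda>y. (v \<bullet> y) *\<^sub>R y) - c\<^sup>2 * Z) / Z > 0" using Z by simp
  moreover have "v \<bullet> tilted_cov K x v = (v \<bullet> expint K x (\<lambda>y. (v \<bullet> y) *\<^sub>R y) - c\<^sup>2 * Z) / Z"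
    using Z unfolding tilted_cov_def Z_def[symmetric] 
    by (simp add: inner_diff_right c_def[symmetric] power2_eq_square field_simps)
  ultimately show ?thesis by simp
qed

text \<open>A hyperplane separating the mean from \<open>K\<close> would give a linear functional a
  mean below all its values on \<open>K\<close>.\<close>

lemma tilted_mean_in: "tilted_mean K x \<in> K"
proof (rule ccontr)
  assume "tilted_mean K x \<notin> K"
  then obtain a b where ab: "a \<bullet> tilted_mean K x < b" "\<And>y. y \<in> K \<Longrightarrow> b < a \<bullet> y"
    using separating_hyperplane_closed_point[OF K(2) compact_imp_closed[OF K(1)]] by blast
  have "0 \<le> expint K x (\<lambda>y. a \<bullet> y + (- b) *\<^sub>R 1)"
    by (intro expint_nonneg) (use ab in \<open>auto simp: less_imp_le\<close>)
  also have "\<dots> = expint K x (\<lambda>y. a \<bullet> y) + (- b) *\<^sub>R expint K x (\<lambda>y. 1)"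
    using K(1) by (simp only: expint_scaleR expint_add continuous_intros)
  also have "\<dots> = a \<bullet> expint K x (\<lambda>y. y) - b * partition_fun K x"
    using expint_inner[OF K(1), of "\<lambda>y. y" x a] by (simp add: partition_fun_def continuous_intros)
  also have "\<dots> = partition_fun K x * (a \<bullet> tilted_mean K x - b)"
    using partition_fun_pos[of x] by (simp add: tilted_mean_def field_simps)
  finally show False using ab(1) partition_fun_pos[of x] by (simp add: zero_le_mult_iff)
qed

text \<open>Coercivity of the potential minimized in \<open>tmap_surj\<close>: the tilt by
  \<open>x \<bullet> a\<close> is outweighed because \<open>K\<close> extends a fixed distance
  beyond the interior point \<open>a\<close> in the direction of \<open>x\<close>.\<close>

lemma ln_partition_fun_coercive:
  assumes a: "a \<in> interior K"
  obtains r c where "r > 0" "\<And>x. ln (partition_fun K x) \<ge> x \<bullet> a + r * norm x + c"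
proof -
  obtain R where R: "R > 0" "cball a R \<subseteq> K"
    using a by (meson mem_interior_cball)
  define r where "r = R / 2"
  have r: "r > 0" "cball a (2 * r) \<subseteq> K" using R by (auto simp: r_def)
  have "ln (partition_fun K x) \<ge> x \<bullet> a + r * norm x + ln (measure lborel (ball (0::'a) (r / 2)))" for x
  proof -
    \<comment> \<open>For nonzero \<open>x\<close> this ball lies between the distances
      \<open>r\<close> and \<open>2 * r\<close> beyond \<open>a\<close> in direction
      \<open>x\<close>. Its volume, which supplies the constant, does not depend on
      \<open>x\<close>.\<close>
    define B where "B = ball (a + (3 / 2 * r) *\<^sub>R sgn x) (r / 2)"
    have y: "x \<bullet> y \<ge> x \<bullet> a + r * norm x" "y \<in> K" if "y \<in> B" for y
    proof -
      define z where "z = y - a - (3 / 2 * r) *\<^sub>R sgn x"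
      have z: "norm z < r / 2" using that by (simp add: z_def B_def dist_norm norm_minus_commute algebra_simps)
      have yz: "y = a + (3 / 2 * r) *\<^sub>R sgn x + z" by (simp add: z_def)
      have xs: "x \<bullet> sgn x = norm x" 
        by (cases "x = 0") (auto simp: sgn_div_norm power2_norm_eq_inner[symmetric] power2_eq_square)
      have "x \<bullet> z \<ge> - (norm x * norm z)" using Cauchy_Schwarz_ineq2[of x z] by linarith
      moreover have "norm x * norm z \<le> norm x * (r / 2)" using z by (intro mult_left_mono) auto
      ultimately show "x \<bullet> y \<ge> x \<bullet> a + r * norm x"
        unfolding yz inner_add_right inner_scaleR_right xs by (simp add: algebra_simps)
      have "norm (y - a) \<le> norm ((3 / 2 * r) *\<^sub>R sgn x) + norm z"
        using norm_triangle_ineq[of "(3 / 2 * r) *\<^sub>R sgn x" z] by (simp add: yz)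
      also have "\<dots> \<le> 3 / 2 * r + r / 2" using z r(1) by (intro add_mono) (auto simp: norm_sgn)
      finally have "y \<in> cball a (2 * r)" by (simp add: dist_norm norm_minus_commute)
      then show "y \<in> K" using r by auto
    qed
    have "exp (x \<bullet> a + r * norm x) * measure lborel (ball (0::'a) (r / 2)) = (LINT y|lborel. exp (x \<bullet> a +
        r * norm x) * indicator B y)"
      using r by (simp add: B_def content_ball)
    also have "\<dots> \<le> partition_fun K x"
      unfolding partition_fun_def expint_def
    proof (rule integral_mono)
      show "integrable lborel (\<lambda>y. exp (x \<bullet> a + r * norm x) * indicator B y)"
        unfolding B_def by (intro integrable_mult_right integrable_real_indicator emeasure_bounded_finite
            bounded_ball) auto
      show "integrable lborel (\<lambda>y. indicator K y *\<^sub>R exp (x \<bullet> y) *\<^sub>R (1::real))"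
        by (rule expint_integrable[OF K(1)]) simp
      show "exp (x \<bullet> a + r * norm x) * indicator B y \<le> indicator K y *\<^sub>R exp (x \<bullet> y) *\<^sub>R 1" for y
        using y[of y] by (auto simp: indicator_def)
    qed
    finally have *: "exp (x \<bullet> a + r * norm x) * measure lborel (ball (0::'a) (r / 2)) \<le> partition_fun K x" .
    have m: "measure lborel (ball (0::'a) (r / 2)) > 0" using r by (simp add: content_ball)
    have "ln (exp (x \<bullet> a + r * norm x) * measure lborel (ball (0::'a) (r / 2))) \<le> ln (partition_fun K x)"
      using * m by (subst ln_le_cancel_iff) (auto simp: partition_fun_pos)
    then show ?thesis using m by (simp add: ln_mult)
  qed
  then show ?thesis using that r(1) by blast
qed

end

section \<open>The relative Steiner polynomial\<close>

text \<open>Along the segment from the identity to \<open>f\<close> every map \<open>h\<close>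
  satisfies \<open>v \<bullet> h v > 0\<close> for nonzero \<open>v\<close> and is therefore
  injective. The determinant starts at 1 and never vanishes, so it keeps its sign.\<close>

lemma det_pos_of_positive:
  fixes f :: "real^'n \<Rightarrow> real^'n"
  assumes f: "linear f" and pos: "\<And>v. v \<noteq> 0 \<Longrightarrow> v \<bullet> f v > 0"
  shows "det (matrix f) > 0"
proof (rule ccontr)
  assume neg: "\<not> det (matrix f) > 0"
  define g where "g s = det (\<chi> i j. (1 - s) * (mat 1 :: real^'n^'n) $ i $ j + s * matrix f $ i $ j)" for s :: real
  have "continuous_on {0..1} g" unfolding g_def det_def by (simp, intro continuous_intros)
  moreover have "g 0 = 1" unfolding g_def by (simp add: vec_nth_inverse det_I flip: vec_eq_iff)
  moreover have "g 1 = det (matrix f)" unfolding g_def by simp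
  ultimately obtain s where s: "0 \<le> s" "s \<le> 1" "g s = 0"
    using IVT2'[of g 1 0 0] neg by auto
  define h where "h v = (1 - s) *\<^sub>R v + s *\<^sub>R f v" for v
  have lh: "linear h" unfolding h_def using f
    by (intro linear_compose_add linear_compose_scale_right linear_id[unfolded id_def])
  have "matrix h = (\<chi> i j. (1 - s) * (mat 1 :: real^'n^'n) $ i $ j + s * matrix f $ i $ j)"
    by (auto simp: vec_eq_iff matrix_def h_def mat_def axis_def)
  then have "det (matrix h) = 0" using s(3) by (simp add: g_def)
  then have "\<not> inj h" using det_nz_iff_inj[OF lh] by simp
  then obtain v where v: "h v = 0" "v \<noteq> 0" using linear_injective_0[OF lh] by blast
  have "v \<bullet> h v = (1 - s) * (v \<bullet> v) + s * (v \<bullet> f v)" by (simp add: h_def inner_add_right)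
  moreover have "v \<bullet> v > 0" "v \<bullet> f v > 0" using v pos by auto
  ultimately have "v \<bullet> h v > 0" using s(1,2)
    by (cases "s = 0") (auto intro!: add_nonneg_pos mult_pos_pos)
  then show False using v by simp
qed

section \<open>Cubic polynomials in the parameter of the sum\<close>

definition cubic_poly :: "(real \<Rightarrow> real) \<Rightarrow> bool" where
  "cubic_poly f \<longleftrightarrow> (\<exists>a b c d. \<forall>t. f t = a + b * t + c * t^2 + d * t^3)"

lemma cubic_poly_prod: "cubic_poly (\<lambda>t. (a1 + t * b1) * (a2 + t * b2) * (a3 + t * b3))"
  unfolding cubic_poly_def
  by (rule exI[of _ "a1*a2*a3"], rule exI[of _ "b1*a2*a3 + a1*b2*a3 + a1*a2*b3"],
      rule exI[of _ "b1*b2*a3 + b1*a2*b3 + a1*b2*b3"], rule exI[of _ "b1*b2*b3"])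
     (auto simp: algebra_simps power2_eq_square power3_eq_cube)

lemma cubic_poly_add: 
  assumes "cubic_poly f" "cubic_poly g" shows "cubic_poly (\<lambda>t. f t + g t)"
proof -
  obtain a b c d a' b' c' d' where "\<And>t. f t = a + b * t + c * t^2 + d * t^3" "\<And>t. g t = a' + b' * t + c'
      * t^2 + d' * t^3"
    using assms unfolding cubic_poly_def by metis
  then show ?thesis unfolding cubic_poly_def
    by (intro exI[of _ "a + a'"] exI[of _ "b + b'"] exI[of _ "c + c'"] exI[of _ "d + d'"]) (auto simp: algebra_simps)
qed

lemma cubic_poly_diff: 
  assumes "cubic_poly f" "cubic_poly g" shows "cubic_poly (\<lambda>t. f t - g t)"
proof -
  obtain a b c d a' b' c' d' where "\<And>t. f t = a + b * t + c * t^2 + d * t^3" "\<And>t. g t = a' + b' * t + c'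
      * t^2 + d' * t^3"
    using assms unfolding cubic_poly_def by metis
  then show ?thesis unfolding cubic_poly_def
    by (intro exI[of _ "a - a'"] exI[of _ "b - b'"] exI[of _ "c - c'"] exI[of _ "d - d'"]) (auto simp: algebra_simps)
qed

lemma cubic_poly_det:
  fixes A B :: "real^3^3"
  shows "cubic_poly (\<lambda>t. det (\<chi> i j. A $ i $ j + t * B $ i $ j))"
  unfolding det_3 by (simp, intro cubic_poly_add cubic_poly_diff cubic_poly_prod)

text \<open>Lagrange interpolation at the nodes 0, 1, 2, 3. Its weights depend on \<open>t\<close>
  alone, so the identity can be integrated over a whole family of cubics.\<close>

lemma cubic_poly_interpolation:
  assumes "cubic_poly f"
  shows "f t = ((1-t)*(2-t)*(3-t)/6) * f 0 + (t*(2-t)*(3-t)/2) * f 1 + (- (t*(1-t)*(3-t)/2)) * f 2 +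
      (t*(1-t)*(2-t)/6) * f 3"
proof -
  obtain a b c d where f: "\<And>t. f t = a + b * t + c * t^2 + d * t^3"
    using assms unfolding cubic_poly_def by metis
  show ?thesis unfolding f by (simp add: power2_eq_square power3_eq_cube field_simps)
qed

text \<open>The sum of the interiors is open and convex, and its closure contains
  \<open>K + t L\<close>. A convex set has a null frontier, so every set in between has the same
  volume; this serves for \<open>K + t L\<close> itself and for the range of its
  parametrization.\<close>

lemma msum_interior_volume:
  fixes K L :: "'a::euclidean_space set"
  assumes K: "compact K" "convex K" "interior K \<noteq> {}" and L: "compact L" "convex L" "interior L \<noteq> {}"
    and S: "msum (interior K) ((*\<^sub>R) t ` interior L) \<subseteq> S" "S \<subseteq> {x + t *\<^sub>R y | x y. x \<in> K \<and> y \<in> L}"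
  shows "S \<in> lmeasurable" "measure lebesgue S = measure lebesgue (msum (interior K) ((*\<^sub>R) t ` interior L))"
proof -
  define Q where "Q = msum (interior K) ((*\<^sub>R) t ` interior L)"
  have oQ: "open Q" unfolding Q_def by (rule open_msum) simp
  have eq: "Q = (\<Union>x\<in>interior K. \<Union>y\<in>(*\<^sub>R) t ` interior L. {x + y})" by (auto simp: Q_def msum_def)
  have cQ: "convex Q" unfolding eq using K L by (intro convex_sums convex_interior convex_scaling)
  have "bounded K" "bounded L" using K L compact_imp_bounded by auto
  then have bQ: "bounded Q" unfolding Q_def
    by (intro bounded_msum bounded_scaling) (auto intro: bounded_interior)
  have lQ: "Q \<in> lmeasurable" using oQ bQ by (simp add: lmeasurable_open)
  have sub: "{x + t *\<^sub>R y | x y. x \<in> K \<and> y \<in> L} \<subseteq> closure Q"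
  proof clarify
    fix x y assume xy: "x \<in> K" "y \<in> L"
    have "x \<in> closure (interior K)" "y \<in> closure (interior L)"
      using xy K L convex_closure_interior closure_subset by blast+
    then obtain X Y where X: "\<And>n. X n \<in> interior K" "X \<longlonglongrightarrow> x" and Y: "\<And>n. Y n \<in> interior L" "Y \<longlonglongrightarrow> y"
      unfolding closure_sequential by metis
    have "(\<lambda>n. X n + t *\<^sub>R Y n) \<longlonglongrightarrow> x + t *\<^sub>R y" by (intro tendsto_intros X Y)
    moreover have "X n + t *\<^sub>R Y n \<in> Q" for n
      unfolding Q_def msum_def using X(1)[of n] imageI[OF Y(1)[of n], of "(*\<^sub>R) t"] by blast
    ultimately show "x + t *\<^sub>R y \<in> closure Q"
      unfolding closure_sequential by (intro exI[of _ "\<lambda>n. X n + t *\<^sub>R Y n"]) simp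
  qed
  have neg: "negligible (sym_diff Q S)"
  proof (rule negligible_subset)
    show "negligible (frontier Q)" using cQ by (rule negligible_convex_frontier)
    show "sym_diff Q S \<subseteq> frontier Q"
      using S sub oQ unfolding frontier_def Q_def[symmetric] by (auto simp: interior_open)
  qed
  show "S \<in> lmeasurable" "measure lebesgue S = measure lebesgue (msum (interior K) ((*\<^sub>R) t ` interior L))"
    unfolding Q_def[symmetric]
    using lmeasurable_negligible_symdiff[OF lQ neg] measure_negligible_symdiff[OF lQ neg] by auto
qed

section \<open>Parametrization of \<open>K + t L\<close> by gradient maps\<close>

context
  fixes K L :: "(real^3) set"
  assumes K: "compact K" "convex K" "interior K \<noteq> {}" and L: "compact L" "convex L" "interior L \<noteq> {}"
begin

definition "tmap t x = tilted_mean K x + t *\<^sub>R tilted_mean L x"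
definition "tjac t x v = tilted_cov K x v + t *\<^sub>R tilted_cov L x v"

lemma tmap_deriv: "(tmap t has_derivative tjac t x) (at x within S)"
  unfolding tmap_def[abs_def] tjac_def[abs_def]
  by (rule has_derivative_at_withinI)
     (intro has_derivative_add has_derivative_scaleR_right tilted_mean_deriv K L)

lemma tjac_linear: "linear (tjac t x)"
  using tmap_deriv has_derivative_linear by blast

lemma tjac_pos: "0 \<le> t \<Longrightarrow> v \<noteq> 0 \<Longrightarrow> v \<bullet> tjac t x v > 0"
  unfolding tjac_def inner_add_right inner_scaleR_right
  using tilted_cov_pos[OF K, of v x] tilted_cov_pos[OF L, of v x] by (intro add_pos_nonneg) auto

text \<open>Along the segment from \<open>x\<close> to \<open>y\<close> the component of
  \<open>tmap t\<close> in direction \<open>y - x\<close> is strictly increasing, since its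
  derivative is the quadratic form of \<open>tjac\<close>.\<close>

lemma tmap_inj: assumes t: "0 \<le> t" shows "inj (tmap t)"
proof (rule injI, rule ccontr)
  fix x y assume eq: "tmap t x = tmap t y" and "x \<noteq> y"
  define v where "v = y - x"
  have v: "v \<noteq> 0" using \<open>x \<noteq> y\<close> by (simp add: v_def)
  have "((\<lambda>s. v \<bullet> tmap t (x + s *\<^sub>R v)) has_real_derivative v \<bullet> tjac t (x + s *\<^sub>R v) v) (at s)" for s
  proof -
    have "((\<lambda>s. x + s *\<^sub>R v) has_derivative (\<lambda>h. h *\<^sub>R v)) (at s)"
      by (auto intro!: derivative_eq_intros)
    from has_derivative_compose[OF this tmap_deriv]
    have "((\<lambda>s. tmap t (x + s *\<^sub>R v)) has_derivative (\<lambda>h. tjac t (x + s *\<^sub>R v) (h *\<^sub>R v))) (at s)" .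
    then have "((\<lambda>s. v \<bullet> tmap t (x + s *\<^sub>R v)) has_derivative (\<lambda>h. v \<bullet> tjac t (x + s *\<^sub>R v) (h *\<^sub>R v))) (at s)"
      by (rule has_derivative_inner_right)
    moreover have "(\<lambda>h. v \<bullet> tjac t (x + s *\<^sub>R v) (h *\<^sub>R v)) = (*) (v \<bullet> tjac t (x + s *\<^sub>R v) v)"
      by (auto simp: fun_eq_iff linear_scale[OF tjac_linear])
    ultimately show ?thesis unfolding has_field_derivative_def by simp
  qed
  then have "v \<bullet> tmap t (x + 0 *\<^sub>R v) < v \<bullet> tmap t (x + 1 *\<^sub>R v)"
    using tjac_pos[OF t v] by (intro DERIV_pos_imp_increasing[of 0 1 "\<lambda>s. v \<bullet> tmap t (x + s *\<^sub>R v)"]) auto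
  then show False using eq by (simp add: v_def)
qed

text \<open>
  The convex potential of \<open>tmap t x - (a + t *\<^sub>R b)\<close> is coercive, and its minimizer is the preimage.
\<close>
lemma tmap_surj:
  assumes t: "0 \<le> t" and a: "a \<in> interior K" and b: "b \<in> interior L"
  shows "a + t *\<^sub>R b \<in> range (tmap t)"
proof -
  define \<phi> where "\<phi> x = ln (partition_fun K x) + t * ln (partition_fun L x) - x \<bullet> (a + t *\<^sub>R b)" for x
  have der: "(\<phi> has_derivative (\<lambda>v. v \<bullet> tilted_mean K x + t * (v \<bullet> tilted_mean L x) - v \<bullet> (a + t *\<^sub>R b)))
      (at x)" for x
    unfolding \<phi>_def[abs_def]
    by (intro has_derivative_add has_derivative_diff has_derivative_mult_right ln_partition_fun_deriv K L
        has_derivative_inner_left has_derivative_ident)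
  have cont: "continuous_on S \<phi>" for S
    by (intro continuous_at_imp_continuous_on ballI has_derivative_continuous[OF der])
  obtain r c where rc: "r > 0" "\<And>x. ln (partition_fun K x) \<ge> x \<bullet> a + r * norm x + c"
    using ln_partition_fun_coercive[OF K a] by metis
  obtain r' c' where rc': "r' > 0" "\<And>x. ln (partition_fun L x) \<ge> x \<bullet> b + r' * norm x + c'"
    using ln_partition_fun_coercive[OF L b] by metis
  have low: "\<phi> x \<ge> r * norm x + (c + t * c')" for x
  proof -
    have "t * ln (partition_fun L x) \<ge> t * (x \<bullet> b + r' * norm x + c')"
      using rc'(2) t by (intro mult_left_mono) auto
    moreover have "t * (x \<bullet> b + r' * norm x + c') \<ge> t * (x \<bullet> b + c')"
      using rc' t by (intro mult_left_mono) auto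
    ultimately show ?thesis using rc(2)[of x] unfolding \<phi>_def inner_add_right inner_scaleR_right
      by (simp add: algebra_simps)
  qed
  \<comment> \<open>Outside this radius the linear lower bound exceeds \<open>\<phi> 0\<close>, so a
    minimizer over the ball is a global one.\<close>
  define R where "R = max 0 ((\<phi> 0 - (c + t * c')) / r) + 1"
  have R: "R > 0" "r * R + (c + t * c') > \<phi> 0"
  proof -
    show "R > 0" by (simp add: R_def)
    have "(\<phi> 0 - (c + t * c')) / r < R" by (simp add: R_def)
    then show "r * R + (c + t * c') > \<phi> 0" using rc(1) by (simp add: divide_less_eq mult.commute)
  qed
  obtain x0 where x0: "x0 \<in> cball 0 R" "\<And>x. x \<in> cball 0 R \<Longrightarrow> \<phi> x0 \<le> \<phi> x"
    using continuous_attains_inf[OF compact_cball, of 0 R \<phi>] cont R(1) by auto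
  have min: "\<phi> x0 \<le> \<phi> x" for x
  proof (cases "x \<in> cball 0 R")
    case False
    then have "r * R \<le> r * norm x" using rc(1) by (intro mult_left_mono) auto
    then have "\<phi> 0 \<le> \<phi> x" using low[of x] R(2) by linarith
    moreover have "\<phi> x0 \<le> \<phi> 0" using x0(2)[of 0] R(1) by simp
    ultimately show ?thesis by linarith
  qed (use x0 in auto)
  have "(\<lambda>v. v \<bullet> tilted_mean K x0 + t * (v \<bullet> tilted_mean L x0) - v \<bullet> (a + t *\<^sub>R b)) = (\<lambda>v. 0)"
    using min by (intro differential_zero_maxmin[OF _ _ der, of x0 UNIV]) auto
  then have "v \<bullet> (tmap t x0 - (a + t *\<^sub>R b)) = 0" for v
    unfolding tmap_def by (simp add: fun_eq_iff inner_diff_right inner_add_right)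
  then have "tmap t x0 = a + t *\<^sub>R b" by (metis eq_iff_diff_eq_0 inner_eq_zero_iff)
  then show ?thesis by (metis rangeI)
qed

text \<open>Change of variables for \<open>tmap t\<close>: the range lies between the sum of the
  interiors and \<open>K + t L\<close>, hence has the full volume, and positivity of the Jacobian
  determinant removes the absolute value.\<close>

lemma volume_eq_integral_det:
  assumes t: "0 \<le> t"
  shows "((\<lambda>x. det (matrix (tjac t x))) has_integral measure lebesgue {x + t *\<^sub>R y | x y. x \<in> K \<and> y \<in> L}) UNIV"
proof -
  have S1: "msum (interior K) ((*\<^sub>R) t ` interior L) \<subseteq> range (tmap t)"
    using tmap_surj[OF t] by (auto simp: msum_def)
  have S2: "range (tmap t) \<subseteq> {x + t *\<^sub>R y | x y. x \<in> K \<and> y \<in> L}"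
    using tilted_mean_in[OF K] tilted_mean_in[OF L] by (auto simp: tmap_def)
  have S3: "msum (interior K) ((*\<^sub>R) t ` interior L) \<subseteq> {x + t *\<^sub>R y | x y. x \<in> K \<and> y \<in> L}"
    using S1 S2 by blast
  have "range (tmap t) \<in> lmeasurable \<and> measure lebesgue (range (tmap t)) = measure lebesgue {x + t *\<^sub>R y
      | x y. x \<in> K \<and> y \<in> L}"
    using msum_interior_volume[OF K L S1 S2] msum_interior_volume[OF K L S3 order_refl] by simp
  then have "((\<lambda>x. \<bar>det (matrix (tjac t x))\<bar>) has_integral measure lebesgue {x + t *\<^sub>R y | x y. x \<in> K \<and> y \<in> L}) UNIV"
    by (subst (asm) has_measure_differentiable_image[where f'="tjac t"]) (use tmap_deriv tmap_inj[OF t] in auto)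
  moreover have "\<bar>det (matrix (tjac t x))\<bar> = det (matrix (tjac t x))" for x
    using det_pos_of_positive[OF tjac_linear tjac_pos[OF t]] by (simp add: less_imp_le)
  ultimately show ?thesis by simp
qed

text \<open>At each \<open>x\<close> the Jacobian determinant is a cubic in \<open>t\<close>.
  Integrating its interpolation formula gives the same formula for the volume.\<close>

lemma steiner_polynomial:
  "\<exists>a b c d. \<forall>t\<ge>0. measure lebesgue {x + t *\<^sub>R y | x y. x \<in> K \<and> y \<in> L} = a + b * t + c * t^2 + d * t^3"
proof -
  define V where "V t = measure lebesgue {x + t *\<^sub>R y | x y. x \<in> K \<and> y \<in> L}" for t
  have cub: "cubic_poly (\<lambda>t. det (matrix (tjac t x)))" for x
  proof -
    have "matrix (tjac t x) = (\<chi> i j. matrix (tilted_cov K x) $ i $ j + t * matrix (tilted_cov L x) $ i $ j)" for t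
      by (auto simp: vec_eq_iff matrix_def tjac_def)
    then show ?thesis using cubic_poly_det by simp
  qed
  have hi: "((\<lambda>x. det (matrix (tjac t x))) has_integral V t) UNIV" if "0 \<le> t" for t
    unfolding V_def by (rule volume_eq_integral_det[OF that])
  have Vt: "V t = ((1-t)*(2-t)*(3-t)/6) * V 0 + (t*(2-t)*(3-t)/2) * V 1 + (- (t*(1-t)*(3-t)/2)) * V 2 +
      (t*(1-t)*(2-t)/6) * V 3"
    if t: "0 \<le> t" for t
  proof -
    have "((\<lambda>x. ((1-t)*(2-t)*(3-t)/6) * det (matrix (tjac 0 x)) + (t*(2-t)*(3-t)/2) * det (matrix (tjac 1 x))
       + (- (t*(1-t)*(3-t)/2)) * det (matrix (tjac 2 x)) + (t*(1-t)*(2-t)/6) * det (matrix (tjac 3 x))) has_integral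
       (((1-t)*(2-t)*(3-t)/6) * V 0 + (t*(2-t)*(3-t)/2) * V 1 + (- (t*(1-t)*(3-t)/2)) * V 2 +
           (t*(1-t)*(2-t)/6) * V 3)) UNIV"
      by (intro has_integral_add has_integral_mult_right hi) auto
    moreover have "(\<lambda>x. ((1-t)*(2-t)*(3-t)/6) * det (matrix (tjac 0 x)) + (t*(2-t)*(3-t)/2) * det (matrix (tjac 1 x))
       + (- (t*(1-t)*(3-t)/2)) * det (matrix (tjac 2 x)) + (t*(1-t)*(2-t)/6) * det (matrix (tjac 3 x))) =
           (\<lambda>x. det (matrix (tjac t x)))"
      by (rule ext, rule cubic_poly_interpolation[OF cub, symmetric])
    ultimately show ?thesis using has_integral_unique[OF hi[OF t]] by simp
  qed
  \<comment> \<open>The coefficients come from the finite differences of \<open>V\<close> at the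
    nodes, the highest one first.\<close>
  define d where "d = (V 3 - 3 * V 2 + 3 * V 1 - V 0) / 6"
  define c where "c = (V 2 - 2 * V 1 + V 0) / 2 - 3 * d"
  define b where "b = V 1 - V 0 - c - d"
  have "V t = V 0 + b * t + c * t^2 + d * t^3" if "0 \<le> t" for t
    unfolding Vt[OF that] by (simp add: b_def c_def d_def power2_eq_square power3_eq_cube field_simps)
  then show ?thesis unfolding V_def by blast
qed

lemma brunn_minkowski_volume:
  assumes t: "0 < t"
  shows "(root 3 (measure lebesgue K) + t * root 3 (measure lebesgue L)) ^ 3 \<le> measure lebesgue {x + t
      *\<^sub>R y | x y. x \<in> K \<and> y \<in> L}"
proof -
  let ?Q = "msum (interior K) ((*\<^sub>R) t ` interior L)"
  have bd: "bounded (interior K)" "bounded (interior L)" using K L by (auto intro: bounded_interior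
      compact_imp_bounded)
  have m: "measure lebesgue (interior K) = measure lebesgue K" "measure lebesgue (interior L) = measure lebesgue L"
    using K L compact_imp_bounded negligible_convex_frontier measure_interior by blast+
  have "measure lebesgue ((*\<^sub>R) t ` interior L) = t ^ 3 * measure lebesgue L"
    using measure_lebesgue_affine[of t 0 "interior L"] t m by simp
  then have r: "root 3 (measure lebesgue ((*\<^sub>R) t ` interior L)) = t * root 3 (measure lebesgue L)"
    using t by (simp add: real_root_mult real_root_power_cancel)
  have "(root DIM(real^3) (measure lebesgue (interior K)) + root DIM(real^3) (measure lebesgue ((*\<^sub>R) t `
      interior L))) ^ DIM(real^3)
     \<le> measure lebesgue ?Q"
    using t bd K L by (intro brunn_minkowski_open open_scaling bounded_scaling) auto
  also have "?Q \<subseteq> {x + t *\<^sub>R y | x y. x \<in> K \<and> y \<in> L}"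
    using interior_subset by (fastforce simp: msum_def)
  then have "measure lebesgue ?Q = measure lebesgue {x + t *\<^sub>R y | x y. x \<in> K \<and> y \<in> L}"
    using msum_interior_volume(2)[OF K L _ order_refl] by simp
  finally show ?thesis using r m by simp
qed

end

text \<open>The definite description \<open>quermass\<close> calls for existence and uniqueness of
  the coefficient sequence. Existence is the Steiner polynomial; uniqueness holds because four
  values determine a cubic and all further terms are fixed to be 0.\<close>

lemma quermass_steiner:
  assumes K: "convex_body K" and L: "convex_body L" and t: "0 \<le> t"
  shows "vol {x + t *\<^sub>R y | x y. x \<in> K \<and> y \<in> L}
    = quermass 0 K L + 3 * quermass 1 K L * t + 3 * quermass 2 K L * t\<^sup>2 + quermass 3 K L * t ^ 3"
proof -
  define P where "P w \<longleftrightarrow> (\<forall>j>3. w j = 0) \<and>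
        (\<forall>t\<ge>0. vol {x + t *\<^sub>R y | x y. x \<in> K \<and> y \<in> L}
               = (\<Sum>j\<le>3. real (3 choose j) * w j * t ^ j))" for w :: "nat \<Rightarrow> real"
  have sum3: "(\<Sum>j\<le>3. real (3 choose j) * w j * t ^ j) = w 0 + 3 * w 1 * t + 3 * w 2 * t\<^sup>2 + w 3 * t ^ 3"
      for w :: "nat \<Rightarrow> real" and t
    by (simp add: eval_nat_numeral)
  have "\<exists>a b c d. \<forall>t\<ge>0. vol {x + t *\<^sub>R y | x y. x \<in> K \<and> y \<in> L} = a + b * t + c * t^2 + d * t^3"
    using K L unfolding convex_body_def vol_def by (intro steiner_polynomial) auto
  then obtain a b c d where abcd: "\<forall>t\<ge>0. vol {x + t *\<^sub>R y | x y. x \<in> K \<and> y \<in> L} = a + b * t + c * t^2 + d * t^3"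
    by (elim exE)
  define w where "w j = (if j = 0 then a else if j = 1 then b / 3 else if j = 2 then c / 3 else if j = 3
      then d else 0)" for j :: nat
  have "P w" unfolding P_def sum3 using abcd by (auto simp: w_def)
  moreover have "w1 = w2" if "P w1" "P w2" for w1 w2
  proof
    fix j
    have Pw: "vol {x + t *\<^sub>R y | x y. x \<in> K \<and> y \<in> L} = w 0 + 3 * w 1 * t + 3 * w 2 * t\<^sup>2 + w 3 * t ^ 3"
      if "P w" "t \<ge> 0" for w t
      using that(1)[unfolded P_def sum3, THEN conjunct2] that(2) by (elim allE impE)
    have "w1 0 + 3 * w1 1 * t + 3 * w1 2 * t\<^sup>2 + w1 3 * t ^ 3 = w2 0 + 3 * w2 1 * t + 3 * w2 2 * t\<^sup>2 + w2
        3 * t ^ 3" if "t \<ge> 0" for t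
      using Pw[OF \<open>P w1\<close> that] Pw[OF \<open>P w2\<close> that] by (rule trans[OF sym])
    from this[of 0] this[of 1] this[of 2] this[of 3]
    have "w1 0 = w2 0" "w1 1 = w2 1" "w1 2 = w2 2" "w1 3 = w2 3" by simp_all
    moreover have "w1 j = w2 j" if "j > 3" using that \<open>P w1\<close> \<open>P w2\<close> unfolding P_def by simp
    moreover have "j = 0 \<or> j = 1 \<or> j = 2 \<or> j = 3 \<or> j > 3" by linarith
    ultimately show "w1 j = w2 j" by blast
  qed
  ultimately have "\<exists>!w. P w" by blast
  then have "P (THE w. P w)" by (rule theI')
  moreover have "quermass i K L = (THE w. P w) i" for i
    unfolding quermass_def P_def ..
  ultimately have "P (\<lambda>i. quermass i K L)" by simp
  from this[unfolded P_def sum3, THEN conjunct2] t show ?thesis by (elim allE impE)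
qed

section \<open>Extreme coefficients and Minkowski's inequality\<close>

lemma quermass_0:
  assumes K: "convex_body K" and L: "convex_body L" shows "quermass 0 K L = vol K"
proof -
  have "L \<noteq> {}" using L by (auto simp: convex_body_def)
  then have "{x + 0 *\<^sub>R y | x y. x \<in> K \<and> y \<in> L} = K" by auto
  then show ?thesis using quermass_steiner[OF K L, of 0] by simp
qed

lemma vol_scale: "c \<ge> 0 \<Longrightarrow> vol ((*\<^sub>R) c ` K) = c ^ 3 * vol K"
  using measure_lebesgue_affine[of c 0 K] by (simp add: vol_def)

text \<open>Since \<open>K + t L\<close> is \<open>t\<close> times \<open>L + (1 / t) K\<close>, the
  Steiner polynomial of the pair \<open>(K, L)\<close> is the reversed polynomial of
  \<open>(L, K)\<close>: the leading coefficient of one is the constant term of the other.\<close>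

lemma quermass_3:
  assumes K: "convex_body K" and L: "convex_body L" shows "quermass 3 K L = vol L"
proof -
  have eq: "quermass 0 K L + 3 * quermass 1 K L * t + 3 * quermass 2 K L * t\<^sup>2 + quermass 3 K L * t ^ 3
     = vol L * t ^ 3 + 3 * quermass 1 L K * t\<^sup>2 + 3 * quermass 2 L K * t + quermass 3 L K" if t: "t > 0" for t
  proof -
    have "{x + t *\<^sub>R y | x y. x \<in> K \<and> y \<in> L} = (*\<^sub>R) t ` {x + (1 / t) *\<^sub>R y | x y. x \<in> L \<and> y \<in> K}"
    proof -
      have "x + t *\<^sub>R y = t *\<^sub>R (y + (1 / t) *\<^sub>R x)" for x y :: "real^3"
        using t by (simp add: scaleR_add_right)
      then show ?thesis by (auto simp: image_iff)
    qed
    then have "vol {x + t *\<^sub>R y | x y. x \<in> K \<and> y \<in> L} = t ^ 3 * vol {x + (1 / t) *\<^sub>R y | x y. x \<in> L \<and> y \<in> K}"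
      using t by (simp add: vol_scale)
    also have "\<dots> = t ^ 3 * (vol L + 3 * quermass 1 L K * (1/t) + 3 * quermass 2 L K * (1/t)\<^sup>2 + quermass
        3 L K * (1/t) ^ 3)"
      using quermass_steiner[OF L K, of "1/t"] t by (simp add: quermass_0[OF L K])
    also have "\<dots> = vol L * t ^ 3 + 3 * quermass 1 L K * t\<^sup>2 + 3 * quermass 2 L K * t + quermass 3 L K"
      using t by (simp add: field_simps power2_eq_square power3_eq_cube)
    finally show ?thesis using quermass_steiner[OF K L, of t] t by simp
  qed
  \<comment> \<open>The reversal divides by \<open>t\<close>, so the four evaluation points start at
    1.\<close>
  from eq[of 1] eq[of 2] eq[of 3] eq[of 4] show ?thesis by simp
qed

lemma vol_pos: "convex_body K \<Longrightarrow> vol K > 0"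
proof -
  assume K: "convex_body K"
  then have "\<not> negligible K" 
    unfolding convex_body_def using negligible_subset[OF _ interior_subset, of K] open_not_negligible[OF
        open_interior, of K] by blast
  moreover have "K \<in> lmeasurable" using K by (simp add: convex_body_def lmeasurable_compact)
  ultimately show ?thesis unfolding vol_def by (metis less_eq_real_def measure_nonneg negligible_iff_measure0)
qed

text \<open>In the comparison of \<open>(p + t * q) ^ 3\<close> with the Steiner polynomial the
  constant and the cubic terms cancel, so the quadratic coefficients decide for large
  \<open>t\<close>.\<close>

lemma quermass_2_ge:
  assumes K: "convex_body K" and L: "convex_body L" 
  shows "vol K * vol L ^ 2 \<le> quermass 2 K L ^ 3"
proof -
  define p q where "p = root 3 (vol K)" and "q = root 3 (vol L)"
  have pq: "p > 0" "q > 0" "p ^ 3 = vol K" "q ^ 3 = vol L"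
    using vol_pos[OF K] vol_pos[OF L] by (auto simp: p_def q_def)
  have ineq: "3 * p\<^sup>2 * q * t + 3 * p * q\<^sup>2 * t\<^sup>2 \<le> 3 * quermass 1 K L * t + 3 * quermass 2 K L * t\<^sup>2" if
      t: "t > 0" for t
  proof -
    have "(p + t * q) ^ 3 \<le> vol {x + t *\<^sub>R y | x y. x \<in> K \<and> y \<in> L}"
      using brunn_minkowski_volume[of K L t] K L t unfolding p_def q_def vol_def convex_body_def by blast
    also have "\<dots> = p ^ 3 + 3 * quermass 1 K L * t + 3 * quermass 2 K L * t\<^sup>2 + q ^ 3 * t ^ 3"
      using quermass_steiner[OF K L, of t] t by (simp add: quermass_0[OF K L] quermass_3[OF K L] pq)
    finally show ?thesis by (simp add: power2_eq_square power3_eq_cube algebra_simps)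
  qed
  have "p * q\<^sup>2 \<le> quermass 2 K L"
  proof (rule ccontr)
    assume "\<not> p * q\<^sup>2 \<le> quermass 2 K L"
    then have e: "p * q\<^sup>2 - quermass 2 K L > 0" by simp
    \<comment> \<open>Large enough for \<open>t\<close> times the supposed deficit of the quadratic
      coefficient to exceed the linear coefficient.\<close>
    define t where "t = (\<bar>quermass 1 K L\<bar> + 1) / (p * q\<^sup>2 - quermass 2 K L)"
    have t: "t > 0" using e by (simp add: t_def add_nonneg_pos)
    have "t * (p * q\<^sup>2 - quermass 2 K L) = \<bar>quermass 1 K L\<bar> + 1" using e by (simp add: t_def)
    then have "quermass 1 K L + quermass 2 K L * t < p * q\<^sup>2 * t" by (simp add: algebra_simps abs_if split: if_splits)
    moreover have "p\<^sup>2 * q > 0" using pq by simp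
    ultimately have "quermass 1 K L + quermass 2 K L * t < p\<^sup>2 * q + p * q\<^sup>2 * t" by linarith
    then have "(quermass 1 K L + quermass 2 K L * t) * (3 * t) < (p\<^sup>2 * q + p * q\<^sup>2 * t) * (3 * t)"
      using t by (intro mult_strict_right_mono) auto
    then show False using ineq[OF t] by (simp add: power2_eq_square algebra_simps)
  qed
  then have "(p * q\<^sup>2) ^ 3 \<le> quermass 2 K L ^ 3" using pq by (intro power_mono) auto
  moreover have "(p * q\<^sup>2) ^ 3 = vol K * vol L ^ 2"
    by (simp add: pq(3,4)[symmetric] power_mult_distrib power_mult[symmetric])
  ultimately show ?thesis by simp
qed

section \<open>Hausdorff measure\<close>

text \<open>The summand of \<open>hausdorff_premeasure\<close>, named so that covers can be compared
  term by term.\<close>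

definition hterm :: "nat \<Rightarrow> 'a::metric_space set \<Rightarrow> ennreal" where
  "hterm d X = (if X = {} then 0 else ennreal (unit_ball_vol (real d) / 2 ^ d * diameter X ^ d))"

lemma hterm_empty [simp]: "hterm d {} = 0"
  by (simp add: hterm_def)

section \<open>Subadditivity and behaviour under Lipschitz maps\<close>

lemma premeasure_le:
  assumes "\<And>i::nat. bounded (U i) \<and> diameter (U i) \<le> \<delta>" "A \<subseteq> (\<Union>i. U i)"
  shows "hausdorff_premeasure d \<delta> A \<le> (\<Sum>i. hterm d (U i))"
  unfolding hausdorff_premeasure_def hterm_def using assms by (intro INF_lower) auto

lemma premeasure_greatest:
  assumes "\<And>U :: nat \<Rightarrow> _. (\<And>i. bounded (U i)) \<Longrightarrow> (\<And>i. diameter (U i) \<le> \<delta>) \<Longrightarrow> A \<subseteq> (\<Union>i. U i) \<Longrightarrow> k \<le> (\<Sum>i. hterm d (U i))"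
  shows "k \<le> hausdorff_premeasure d \<delta> A"
  unfolding hausdorff_premeasure_def hterm_def[symmetric] by (rule INF_greatest) (use assms in auto)

lemma premeasure_mono: "A \<subseteq> B \<Longrightarrow> hausdorff_premeasure d \<delta> A \<le> hausdorff_premeasure d \<delta> B"
  by (rule premeasure_greatest) (blast intro: premeasure_le)

lemma premeasure_le_hausdorff: "\<delta> > 0 \<Longrightarrow> hausdorff_premeasure d \<delta> A \<le> hausdorff_measure d A"
  unfolding hausdorff_measure_def by (intro SUP_upper) auto

lemma hausdorff_least:
  "(\<And>\<delta>. \<delta> > 0 \<Longrightarrow> hausdorff_premeasure d \<delta> A \<le> k) \<Longrightarrow> hausdorff_measure d A \<le> k"
  unfolding hausdorff_measure_def by (intro SUP_least) auto

lemma hausdorff_mono: "A \<subseteq> B \<Longrightarrow> hausdorff_measure d A \<le> hausdorff_measure d B"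
  by (rule hausdorff_least) (meson order_trans premeasure_mono premeasure_le_hausdorff)

text \<open>Covers that are optimal up to \<open>e / 2 ^ (n + 1)\<close> are merged into one
  sequence by the pairing function.\<close>

lemma premeasure_subadd:
  fixes A :: "nat \<Rightarrow> 'a::metric_space set"
  shows "hausdorff_premeasure d \<delta> (\<Union>n. A n) \<le> (\<Sum>n. hausdorff_premeasure d \<delta> (A n))"
proof (rule ennreal_le_epsilon)
  fix e :: real assume e: "e > 0" and fin: "(\<Sum>n. hausdorff_premeasure d \<delta> (A n)) < top"
  have "\<exists>U::nat \<Rightarrow> 'a set. (\<forall>i. bounded (U i) \<and> diameter (U i) \<le> \<delta>) \<and> A n \<subseteq> (\<Union>i. U i) \<and>
     (\<Sum>i. hterm d (U i)) \<le> hausdorff_premeasure d \<delta> (A n) + ennreal (e * (1/2) ^ Suc n)" for n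
  proof -
    have "hausdorff_premeasure d \<delta> (A n) < top"
      using fin ennreal_suminf_lessD by blast
    then have "hausdorff_premeasure d \<delta> (A n) < hausdorff_premeasure d \<delta> (A n) + ennreal (e * (1/2) ^ Suc n)"
      using e by (cases "hausdorff_premeasure d \<delta> (A n)") (auto simp flip: ennreal_plus simp: ennreal_less_iff)
    then obtain U where "U \<in> {U :: nat \<Rightarrow> 'a set. (\<forall>i. bounded (U i) \<and> diameter (U i) \<le> \<delta>) \<and> A n \<subseteq> (\<Union>i. U i)}"
      "(\<Sum>i. hterm d (U i)) < hausdorff_premeasure d \<delta> (A n) + ennreal (e * (1/2) ^ Suc n)"
      unfolding hausdorff_premeasure_def INF_less_iff hterm_def[symmetric] by blast
    then show ?thesis by (auto intro: less_imp_le)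
  qed
  then have "\<exists>U. \<forall>n. (\<forall>i. bounded (U n i) \<and> diameter (U n i) \<le> \<delta>) \<and> A n \<subseteq> (\<Union>i::nat. U n i) \<and>
     (\<Sum>i. hterm d (U n i)) \<le> hausdorff_premeasure d \<delta> (A n) + ennreal (e * (1/2) ^ Suc n)"
    by (intro choice allI)
  then obtain U :: "nat \<Rightarrow> nat \<Rightarrow> 'a set" where UU: "\<forall>n. (\<forall>i. bounded (U n i) \<and> diameter (U n i) \<le> \<delta>) \<and> A n
      \<subseteq> (\<Union>i. U n i) \<and>
     (\<Sum>i. hterm d (U n i)) \<le> hausdorff_premeasure d \<delta> (A n) + ennreal (e * (1/2) ^ Suc n)"
    by (elim exE)
  have U: "bounded (U n i)" "diameter (U n i) \<le> \<delta>" "A n \<subseteq> (\<Union>i. U n i)"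
     "(\<Sum>i. hterm d (U n i)) \<le> hausdorff_premeasure d \<delta> (A n) + ennreal (e * (1/2) ^ Suc n)" for n i
    by (simp_all only: UU[rule_format])
  define W where "W k = U (fst (prod_decode k)) (snd (prod_decode k))" for k
  have "hausdorff_premeasure d \<delta> (\<Union>n. A n) \<le> (\<Sum>k. hterm d (W k))"
  proof (rule premeasure_le)
    show "bounded (W i) \<and> diameter (W i) \<le> \<delta>" for i using U by (simp add: W_def)
    show "(\<Union>n. A n) \<subseteq> (\<Union>i. W i)"
    proof
      fix x assume "x \<in> (\<Union>n. A n)"
      then obtain n i where "x \<in> U n i" using U(3) by blast
      then have "x \<in> W (prod_encode (n, i))" by (simp add: W_def)
      then show "x \<in> (\<Union>i. W i)" by blast
    qed
  qed
  also have "(\<Sum>k. hterm d (W k)) = (\<Sum>n. \<Sum>i. hterm d (U n i))"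
    unfolding W_def using suminf_ennreal_2dimen[of "\<lambda>n. (\<Sum>i. hterm d (U n i))" "\<lambda>p. hterm d (U (fst p)
        (snd p))"] by simp
  also have "\<dots> \<le> (\<Sum>n. hausdorff_premeasure d \<delta> (A n) + ennreal (e * (1/2) ^ Suc n))"
    using U(4) by (intro suminf_le) auto
  also have "\<dots> = (\<Sum>n. hausdorff_premeasure d \<delta> (A n)) + (\<Sum>n. ennreal (e * (1/2) ^ Suc n))"
    by (intro suminf_add[symmetric]) auto
  also have "(\<Sum>n. ennreal (e * (1/2) ^ Suc n)) = ennreal e"
    using e sums_mult[OF power_half_series, of e] by (intro suminf_ennreal_eq) auto
  finally show "hausdorff_premeasure d \<delta> (\<Union>n. A n) \<le> (\<Sum>n. hausdorff_premeasure d \<delta> (A n)) + ennreal e" .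
qed

lemma hausdorff_subadd:
  fixes A :: "nat \<Rightarrow> 'a::metric_space set"
  shows "hausdorff_measure d (\<Union>n. A n) \<le> (\<Sum>n. hausdorff_measure d (A n))"
proof (rule hausdorff_least)
  fix \<delta> :: real assume "\<delta> > 0"
  have "hausdorff_premeasure d \<delta> (\<Union>n. A n) \<le> (\<Sum>n. hausdorff_premeasure d \<delta> (A n))" by (rule premeasure_subadd)
  also have "\<dots> \<le> (\<Sum>n. hausdorff_measure d (A n))"
    using premeasure_le_hausdorff[OF \<open>\<delta> > 0\<close>] by (intro suminf_le) auto
  finally show "hausdorff_premeasure d \<delta> (\<Union>n. A n) \<le> (\<Sum>n. hausdorff_measure d (A n))" .
qed

lemma premeasure_empty: "\<delta> \<ge> 0 \<Longrightarrow> hausdorff_premeasure d \<delta> {} = 0"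
  using premeasure_le[of "\<lambda>i. {}" \<delta> "{}" d] by (simp add: diameter_empty)

lemma premeasure_Un:
  assumes "\<delta> \<ge> 0"
  shows "hausdorff_premeasure d \<delta> (A \<union> B) \<le> hausdorff_premeasure d \<delta> A + hausdorff_premeasure d \<delta> B"
proof -
  define F where "F n = (if n = 0 then A else if n = 1 then B else {})" for n :: nat
  have "(\<Union>n. F n) = A \<union> B" by (auto simp: F_def split: if_splits)
  moreover have "(\<Sum>n. hausdorff_premeasure d \<delta> (F n)) = (\<Sum>n\<in>{0,1}. hausdorff_premeasure d \<delta> (F n))"
    by (rule suminf_finite) (auto simp: F_def premeasure_empty assms)
  ultimately show ?thesis using premeasure_subadd[of d \<delta> F] by (simp add: F_def)
qed

text \<open>Intersecting the covering set with \<open>A\<close> confines the estimate to points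
  where the Lipschitz condition is assumed.\<close>

lemma hterm_lipschitz_image:
  fixes f :: "'a::real_normed_vector \<Rightarrow> 'b::real_normed_vector"
  assumes f: "\<And>x y. x \<in> A \<Longrightarrow> y \<in> A \<Longrightarrow> dist (f x) (f y) \<le> M * dist x y" and M: "M > 0" and U: "bounded U"
  shows "bounded (f ` (U \<inter> A))" "diameter (f ` (U \<inter> A)) \<le> M * diameter U"
    "hterm d (f ` (U \<inter> A)) \<le> ennreal (M ^ d) * hterm d U"
proof -
  have dd: "dist (f x) (f y) \<le> M * diameter U" if "x \<in> U \<inter> A" "y \<in> U \<inter> A" for x y
  proof -
    have "dist (f x) (f y) \<le> M * dist x y" using f that by auto
    also have "\<dots> \<le> M * diameter U" using M U that by (intro mult_left_mono diameter_bounded_bound) auto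
    finally show ?thesis .
  qed
  show 1: "bounded (f ` (U \<inter> A))" using dd unfolding bounded_two_points by (intro exI[of _ "M * diameter U"]) auto
  show 2: "diameter (f ` (U \<inter> A)) \<le> M * diameter U"
    using dd M diameter_ge_0[OF U] by (intro diameter_le) (auto simp: dist_norm)
  show "hterm d (f ` (U \<inter> A)) \<le> ennreal (M ^ d) * hterm d U"
  proof (cases "U \<inter> A = {}")
    case False
    have "unit_ball_vol (real d) / 2 ^ d * diameter (f ` (U \<inter> A)) ^ d \<le> unit_ball_vol (real d) / 2 ^ d *
        (M * diameter U) ^ d"
      using 2 diameter_ge_0[OF 1] by (intro mult_left_mono power_mono) auto
    also have "\<dots> = M ^ d * (unit_ball_vol (real d) / 2 ^ d * diameter U ^ d)" by (simp add: power_mult_distrib)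
    finally show ?thesis using False M by (auto simp: hterm_def ennreal_mult[symmetric] diameter_ge_0[OF
        U] intro!: ennreal_leI)
  qed auto
qed

lemma hausdorff_lipschitz_image:
  fixes f :: "'a::real_normed_vector \<Rightarrow> 'b::real_normed_vector"
  assumes f: "\<And>x y. x \<in> A \<Longrightarrow> y \<in> A \<Longrightarrow> dist (f x) (f y) \<le> M * dist x y" and M: "M > 0"
  shows "hausdorff_measure d (f ` A) \<le> ennreal (M ^ d) * hausdorff_measure d A"
proof (rule hausdorff_least)
  fix \<delta> :: real assume \<delta>: "\<delta> > 0"
  \<comment> \<open>The factor is moved to the left as its inverse, so that the claim becomes a
    lower bound for an infimum over covers.\<close>
  have "ennreal ((1 / M) ^ d) * hausdorff_premeasure d \<delta> (f ` A) \<le> hausdorff_premeasure d (\<delta> / M) A"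
  proof (rule premeasure_greatest)
    fix U :: "nat \<Rightarrow> 'a set" assume U: "\<And>i. bounded (U i)" "\<And>i. diameter (U i) \<le> \<delta> / M" "A \<subseteq> (\<Union>i. U i)"
    have lip: "bounded (f ` (U i \<inter> A))" "diameter (f ` (U i \<inter> A)) \<le> M * diameter (U i)"
       "hterm d (f ` (U i \<inter> A)) \<le> ennreal (M ^ d) * hterm d (U i)" for i
      by (rule hterm_lipschitz_image[OF f M U(1)]; assumption)+
    have "hausdorff_premeasure d \<delta> (f ` A) \<le> (\<Sum>i. hterm d (f ` (U i \<inter> A)))"
    proof (rule premeasure_le)
      show "bounded (f ` (U i \<inter> A)) \<and> diameter (f ` (U i \<inter> A)) \<le> \<delta>" for i
      proof
        have "M * diameter (U i) \<le> \<delta>" using U(2)[of i] M by (simp add: pos_le_divide_eq mult.commute)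
        then show "diameter (f ` (U i \<inter> A)) \<le> \<delta>" using lip(2)[of i] by linarith
      qed (rule lip(1))
      show "f ` A \<subseteq> (\<Union>i. f ` (U i \<inter> A))" using U(3) by blast
    qed
    also have "\<dots> \<le> (\<Sum>i. ennreal (M ^ d) * hterm d (U i))" by (intro suminf_le lip(3)) auto
    also have "\<dots> = ennreal (M ^ d) * (\<Sum>i. hterm d (U i))" by (rule ennreal_suminf_cmult)
    finally have "ennreal ((1 / M) ^ d) * hausdorff_premeasure d \<delta> (f ` A) \<le> ennreal ((1 / M) ^ d) *
        (ennreal (M ^ d) * (\<Sum>i. hterm d (U i)))"
      by (rule mult_left_mono) simp
    also have "\<dots> = (\<Sum>i. hterm d (U i))"
      using M by (simp add: mult.assoc[symmetric] ennreal_mult[symmetric] power_mult_distrib[symmetric])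
    finally show "ennreal ((1 / M) ^ d) * hausdorff_premeasure d \<delta> (f ` A) \<le> (\<Sum>i. hterm d (U i))" .
  qed
  also have "\<dots> \<le> hausdorff_measure d A" using \<delta> M by (intro premeasure_le_hausdorff) simp
  finally have "ennreal (M ^ d) * (ennreal ((1 / M) ^ d) * hausdorff_premeasure d \<delta> (f ` A)) \<le> ennreal (M
      ^ d) * hausdorff_measure d A"
    by (rule mult_left_mono) simp
  then show "hausdorff_premeasure d \<delta> (f ` A) \<le> ennreal (M ^ d) * hausdorff_measure d A"
    using M by (simp add: mult.assoc[symmetric] ennreal_mult[symmetric] power_mult_distrib[symmetric])
qed

text \<open>The bookkeeping for Vitali's theorems: covering sets \<open>F c\<close> are charged to
  disjoint sets \<open>G c\<close> inside \<open>T\<close>. Enlarged balls \<open>F c\<close> serve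
  for null sets, and \<open>F = G\<close> serves for open sets.\<close>

lemma premeasure_countable_cover:
  fixes F :: "'i \<Rightarrow> 'a::metric_space set"
  assumes C: "countable C" and F: "\<And>c. c \<in> C \<Longrightarrow> bounded (F c)" "\<And>c. c \<in> C \<Longrightarrow> diameter (F c) \<le> \<delta>"
    and A: "A \<subseteq> (\<Union>c\<in>C. F c)" and \<delta>: "0 \<le> \<delta>"
    and G: "\<And>c. c \<in> C \<Longrightarrow> hterm d (F c) \<le> k * emeasure M (G c)" "\<And>c. c \<in> C \<Longrightarrow> G c \<in> sets M"
      "disjoint_family_on G C" "(\<Union>c\<in>C. G c) \<subseteq> T" "T \<in> sets M"
  shows "hausdorff_premeasure d \<delta> A \<le> k * emeasure M T"
proof -
  \<comment> \<open>A finite or infinite \<open>C\<close> is spread over the naturals; indices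
    outside \<open>I\<close> carry the empty set, whose term is 0.\<close>
  define I where "I = to_nat_on C ` C"
  define F' where "F' i = (if i \<in> I then F (from_nat_into C i) else {})" for i
  define G' where "G' i = (if i \<in> I then G (from_nat_into C i) else {})" for i
  have I: "from_nat_into C i \<in> C" if "i \<in> I" for i using that C by (auto simp: I_def)
  have "hausdorff_premeasure d \<delta> A \<le> (\<Sum>i. hterm d (F' i))"
  proof (rule premeasure_le)
    show "bounded (F' i) \<and> diameter (F' i) \<le> \<delta>" for i using F I \<delta> by (auto simp: F'_def diameter_empty)
    show "A \<subseteq> (\<Union>i. F' i)"
    proof
      fix x assume "x \<in> A"
      then obtain c where c: "c \<in> C" "x \<in> F c" using A by blast
      then have "x \<in> F' (to_nat_on C c)" using C by (simp add: F'_def I_def)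
      then show "x \<in> (\<Union>i. F' i)" by blast
    qed
  qed
  also have "\<dots> \<le> (\<Sum>i. k * emeasure M (G' i))"
  proof (intro suminf_le)
    show "hterm d (F' i) \<le> k * emeasure M (G' i)" for i
    proof (cases "i \<in> I")
      case True
      then show ?thesis using G(1)[OF I[OF True]] by (simp only: F'_def G'_def if_True)
    qed (simp add: F'_def)
  qed auto
  also have "\<dots> = k * (\<Sum>i. emeasure M (G' i))" by (rule ennreal_suminf_cmult)
  also have "(\<Sum>i. emeasure M (G' i)) = emeasure M (\<Union>i. G' i)"
  proof (rule suminf_emeasure)
    show "range G' \<subseteq> sets M" using G(2) I by (auto simp: G'_def)
    show "disjoint_family G'" unfolding disjoint_family_on_def
    proof (intro ballI impI)
      fix m n :: nat assume mn: "m \<noteq> n"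
      show "G' m \<inter> G' n = {}"
      proof (cases "m \<in> I \<and> n \<in> I")
        case True
        then have "from_nat_into C m \<noteq> from_nat_into C n" using mn C by (auto simp: I_def)
        then show ?thesis using True I G(3) by (auto simp: G'_def disjoint_family_on_def)
      qed (auto simp: G'_def)
    qed
  qed
  also have "\<dots> \<le> emeasure M T"
    using G(4,5) I by (intro emeasure_mono) (auto simp: G'_def split: if_splits)
  finally show ?thesis by (simp add: mult_left_mono)
qed

section \<open>Hausdorff measure in full dimension is at most Lebesgue measure\<close>

lemma hterm_ball:
  fixes a :: "'a::euclidean_space"
  assumes "r > 0" "c \<ge> 0"
  shows "hterm DIM('a) (ball a (c * r)) \<le> ennreal (c ^ DIM('a)) * emeasure lebesgue (ball a r)"
proof -
  have "emeasure lebesgue (ball a r) = ennreal (unit_ball_vol (real DIM('a)) * r ^ DIM('a))"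
    using assms by (simp add: emeasure_ball)
  then show ?thesis using assms
    by (auto simp: hterm_def ennreal_mult[symmetric] power_mult_distrib intro!: ennreal_leI)
qed

text \<open>An open superset of small volume contains disjoint balls whose fivefold enlargements
  cover \<open>N\<close>, so the cover costs at most \<open>5 ^ DIM('a)\<close> times that
  volume.\<close>

lemma hausdorff_null:
  fixes N :: "'a::euclidean_space set"
  assumes N: "N \<in> null_sets lebesgue"
  shows "hausdorff_measure DIM('a) N = 0"
proof -
  have "hausdorff_measure DIM('a) N \<le> 0"
  proof (rule hausdorff_least)
    fix \<delta> :: real assume \<delta>: "\<delta> > 0"
    show "hausdorff_premeasure DIM('a) \<delta> N \<le> 0"
    proof (rule ennreal_le_epsilon)
      fix e :: real assume e: "e > 0"
      define e' where "e' = e / 5 ^ DIM('a)"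
      have e': "e' > 0" using e by (simp add: e'_def)
      obtain T where T: "open T" "N \<subseteq> T" "T - N \<in> lmeasurable" "emeasure lebesgue (T - N) < ennreal e'"
        using sets_lebesgue_outer_open[of N e'] N e' by auto
      have "emeasure lebesgue T = emeasure lebesgue (T - N)"
        using N T by (intro emeasure_Diff_null_set[symmetric]) (auto simp: borel_open)
      then have mT: "emeasure lebesgue T \<le> ennreal e'" using T(4) by simp
      \<comment> \<open>Radius at most \<open>\<delta> / 10\<close>, so that the fivefold ball has
        diameter at most \<open>\<delta>\<close>.\<close>
      define K where "K = {(x, r). x \<in> N \<and> 0 < r \<and> r \<le> \<delta> / 10 \<and> ball x r \<subseteq> T}"
      have cov: "N \<subseteq> (\<Union>c\<in>K. ball (fst c) (snd c))"
      proof
        fix x assume x: "x \<in> N"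
        then have "x \<in> T" using T by auto
        then obtain r where r: "r > 0" "ball x r \<subseteq> T" by (rule openE[OF T(1)])
        then have "(x, min r (\<delta> / 10)) \<in> K" using x \<delta> by (auto simp: K_def)
        then show "x \<in> (\<Union>c\<in>K. ball (fst c) (snd c))" using r \<delta> by (auto intro!: bexI[of _ "(x, min r (\<delta> / 10))"])
      qed
      have kr: "\<And>i. i \<in> K \<Longrightarrow> 0 < snd i \<and> snd i \<le> \<delta> / 10" and kT: "\<And>i. i \<in> K \<Longrightarrow> ball (fst i) (snd i) \<subseteq> T"
        by (auto simp: K_def)
  obtain C where C: "countable C" "C \<subseteq> K" "pairwise (\<lambda>i j. disjnt (ball (fst i) (snd i)) (ball (fst j) (snd j))) C"
        "N \<subseteq> (\<Union>c\<in>C. ball (fst c) (5 * snd c))"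
        by (rule Vitali_covering_lemma_balls[OF cov kr])
      have "hausdorff_premeasure DIM('a) \<delta> N \<le> ennreal (5 ^ DIM('a)) * emeasure lebesgue T"
      proof (rule premeasure_countable_cover[where F="\<lambda>c. ball (fst c) (5 * snd c)" and G="\<lambda>c. ball (fst c) (snd c)"])
        show "disjoint_family_on (\<lambda>c. ball (fst c) (snd c)) C"
          using C(3) by (auto simp: disjoint_family_on_def pairwise_def disjnt_def)
        show "hterm DIM('a) (ball (fst c) (5 * snd c)) \<le> ennreal (5 ^ DIM('a)) * emeasure lebesgue (ball
            (fst c) (snd c))"
          if "c \<in> C" for c
          using kr[of c] that C(2) by (intro hterm_ball) auto
        show "diameter (ball (fst c) (5 * snd c)) \<le> \<delta>" if "c \<in> C" for c
          using kr[of c] that C(2) by auto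
        show "(\<Union>c\<in>C. ball (fst c) (snd c)) \<subseteq> T" using kT C(2) by blast
      qed (use C T \<delta> in auto)
      also have "\<dots> \<le> ennreal (5 ^ DIM('a)) * ennreal e'" using mT by (intro mult_left_mono) auto
      also have "\<dots> = ennreal e" using e by (simp add: ennreal_mult[symmetric] e'_def)
      finally show "hausdorff_premeasure DIM('a) \<delta> N \<le> 0 + ennreal e" by simp
    qed
  qed
  then show ?thesis by simp
qed

text \<open>Vitali's theorem fills \<open>T\<close> with small disjoint balls up to a null set. The
  normalization makes the term of a ball equal to its volume, and the remainder costs nothing by
  \<open>hausdorff_null\<close>.\<close>

lemma hausdorff_le_lebesgue_open:
  fixes T :: "'a::euclidean_space set"
  assumes T: "open T"
  shows "hausdorff_measure DIM('a) T \<le> emeasure lebesgue T"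
proof (rule hausdorff_least)
  fix \<delta> :: real assume \<delta>: "\<delta> > 0"
  define K where "K = {(x, r). 0 < r \<and> r \<le> \<delta> / 2 \<and> ball x r \<subseteq> T}"
  have cov: "\<exists>i. i \<in> K \<and> x \<in> ball (fst i) (snd i) \<and> snd i < d" if "x \<in> T" "0 < d" for x d
  proof -
    obtain r where r: "r > 0" "ball x r \<subseteq> T" by (rule openE[OF T \<open>x \<in> T\<close>])
    define s where "s = min r (min (\<delta> / 2) (d / 2))"
    have "s > 0" "s \<le> r" "s \<le> \<delta> / 2" "s < d" using r \<delta> that by (auto simp: s_def)
    then have "(x, s) \<in> K" "x \<in> ball x s" "s < d" using r by (auto simp: K_def)
    then show ?thesis by (metis fst_conv snd_conv)
  qed
  have kr: "\<And>i. i \<in> K \<Longrightarrow> 0 < snd i \<and> snd i \<le> \<delta> / 2" and kT: "\<And>i. i \<in> K \<Longrightarrow> ball (fst i) (snd i) \<subseteq> T"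
    by (auto simp: K_def)
  obtain C where C: "countable C" "C \<subseteq> K" "pairwise (\<lambda>i j. disjnt (ball (fst i) (snd i)) (ball (fst j) (snd j))) C"
    "negligible (T - (\<Union>c\<in>C. ball (fst c) (snd c)))"
    by (rule Vitali_covering_theorem_balls[OF cov])
  let ?B = "\<Union>c\<in>C. ball (fst c) (snd c)"
  have 1: "hausdorff_premeasure DIM('a) \<delta> ?B \<le> 1 * emeasure lebesgue T"
  proof (rule premeasure_countable_cover[where F="\<lambda>c. ball (fst c) (snd c)" and G="\<lambda>c. ball (fst c) (snd c)"])
    show "disjoint_family_on (\<lambda>c. ball (fst c) (snd c)) C"
      using C(3) by (auto simp: disjoint_family_on_def pairwise_def disjnt_def)
    show "hterm DIM('a) (ball (fst c) (snd c)) \<le> 1 * emeasure lebesgue (ball (fst c) (snd c))" if "c \<in> C" for c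
      using that C(2) kr[of c] hterm_ball[of "snd c" 1 "fst c"] by auto
    show "diameter (ball (fst c) (snd c)) \<le> \<delta>" if "c \<in> C" for c
      using kr[of c] that C(2) by auto
    show "(\<Union>c\<in>C. ball (fst c) (snd c)) \<subseteq> T" using kT C(2) by blast
  qed (use C T \<delta> in auto)
  have 2: "hausdorff_premeasure DIM('a) \<delta> (T - ?B) \<le> 0"
    using premeasure_le_hausdorff[OF \<delta>] hausdorff_null C(4) by (metis negligible_iff_null_sets)
  have "hausdorff_premeasure DIM('a) \<delta> T \<le> hausdorff_premeasure DIM('a) \<delta> (?B \<union> (T - ?B))"
    by (intro premeasure_mono) auto
  also have "\<dots> \<le> hausdorff_premeasure DIM('a) \<delta> ?B + hausdorff_premeasure DIM('a) \<delta> (T - ?B)"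
    using \<delta> by (intro premeasure_Un) auto
  also have "\<dots> \<le> 1 * emeasure lebesgue T + 0" using 1 2 by (rule add_mono)
  finally show "hausdorff_premeasure DIM('a) \<delta> T \<le> emeasure lebesgue T" by simp
qed

lemma hausdorff_le_lebesgue:
  fixes B :: "'a::euclidean_space set"
  assumes B: "B \<in> sets lebesgue"
  shows "hausdorff_measure DIM('a) B \<le> emeasure lebesgue B"
proof (rule ennreal_le_epsilon)
  fix e :: real assume e: "e > 0"
  obtain T where T: "open T" "B \<subseteq> T" "T - B \<in> lmeasurable" "emeasure lebesgue (T - B) < ennreal e"
    using sets_lebesgue_outer_open[OF B e] by auto
  have "hausdorff_measure DIM('a) B \<le> hausdorff_measure DIM('a) T" using T by (intro hausdorff_mono)
  also have "\<dots> \<le> emeasure lebesgue T" using T by (intro hausdorff_le_lebesgue_open)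
  also have "\<dots> = emeasure lebesgue (B \<union> (T - B))" using T by (simp add: Un_absorb1)
  also have "\<dots> \<le> emeasure lebesgue B + emeasure lebesgue (T - B)" using B T by (intro emeasure_subadditive) auto
  also have "\<dots> \<le> emeasure lebesgue B + ennreal e" using T by (intro add_left_mono) auto
  finally show "hausdorff_measure DIM('a) B \<le> emeasure lebesgue B + ennreal e" .
qed

section \<open>The gauge of a convex body and its regular points\<close>

definition polar_set :: "'a::euclidean_space set \<Rightarrow> 'a set" where
  "polar_set K = {p. \<forall>z\<in>K. p \<bullet> z \<le> 1}"

text \<open>For a body with the origin in its interior this is the Minkowski functional, written as
  the support function of the polar set so that subgradients become maximizers over a fixed compact
  set.\<close>

definition gauge_fun :: "'a::euclidean_space set \<Rightarrow> 'a \<Rightarrow> real" where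
  "gauge_fun K y = (SUP p\<in>polar_set K. p \<bullet> y)"

text \<open>The face of the polar set exposed by \<open>y\<close>, which is the subdifferential of
  the gauge at \<open>y\<close>.\<close>

definition subgrads :: "'a::euclidean_space set \<Rightarrow> 'a \<Rightarrow> 'a set" where
  "subgrads K y = {p \<in> polar_set K. p \<bullet> y = gauge_fun K y}"

text \<open>A single subgradient means that the gauge is differentiable there. These points form a
  cone, and its members on the boundary of the body are the points with a unique outer
  normal.\<close>

definition regular_points :: "'a::euclidean_space set \<Rightarrow> 'a set" where
  "regular_points K = {y. y \<noteq> 0 \<and> (\<exists>p. subgrads K y = {p})}"

text \<open>
  On the boundary of \<open>K\<close> a subgradient of the gauge is an outer normal \<open>p\<close> scaled such that
  \<open>p \<bullet> x = 1\<close>; for the unit normal \<open>u = sgn p\<close> this means \<open>norm p = 1 / support_fun K u\<close>.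
\<close>
definition gauge_grad :: "'a::euclidean_space set \<Rightarrow> 'a \<Rightarrow> 'a" where
  "gauge_grad K y = (if y \<in> regular_points K then THE p. subgrads K y = {p} else 0)"

section \<open>The gauge as a sublinear function and the body as its unit ball\<close>

locale gauged_body =
  fixes K :: "'a::euclidean_space set"
  assumes K: "compact K" "convex K" and zero: "0 \<in> interior K"
begin

abbreviation "P \<equiv> polar_set K"
abbreviation "g \<equiv> gauge_fun K"
abbreviation "N \<equiv> subgrads K"
abbreviation "Rg \<equiv> regular_points K"
abbreviation "gr \<equiv> gauge_grad K"

lemma zero_mem: "0 \<in> K" using zero interior_subset by auto

lemma zero_polar: "0 \<in> P" by (simp add: polar_set_def)

lemma polar_bounded_ex: "\<exists>M>0. \<forall>p\<in>P. norm p \<le> M"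
proof -
  obtain r where r: "r > 0" "cball 0 r \<subseteq> K" using zero mem_interior_cball by blast
  have "norm p \<le> 1 / r" if "p \<in> P" for p
  proof -
    have "r *\<^sub>R sgn p \<in> K" using r by (auto simp: norm_sgn intro!: subsetD[OF r(2)])
    then have "p \<bullet> (r *\<^sub>R sgn p) \<le> 1" using that by (auto simp: polar_set_def)
    moreover have "p \<bullet> sgn p = norm p"
      by (cases "p = 0") (auto simp: sgn_div_norm power2_norm_eq_inner[symmetric] power2_eq_square)
    ultimately show ?thesis using r(1) by (simp add: pos_le_divide_eq mult.commute)
  qed
  then show ?thesis using r(1) by (intro exI[of _ "1 / r"]) auto
qed

text \<open>Radius of a ball containing the polar set, hence a Lipschitz constant of the gauge and a
  bound for its gradient.\<close>

definition "M = (SOME M. M > 0 \<and> (\<forall>p\<in>P. norm p \<le> M))"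

lemma M: "M > 0" "p \<in> P \<Longrightarrow> norm p \<le> M"
  using someI_ex[of "\<lambda>M. M > 0 \<and> (\<forall>p\<in>P. norm p \<le> M)"] polar_bounded_ex unfolding M_def by blast+

lemma polar_compact: "compact P"
proof -
  have "P = (\<Inter>z\<in>K. {p. z \<bullet> p \<le> 1})" by (auto simp: polar_set_def inner_commute)
  then have "closed P" by (auto simp: closed_halfspace_le)
  moreover have "bounded P" using M(2) bounded_iff by blast
  ultimately show ?thesis by (simp add: compact_eq_bounded_closed)
qed

lemma bdd_above_polar: "bdd_above ((\<lambda>p. p \<bullet> y) ` P)"
proof (rule bdd_aboveI2)
  fix p assume "p \<in> P"
  then show "p \<bullet> y \<le> M * norm y"
    using Cauchy_Schwarz_ineq2[of p y] mult_right_mono[OF M(2), of p "norm y"] by auto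
qed

lemma gauge_ge: "p \<in> P \<Longrightarrow> p \<bullet> y \<le> g y"
  unfolding gauge_fun_def by (rule cSUP_upper[OF _ bdd_above_polar])

lemma subgrads_nonempty: "\<exists>p. p \<in> N y"
proof -
  have "\<exists>p\<in>P. \<forall>q\<in>P. q \<bullet> y \<le> p \<bullet> y"
    using zero_polar by (intro continuous_attains_sup polar_compact continuous_intros) auto
  then obtain p where p: "p \<in> P" "\<And>q. q \<in> P \<Longrightarrow> q \<bullet> y \<le> p \<bullet> y" by blast
  have "g y \<le> p \<bullet> y" unfolding gauge_fun_def using zero_polar p(2) by (intro cSUP_least) auto
  then have "p \<in> N y" using p(1) gauge_ge[OF p(1), of y] by (auto simp: subgrads_def)
  then show ?thesis by blast
qed

lemma subgradsD: "p \<in> N y \<Longrightarrow> p \<in> P" "p \<in> N y \<Longrightarrow> p \<bullet> y = g y"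
  by (auto simp: subgrads_def)

lemma gauge_add: "g (x + y) \<le> g x + g y"
proof -
  obtain p where p: "p \<in> N (x + y)" using subgrads_nonempty by blast
  then have "g (x + y) = p \<bullet> x + p \<bullet> y" by (simp add: subgradsD(2)[symmetric] inner_add_right)
  then show ?thesis using gauge_ge[OF subgradsD(1)[OF p]] by (simp add: add_mono)
qed

lemma gauge_scale: assumes "0 \<le> c" shows "g (c *\<^sub>R y) = c * g y"
proof (rule antisym)
  obtain p where p: "p \<in> N (c *\<^sub>R y)" using subgrads_nonempty by blast
  then have "g (c *\<^sub>R y) = c * (p \<bullet> y)" by (simp add: subgradsD(2)[symmetric])
  then show "g (c *\<^sub>R y) \<le> c * g y" using gauge_ge[OF subgradsD(1)[OF p], of y] assms by (simp add: mult_left_mono)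
  obtain q where q: "q \<in> N y" using subgrads_nonempty by blast
  then have "c * g y = q \<bullet> (c *\<^sub>R y)" by (simp add: subgradsD(2)[symmetric])
  then show "c * g y \<le> g (c *\<^sub>R y)" using gauge_ge[OF subgradsD(1)[OF q], of "c *\<^sub>R y"] by (simp only:)
qed

lemma gauge_zero [simp]: "g 0 = 0" using gauge_scale[of 0 0] by simp

lemma gauge_le_norm: "g y \<le> M * norm y"
proof -
  obtain p where p: "p \<in> N y" using subgrads_nonempty by blast
  have "p \<bullet> y \<le> norm p * norm y" by (rule norm_cauchy_schwarz)
  also have "\<dots> \<le> M * norm y" using M(2)[OF subgradsD(1)[OF p]] by (rule mult_right_mono) simp
  finally show ?thesis by (simp add: subgradsD(2)[OF p])
qed

lemma gauge_diff_le: "g x - g y \<le> M * norm (x - y)"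
  using gauge_add[of "x - y" y] gauge_le_norm[of "x - y"] by simp

lemma gauge_lipschitz: "\<bar>g x - g y\<bar> \<le> M * norm (x - y)"
  using gauge_diff_le[of x y] gauge_diff_le[of y x] by (simp add: norm_minus_commute)

lemma gauge_continuous: "continuous_on S g"
proof (rule continuous_on_subset)
  show "continuous_on UNIV g"
  proof (rule lipschitz_on_continuous_on[of M])
    show "M-lipschitz_on UNIV g" using gauge_lipschitz M(1)
      by (auto intro!: lipschitz_onI simp: dist_real_def dist_norm)
  qed
qed auto

lemma gauge_measurable [measurable]: "g \<in> borel_measurable borel"
  using gauge_continuous by (rule borel_measurable_continuous_onI)

lemma gauge_pos: assumes "y \<noteq> 0" shows "g y > 0"
proof -
  obtain R where R: "R > 0" "\<And>z. z \<in> K \<Longrightarrow> norm z \<le> R"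
    using compact_imp_bounded[OF K(1)] bounded_pos by metis
  have "(1 / R) *\<^sub>R sgn y \<in> P" unfolding polar_set_def
  proof (clarify)
    fix z assume "z \<in> K"
    have "sgn y \<bullet> z \<le> norm (sgn y) * norm z" by (rule norm_cauchy_schwarz)
    also have "\<dots> \<le> R" using R(2)[OF \<open>z \<in> K\<close>] assms by (simp add: norm_sgn)
    finally show "(1 / R) *\<^sub>R sgn y \<bullet> z \<le> 1" using R(1) by simp
  qed
  then have "(1 / R) *\<^sub>R sgn y \<bullet> y \<le> g y" by (rule gauge_ge)
  moreover have "sgn y \<bullet> y > 0" using assms by (simp add: sgn_div_norm)
  ultimately show ?thesis using R(1) by (metis divide_pos_pos inner_scaleR_left less_le_trans
      mult_pos_pos zero_less_one)
qed

text \<open>The bipolar theorem. A hyperplane separating \<open>y\<close> from \<open>K\<close>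
  misses the origin, so its normal can be rescaled to an element of the polar set with value above 1
  at \<open>y\<close>.\<close>

lemma mem_iff_gauge: "y \<in> K \<longleftrightarrow> g y \<le> 1"
proof
  assume "y \<in> K"
  obtain p where p: "p \<in> N y" using subgrads_nonempty by blast
  then show "g y \<le> 1" using \<open>y \<in> K\<close> by (auto simp: subgrads_def polar_set_def)
next
  assume g: "g y \<le> 1"
  show "y \<in> K"
  proof (rule ccontr)
    assume "y \<notin> K"
    then obtain a b where ab: "a \<bullet> y < b" "\<And>z. z \<in> K \<Longrightarrow> b < a \<bullet> z"
      using separating_hyperplane_closed_point[OF K(2) compact_imp_closed[OF K(1)]] by blast
    have b: "b < 0" using ab(2)[OF zero_mem] by simp
    have "(1 / b) *\<^sub>R a \<in> P" unfolding polar_set_def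
    proof clarify
      fix z assume "z \<in> K"
      then show "(1 / b) *\<^sub>R a \<bullet> z \<le> 1" using ab(2)[of z] b by (simp add: divide_le_eq)
    qed
    then have "(1 / b) *\<^sub>R a \<bullet> y \<le> 1" using gauge_ge g order_trans by blast
    then show False using ab(1) b by (simp add: divide_le_eq)
  qed
qed

lemma closed_K: "closed K" using K by (simp add: compact_imp_closed)

lemma frontier_iff_gauge: "y \<in> frontier K \<longleftrightarrow> g y = 1"
proof -
  have "y \<in> interior K \<longleftrightarrow> g y < 1"
  proof
    assume "g y < 1"
    moreover have "open {z. g z < 1}" using open_Collect_less[OF gauge_continuous continuous_on_const] .
    moreover have "{z. g z < 1} \<subseteq> K" by (simp add: mem_iff_gauge subset_iff)
    ultimately show "y \<in> interior K" using interior_maximal[of "{z. g z < 1}" K] by blast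
  next
    assume "y \<in> interior K"
    then obtain e where e: "e > 0" "cball y e \<subseteq> K" by (auto simp: mem_interior_cball)
    show "g y < 1"
    proof (cases "y = 0")
      case False
      \<comment> \<open>An interior point can be moved outward along its ray by the distance
        \<open>e\<close> without leaving \<open>K\<close>.\<close>
      define t where "t = 1 + e / norm y"
      have t: "t > 1" using e False by (simp add: t_def)
      have "norm (y - t *\<^sub>R y) = \<bar>1 - t\<bar> * norm y" by (metis norm_scaleR scaleR_left_diff_distrib scaleR_one)
      also have "\<dots> = e" using e(1) False by (simp add: t_def)
      finally have "t *\<^sub>R y \<in> K" using e(2) by (auto simp: dist_norm)
      then have "t * g y \<le> 1" using mem_iff_gauge[of "t *\<^sub>R y"] gauge_scale[of t y] t by simp
      moreover have "g y < t * g y" using gauge_pos[OF False] t by simp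
      ultimately show ?thesis by linarith
    qed simp
  qed
  then show ?thesis using closed_K mem_iff_gauge[of y] by (auto simp: frontier_def)
qed

section \<open>Regular points: homogeneity, strict differentiability, measurability\<close>

lemma subgrads_scale: assumes "c > 0" shows "N (c *\<^sub>R y) = N y"
  using assms gauge_scale[of c y] by (auto simp: subgrads_def)

lemma regular_scale: "c > 0 \<Longrightarrow> c *\<^sub>R y \<in> Rg \<longleftrightarrow> y \<in> Rg"
  by (simp add: regular_points_def subgrads_scale)

lemma grad_scale: "c > 0 \<Longrightarrow> gr (c *\<^sub>R y) = gr y"
  by (simp add: gauge_grad_def regular_scale subgrads_scale)

lemma grad_subgrads: assumes "y \<in> Rg" shows "N y = {gr y}"
proof -
  obtain p where "N y = {p}" using assms by (auto simp: regular_points_def)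
  then show ?thesis using assms by (simp add: gauge_grad_def)
qed

lemma grad_mem: "y \<in> Rg \<Longrightarrow> gr y \<in> P" "y \<in> Rg \<Longrightarrow> gr y \<bullet> y = g y"
  using grad_subgrads[of y] subgradsD by blast+

lemma regular_nonzero: "y \<in> Rg \<Longrightarrow> y \<noteq> 0" by (simp add: regular_points_def)

lemma grad_nonzero: "y \<in> Rg \<Longrightarrow> gr y \<noteq> 0"
  using grad_mem(2)[of y] gauge_pos[OF regular_nonzero, of y] by auto

lemma grad_norm_le: "norm (gr y) \<le> M"
  using M(1) M(2)[OF grad_mem(1)] by (cases "y \<in> Rg") (auto simp: gauge_grad_def)

text \<open>Upper semicontinuity of the subdifferential. Outside the ball of radius \<open>e\<close>
  about \<open>gr y\<close> the polar set is compact, so its elements miss the maximum at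
  \<open>y\<close> by a margin \<open>m\<close>, and a small move of \<open>y\<close> cannot make
  this up.\<close>

lemma subgrads_usc:
  assumes y: "y \<in> Rg" and e: "e > 0"
  shows "\<exists>d>0. \<forall>z. dist z y < d \<longrightarrow> (\<forall>q\<in>N z. dist q (gr y) < e)"
proof -
  define Q where "Q = P - ball (gr y) e"
  have Q: "compact Q" unfolding Q_def by (intro compact_diff polar_compact open_ball)
  obtain m where m: "m > 0" "\<And>q. q \<in> Q \<Longrightarrow> m \<le> g y - q \<bullet> y"
  proof (cases "Q = {}")
    case True then show ?thesis using that[of 1] by auto
  next
    case False
    obtain q0 where q0: "q0 \<in> Q" "\<And>q. q \<in> Q \<Longrightarrow> g y - q0 \<bullet> y \<le> g y - q \<bullet> y"
    proof -
      have "continuous_on Q (\<lambda>q. g y - q \<bullet> y)" by (intro continuous_intros)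
      from continuous_attains_inf[OF Q False this] show ?thesis using that by blast
    qed
    have "q0 \<notin> N y" using q0(1) e grad_subgrads[OF y] by (auto simp: Q_def)
    then have "g y - q0 \<bullet> y > 0" using q0(1) gauge_ge[of q0 y] by (auto simp: Q_def subgrads_def)
    then show ?thesis using that q0(2) by blast
  qed
  \<comment> \<open>The margin is spent twice, on the change of the gauge and on that of the
    functional \<open>q\<close>, each at most \<open>M\<close> times the distance.\<close>
  have "dist q (gr y) < e" if z: "dist z y < m / (2 * M)" and q: "q \<in> N z" for z q
  proof (rule ccontr)
    assume "\<not> dist q (gr y) < e"
    then have "q \<in> Q" using subgradsD(1)[OF q] by (auto simp: Q_def dist_commute)
    then have "m \<le> g y - q \<bullet> y" by (rule m(2))
    also have "\<dots> = (g y - g z) + q \<bullet> (z - y)" using subgradsD(2)[OF q] by (simp add: inner_diff_right)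
    also have "\<dots> \<le> M * norm (y - z) + M * norm (z - y)"
    proof (rule add_mono[OF gauge_diff_le])
      have "q \<bullet> (z - y) \<le> norm q * norm (z - y)" by (rule norm_cauchy_schwarz)
      also have "\<dots> \<le> M * norm (z - y)" using M(2)[OF subgradsD(1)[OF q]] by (rule mult_right_mono) simp
      finally show "q \<bullet> (z - y) \<le> M * norm (z - y)" .
    qed
    also have "\<dots> = 2 * M * dist z y" by (simp add: dist_norm norm_minus_commute)
    also have "\<dots> < m" using z M(1) by (simp add: pos_less_divide_eq mult.commute)
    finally show False by simp
  qed
  moreover have "m / (2 * M) > 0" using m(1) M(1) by simp
  ultimately show ?thesis by blast
qed

text \<open>A subgradient at \<open>a\<close> bounds \<open>g a - g b\<close> from above by a
  functional close to \<open>gr y\<close>; exchanging \<open>a\<close> and \<open>b\<close> gives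
  the other side. That both points vary is what the bi-Lipschitz estimates on the boundary
  require.\<close>

lemma gauge_strict_deriv:
  assumes y: "y \<in> Rg" and e: "e > 0"
  shows "\<exists>d>0. \<forall>a\<in>ball y d. \<forall>b\<in>ball y d. \<bar>g a - g b - gr y \<bullet> (a - b)\<bar> \<le> e * norm (a - b)"
proof -
  obtain d where d: "d > 0" "\<And>z q. dist z y < d \<Longrightarrow> q \<in> N z \<Longrightarrow> dist q (gr y) < e"
    using subgrads_usc[OF y e] by blast
  have one: "g a - g b - gr y \<bullet> (a - b) \<le> e * norm (a - b)" if "a \<in> ball y d" for a b
  proof -
    obtain q where q: "q \<in> N a" using subgrads_nonempty by blast
    have "g a - g b \<le> q \<bullet> (a - b)"
      using subgradsD(2)[OF q] gauge_ge[OF subgradsD(1)[OF q], of b] by (simp add: inner_diff_right)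
    then have "g a - g b - gr y \<bullet> (a - b) \<le> (q - gr y) \<bullet> (a - b)" by (simp add: inner_diff_left)
    also have "\<dots> \<le> norm (q - gr y) * norm (a - b)" by (rule norm_cauchy_schwarz)
    also have "\<dots> \<le> e * norm (a - b)"
      using d(2)[OF _ q] that by (intro mult_right_mono) (auto simp: dist_norm norm_minus_commute less_imp_le)
    finally show ?thesis .
  qed
  have "\<bar>g a - g b - gr y \<bullet> (a - b)\<bar> \<le> e * norm (a - b)" if "a \<in> ball y d" "b \<in> ball y d" for a b
    using one[OF that(1), of b] one[OF that(2), of a] by (simp add: norm_minus_commute inner_diff_right abs_le_iff)
  then show ?thesis using d(1) by blast
qed

lemma grad_continuous: "continuous_on Rg gr"
  unfolding continuous_on_iff
proof (intro ballI allI impI)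
  fix y and e :: real assume y: "y \<in> Rg" and e: "e > 0"
  obtain d where d: "d > 0" "\<And>z q. dist z y < d \<Longrightarrow> q \<in> N z \<Longrightarrow> dist q (gr y) < e"
    using subgrads_usc[OF y e] by blast
  have "dist (gr z) (gr y) < e" if "z \<in> Rg" "dist z y < d" for z
    using d(2)[OF that(2)] grad_subgrads[OF that(1)] by simp
  then show "\<exists>d>0. \<forall>z\<in>Rg. dist z y < d \<longrightarrow> dist (gr z) (gr y) < e" using d(1) by blast
qed

text \<open>The regular points are the nonzero part of a countable intersection of open sets:
  \<open>W n\<close> collects the points having a neighbourhood on which any two subgradients differ
  by less than \<open>1 / (n + 1)\<close>.\<close>

lemma regular_borel [measurable]: "Rg \<in> sets borel"
proof -
  define W where "W n = {y. \<exists>d>0. \<forall>z z' q q'. dist z y < d \<longrightarrow> dist z' y < d \<longrightarrow> q \<in> N z \<longrightarrow> q' \<in> N z' \<longrightarrow> dist q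
      q' < 1 / real (Suc n)}" for n
  have "open (W n)" for n
    unfolding open_dist
  proof
    fix y assume "y \<in> W n"
    then obtain d where d: "d > 0" "\<And>z z' q q'. dist z y < d \<Longrightarrow> dist z' y < d \<Longrightarrow> q \<in> N z \<Longrightarrow> q' \<in> N z' \<Longrightarrow> dist
        q q' < 1 / real (Suc n)"
      unfolding W_def by blast
    have "x \<in> W n" if x: "dist x y < d / 2" for x
    proof -
      have "dist z y < d" if "dist z x < d / 2" for z using dist_triangle[of z y x] that x by linarith
      then have "dist q q' < 1 / real (Suc n)" if "dist z x < d / 2" "dist z' x < d / 2" "q \<in> N z" "q' \<in>
          N z'" for z z' q q'
        using d(2)[of z z' q q'] that by blast
      moreover have "d / 2 > 0" using d(1) by simp
      ultimately show ?thesis unfolding W_def by blast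
    qed
    then show "\<exists>e>0. \<forall>x. dist x y < e \<longrightarrow> x \<in> W n" using d(1) by (intro exI[of _ "d / 2"]) auto
  qed
  moreover have "Rg = (\<Inter>n. W n) - {0}"
  proof (intro equalityI subsetI)
    fix y assume y: "y \<in> Rg"
    have "y \<in> W n" for n
    proof -
      obtain d where d: "d > 0" "\<And>z q. dist z y < d \<Longrightarrow> q \<in> N z \<Longrightarrow> dist q (gr y) < 1 / real (Suc n) / 2"
        using subgrads_usc[OF y, of "1 / real (Suc n) / 2"] by auto
      have "dist q q' < 1 / real (Suc n)" if "dist z y < d" "dist z' y < d" "q \<in> N z" "q' \<in> N z'" for z z' q q'
        using dist_triangle_half_l[OF d(2)[OF that(1,3)] d(2)[OF that(2,4)]] .
      then show ?thesis unfolding W_def using d(1) by blast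
    qed
    then show "y \<in> (\<Inter>n. W n) - {0}" using regular_nonzero[OF y] by blast
  next
    fix y assume y: "y \<in> (\<Inter>n. W n) - {0}"
    obtain p where p: "p \<in> N y" using subgrads_nonempty by blast
    have "q = p" if q: "q \<in> N y" for q
    proof (rule ccontr)
      assume "q \<noteq> p"
      then obtain n where n: "1 / real (Suc n) < dist q p" using nat_approx_posE[of "dist q p"] by auto
      have "y \<in> W n" using y by blast
      then obtain d where d: "d > 0" "\<And>z z' q q'. dist z y < d \<Longrightarrow> dist z' y < d \<Longrightarrow> q \<in> N z \<Longrightarrow> q' \<in> N z' \<Longrightarrow>
          dist q q' < 1 / real (Suc n)"
        unfolding W_def by blast
      then have "dist q p < 1 / real (Suc n)" using d(2)[of y y q p] p q by simp
      then show False using n by linarith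
    qed
    then have "N y = {p}" using p by blast
    then show "y \<in> Rg" using y by (auto simp: regular_points_def)
  qed
  ultimately show ?thesis by (auto intro!: sets.Diff sets.countable_INT)
qed

lemma grad_measurable [measurable]: "gr \<in> borel_measurable borel"
proof -
  have "(\<lambda>y. indicator Rg y *\<^sub>R gr y) \<in> borel_measurable borel"
    by (rule borel_measurable_continuous_on_indicator[OF regular_borel grad_continuous])
  moreover have "(\<lambda>y. indicator Rg y *\<^sub>R gr y) = gr" by (auto simp: fun_eq_iff gauge_grad_def indicator_def)
  ultimately show ?thesis by simp
qed

section \<open>Almost every point is regular\<close>

definition second_diff :: "real \<Rightarrow> 'a \<Rightarrow> 'a \<Rightarrow> real" where
  "second_diff s e y = (g (y + s *\<^sub>R e) + g (y - s *\<^sub>R e) - 2 * g y) / s"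

text \<open>Add the subgradient inequality of \<open>p\<close> at \<open>y + s *\<^sub>R e\<close>
  to that of \<open>q\<close> at \<open>y - s *\<^sub>R e\<close>, then exchange \<open>p\<close>
  and \<open>q\<close>. Division by \<open>s\<close> once, not twice, makes
  \<open>second_diff\<close> detect jumps of the gradient instead of curvature.\<close>

lemma second_diff_ge:
  assumes p: "p \<in> N y" and q: "q \<in> N y" and s: "s > 0"
  shows "\<bar>(p - q) \<bullet> e\<bar> \<le> second_diff s e y"
proof -
  have "s * ((p - q) \<bullet> e) \<le> g (y + s *\<^sub>R e) + g (y - s *\<^sub>R e) - 2 * g y" if "p \<in> N y" "q \<in> N y" for p q
    using gauge_ge[OF subgradsD(1)[OF that(1)], of "y + s *\<^sub>R e"] gauge_ge[OF subgradsD(1)[OF that(2)],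
        of "y - s *\<^sub>R e"]
      subgradsD(2)[OF that(1)] subgradsD(2)[OF that(2)]
    by (simp add: inner_add_right inner_diff_right inner_diff_left algebra_simps)
  from this[OF p q] this[OF q p]
  have "s * \<bar>(p - q) \<bullet> e\<bar> \<le> g (y + s *\<^sub>R e) + g (y - s *\<^sub>R e) - 2 * g y"
    by (auto simp: abs_if inner_diff_left algebra_simps)
  then show ?thesis using s unfolding second_diff_def by (simp add: pos_le_divide_eq mult.commute)
qed

text \<open>
  The integral is a difference of integrals of one bounded function over two balls that are
  translates of each other by a vector of length \<open>s\<close>, so only a thin shell contributes. Hence the
  second differences vanish in the limit almost everywhere, without an appeal to Rademacher's theorem.
\<close>
lemma second_diff_integral:
  assumes e: "norm e = 1" and s: "0 < s" "s < k"
  shows "integrable lborel (\<lambda>y. indicator (ball 0 k) y * second_diff s e y)"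
    "(LINT y|lborel. indicator (ball 0 k) y * second_diff s e y)
      \<le> M * (measure lborel (ball (0::'a) (k + s)) - measure lborel (ball (0::'a) (k - s)))"
proof -
  define D where "D y = (g (y + s *\<^sub>R e) - g y) / s" for y
  have D: "\<bar>D y\<bar> \<le> M" for y
    using gauge_lipschitz[of "y + s *\<^sub>R e" y] e s(1) by (simp add: D_def abs_divide pos_divide_le_eq)
  have [measurable]: "D \<in> borel_measurable borel" unfolding D_def by measurable
  define b where "b y = (indicator (ball 0 k) y :: real)" for y :: 'a
  have [measurable]: "b \<in> borel_measurable borel" unfolding b_def by (intro borel_measurable_indicator) simp
  have ib: "integrable lborel (indicator (ball 0 r) :: 'a \<Rightarrow> real)" for r
    by (intro integrable_real_indicator emeasure_bounded_finite bounded_ball) auto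
  have dist: "distr lborel borel ((+) (s *\<^sub>R e)) = (lborel :: 'a measure)" by (rule lborel_distr_plus)
  have "integrable (distr lborel borel ((+) (s *\<^sub>R e))) b" unfolding dist b_def by (rule ib)
  then have ib2: "integrable lborel (\<lambda>y. b (s *\<^sub>R e + y))" by (subst (asm) integrable_distr_eq) auto
  have i1: "integrable lborel (\<lambda>y. b y * D y)"
  proof (rule Bochner_Integration.integrable_bound)
    show "integrable lborel (\<lambda>y. M * b y)" using ib by (simp add: b_def)
    show "AE y in lborel. norm (b y * D y) \<le> norm (M * b y)"
      using D M(1) by (auto simp: b_def indicator_def)
  qed measurable
  have i2: "integrable lborel (\<lambda>y. b (s *\<^sub>R e + y) * D y)"
  proof (rule Bochner_Integration.integrable_bound)
    show "integrable lborel (\<lambda>y. M * b (s *\<^sub>R e + y))" using ib2 by simp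
    show "AE y in lborel. norm (b (s *\<^sub>R e + y) * D y) \<le> norm (M * b (s *\<^sub>R e + y))"
      using D M(1) by (auto simp: b_def indicator_def)
  qed measurable
  have i3: "integrable lborel (\<lambda>y. b y * D (y - s *\<^sub>R e))"
    and e3: "(LINT y|lborel. b y * D (y - s *\<^sub>R e)) = (LINT y|lborel. b (s *\<^sub>R e + y) * D y)"
  proof -
    have "integrable (distr lborel borel ((+) (s *\<^sub>R e))) (\<lambda>y. b y * D (y - s *\<^sub>R e))"
      using i2 by (subst integrable_distr_eq) auto
    then show "integrable lborel (\<lambda>y. b y * D (y - s *\<^sub>R e))" unfolding dist .
    have "(LINT y|distr lborel borel ((+) (s *\<^sub>R e)). b y * D (y - s *\<^sub>R e)) = (LINT y|lborel. b (s *\<^sub>R e + y) * D y)"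
      by (subst integral_distr) auto
    then show "(LINT y|lborel. b y * D (y - s *\<^sub>R e)) = (LINT y|lborel. b (s *\<^sub>R e + y) * D y)" unfolding dist .
  qed
  \<comment> \<open>The second difference compares the difference quotient \<open>D\<close> at
    \<open>y\<close> and at \<open>y - s *\<^sub>R e\<close>; translation invariance has moved the
    shift from \<open>D\<close> to the ball.\<close>
  have eq: "(\<lambda>y. indicator (ball 0 k) y * second_diff s e y) = (\<lambda>y. b y * D y - b y * D (y - s *\<^sub>R e))"
    using s by (auto simp: fun_eq_iff second_diff_def D_def b_def diff_divide_distrib add_divide_distrib
        algebra_simps)
  show "integrable lborel (\<lambda>y. indicator (ball 0 k) y * second_diff s e y)"
    unfolding eq using i1 i3 by (rule Bochner_Integration.integrable_diff)
  have "(LINT y|lborel. indicator (ball 0 k) y * second_diff s e y) = (LINT y|lborel. b y * D y) - (LINT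
      y|lborel. b (s *\<^sub>R e + y) * D y)"
    unfolding eq using i1 i3 e3 by simp
  also have "\<dots> = (LINT y|lborel. b y * D y - b (s *\<^sub>R e + y) * D y)"
    using i1 i2 by simp
  also have "\<dots> \<le> (LINT y::'a|lborel. M * (indicator (ball 0 (k + s)) y - indicator (ball 0 (k - s)) y))"
  proof (rule integral_mono)
    show "integrable lborel (\<lambda>y. b y * D y - b (s *\<^sub>R e + y) * D y)" using i1 i2 by simp
    show "integrable lborel (\<lambda>y::'a. M * (indicator (ball 0 (k + s)) y - indicator (ball 0 (k - s)) y))"
        using ib by simp
    fix y
    have n: "norm (s *\<^sub>R e + y) \<le> s + norm y" "norm y \<le> s + norm (s *\<^sub>R e + y)"
      using norm_triangle_ineq[of "s *\<^sub>R e" y] norm_triangle_ineq[of "s *\<^sub>R e + y" "- (s *\<^sub>R e)"] e s by auto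
    have "\<bar>b y - b (s *\<^sub>R e + y)\<bar> \<le> indicator (ball 0 (k + s)) y - indicator (ball 0 (k - s)) y"
      using n s by (auto simp: b_def indicator_def)
    then have le: "M * \<bar>b y - b (s *\<^sub>R e + y)\<bar> \<le> M * (indicator (ball 0 (k + s)) y - indicator (ball 0 (k - s)) y)"
      using M(1) by (intro mult_left_mono) auto
    have "b y * D y - b (s *\<^sub>R e + y) * D y \<le> \<bar>(b y - b (s *\<^sub>R e + y)) * D y\<bar>"
      by (simp add: left_diff_distrib)
    also have "\<dots> \<le> \<bar>b y - b (s *\<^sub>R e + y)\<bar> * M"
      unfolding abs_mult using D[of y] by (rule mult_left_mono) simp
    finally show "b y * D y - b (s *\<^sub>R e + y) * D y \<le> M * (indicator (ball 0 (k + s)) y - indicator (ball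
        0 (k - s)) y)"
      using le by (simp add: mult.commute)
  qed
  also have "\<dots> = M * (measure lborel (ball (0::'a) (k + s)) - measure lborel (ball (0::'a) (k - s)))"
    using ib by simp
  finally show "(LINT y|lborel. indicator (ball 0 k) y * second_diff s e y)
      \<le> M * (measure lborel (ball (0::'a) (k + s)) - measure lborel (ball (0::'a) (k - s)))" .
qed

text \<open>On this set the integrand is at least \<open>c\<close>, while the integral is at most
  \<open>M\<close> times the volume of a shell of thickness \<open>2 * s\<close>, which tends to 0
  with \<open>s = 1 / (n + 1)\<close>.\<close>

lemma negligible_kink:
  assumes e: "norm e = 1" and c: "c > 0" and k: "k > 1"
  shows "{y \<in> ball 0 k. \<forall>n. c \<le> second_diff (1 / real (Suc n)) e y} \<in> null_sets lborel" (is "?Z \<in> _")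
proof -
  have [measurable]: "(\<lambda>y. second_diff s e y) \<in> borel_measurable borel" for s
    unfolding second_diff_def by measurable
  have Z: "?Z \<in> sets lborel" by measurable
  have fin: "emeasure lborel ?Z < \<infinity>" by (intro emeasure_bounded_finite bounded_subset[OF bounded_ball[of 0 k]]) auto
  have iz: "integrable lborel (indicator ?Z :: 'a \<Rightarrow> real)"
    using Z fin by (intro integrable_real_indicator)
  define F where "F s = M * (measure lborel (ball (0::'a) (k + s)) - measure lborel (ball (0::'a) (k - s)))" for s
  have bound: "c * measure lborel ?Z \<le> F (1 / real (Suc n))" if n: "n \<ge> 1" for n
  proof -
    define s where "s = 1 / real (Suc n)"
    have "s \<le> 1" "0 < s" by (simp_all add: s_def)
    then have s: "0 < s" "s < k" using k by linarith+
    have nn: "second_diff s e y \<ge> 0" for y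
    proof -
      obtain p where "p \<in> N y" using subgrads_nonempty by blast
      from second_diff_ge[OF this this s(1), of e] show ?thesis by simp
    qed
    have "c * measure lborel ?Z = (LINT y|lborel. c * indicator ?Z y)" by simp
    also have "\<dots> \<le> (LINT y|lborel. indicator (ball 0 k) y * second_diff s e y)"
    proof (rule integral_mono)
      show "integrable lborel (\<lambda>y. c * indicator ?Z y)" using iz by simp
      show "integrable lborel (\<lambda>y. indicator (ball 0 k) y * second_diff s e y)"
        by (rule second_diff_integral(1)[OF e s])
      show "c * indicator ?Z y \<le> indicator (ball 0 k) y * second_diff s e y" for y
        using nn[of y] by (auto simp: indicator_def s_def)
    qed
    also have "\<dots> \<le> F s" unfolding F_def by (rule second_diff_integral(2)[OF e s])
    finally show ?thesis by (simp add: s_def)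
  qed
  have "(\<lambda>n. F (1 / real (Suc n))) \<longlonglongrightarrow> 0"
  proof -
    define G where "G s = M * (unit_ball_vol DIM('a) * (k + s) ^ DIM('a) - unit_ball_vol DIM('a) * (k -
        s) ^ DIM('a))" for s
    have "F s = G s" if "0 < s" "s < k" for s using that by (simp add: F_def G_def content_ball)
    moreover have "1 / real (Suc n) < k" for n
    proof -
      have "1 / real (Suc n) \<le> 1" by simp
      then show ?thesis using k by linarith
    qed
    ultimately have "F (1 / real (Suc n)) = G (1 / real (Suc n))" for n
      by simp
    moreover have "(\<lambda>n. G (1 / real (Suc n))) \<longlonglongrightarrow> M * (unit_ball_vol DIM('a) * (k + 0) ^ DIM('a) -
        unit_ball_vol DIM('a) * (k - 0) ^ DIM('a))"
      unfolding G_def using LIMSEQ_inverse_real_of_nat by (intro tendsto_intros) (simp_all add: inverse_eq_divide)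
    ultimately show ?thesis by simp
  qed
  then have "c * measure lborel ?Z \<le> 0"
    using bound by (intro LIMSEQ_le_const[of _ 0 "c * measure lborel ?Z"]) auto
  then have "measure lborel ?Z = 0" using c by (simp add: mult_le_0_iff measure_le_0_iff)
  moreover have "emeasure lborel ?Z = ennreal (measure lborel ?Z)"
    using fin by (intro emeasure_eq_ennreal_measure) auto
  ultimately show ?thesis using Z by (intro null_setsI) (simp_all only: ennreal_0)
qed

text \<open>A nonzero point that is not regular has two subgradients differing in some basis
  direction by more than some \<open>1 / (m + 1)\<close>; hence countably many kink sets and the
  origin cover the exceptional points.\<close>

lemma AE_regular: "AE y in lborel. y \<in> Rg"
proof -
  \<comment> \<open>Adding 2 keeps the radius above 1, as \<open>negligible_kink\<close>
    demands.\<close>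
  define Z where "Z i = {y \<in> ball 0 (real (fst (snd i)) + 2). \<forall>n. 1 / real (Suc (snd (snd i))) \<le>
      second_diff (1 / real (Suc n)) (fst i) y}" 
    for i :: "'a \<times> nat \<times> nat"
  have "Z i \<in> null_sets lborel" if "i \<in> Basis \<times> UNIV" for i
    unfolding Z_def using that by (intro negligible_kink) auto
  then have null: "(\<Union>i\<in>Basis \<times> UNIV. Z i) \<union> {0} \<in> null_sets lborel"
  proof (intro null_sets.Un)
    show "(\<Union>i\<in>Basis \<times> UNIV. Z i) \<in> null_sets lborel"
    proof (rule null_sets_UN')
      show "countable (Basis \<times> (UNIV :: (nat \<times> nat) set) :: ('a \<times> nat \<times> nat) set)"
        by (rule countable_SIGMA) (simp_all add: countable_finite)
    qed fact
  qed (auto intro: finite_imp_null_set_lborel)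
  moreover have "{y \<in> space lborel. y \<notin> Rg} \<subseteq> (\<Union>i\<in>Basis \<times> UNIV. Z i) \<union> {0}"
  proof
    fix y assume "y \<in> {y \<in> space lborel. y \<notin> Rg}"
    then have y: "y \<notin> Rg" by simp
    show "y \<in> (\<Union>i\<in>Basis \<times> UNIV. Z i) \<union> {0}"
    proof (cases "y = 0")
      case False
      obtain p where p: "p \<in> N y" using subgrads_nonempty by blast
      have "N y \<noteq> {p}" using y False by (auto simp: regular_points_def)
      then obtain q where q: "q \<in> N y" "q \<noteq> p" using p by blast
      then obtain e where e: "e \<in> Basis" "(p - q) \<bullet> e \<noteq> 0"
        using euclidean_all_zero_iff[of "p - q"] by auto
      then obtain m where m: "1 / real (Suc m) < \<bar>(p - q) \<bullet> e\<bar>" using nat_approx_posE[of "\<bar>(p - q) \<bullet> e\<bar>"] by auto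
      obtain k :: nat where k: "norm y < real k" using reals_Archimedean2 by blast
      have "1 / real (Suc m) \<le> second_diff (1 / real (Suc n)) e y" for n
        using second_diff_ge[OF p q(1), of "1 / real (Suc n)" e] m by simp
      then have "y \<in> Z (e, k, m)" using k by (simp add: Z_def)
      then show ?thesis using e(1) by blast
    qed simp
  qed
  ultimately show ?thesis by (rule AE_I')
qed

end

section \<open>Volumes of pyramids\<close>

unbundle cross3_syntax

text \<open>Regroups the coordinates so that volumes in \<open>real^3\<close> can be computed by
  Fubini's theorem for the product of a plane and a line.\<close>

definition vec_of_pair :: "(real \<times> real) \<times> real \<Rightarrow> real^3" where
  "vec_of_pair w = vector [fst (fst w), snd (fst w), snd w]"

lemma vec_of_pair_nth [simp]:
  "vec_of_pair w $ 1 = fst (fst w)" "vec_of_pair w $ 2 = snd (fst w)" "vec_of_pair w $ 3 = snd w"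
  by (simp_all add: vec_of_pair_def)

lemma vec_of_pair_measurable [measurable]: "vec_of_pair \<in> borel_measurable borel"
proof (rule borel_measurable_continuous_onI)
  have "vec_of_pair = (\<lambda>w. fst (fst w) *\<^sub>R axis 1 1 + snd (fst w) *\<^sub>R axis 2 1 + snd w *\<^sub>R axis 3 1)"
    by (auto simp: fun_eq_iff vec_eq_iff forall_3 axis_def)
  moreover have "continuous_on UNIV (\<lambda>w. fst (fst w) *\<^sub>R axis 1 1 + snd (fst w) *\<^sub>R axis 2 1 + snd w *\<^sub>R
      (axis 3 1 :: real^3))"
    by (intro continuous_intros)
  ultimately show "continuous_on UNIV vec_of_pair" by (simp only:)
qed

lemma vec_of_pair_lborel: "lborel = distr lborel borel vec_of_pair"
proof (rule lborel_eqI)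
  fix l u :: "real^3" assume le: "\<And>b. b \<in> Basis \<Longrightarrow> l \<bullet> b \<le> u \<bullet> b"
  have le': "l $ i \<le> u $ i" for i using le[of "axis i 1"] by (simp add: inner_axis axis_in_Basis_iff)
  have "vec_of_pair -` box l u = box ((l $ 1, l $ 2), l $ 3) ((u $ 1, u $ 2), u $ 3)"
    by (auto simp: mem_box_cart mem_box Basis_prod_def forall_3)
  then have "emeasure (distr lborel borel vec_of_pair) (box l u) = emeasure lborel (box ((l $ 1, l $ 2),
      l $ 3) ((u $ 1, u $ 2), u $ 3))"
    by (simp add: emeasure_distr)
  also have "\<dots> = ennreal ((u $ 1 - l $ 1) * (u $ 2 - l $ 2) * (u $ 3 - l $ 3))"
    by (subst emeasure_lborel_box) (auto simp: Basis_prod_def le' prod.union_disjoint image_iff mult_ac)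
  also have "(u $ 1 - l $ 1) * (u $ 2 - l $ 2) * (u $ 3 - l $ 3) = (\<Prod>b\<in>Basis. (u - l) \<bullet> b)"
  proof -
    have B: "(Basis :: (real^3) set) = (\<lambda>i. axis i 1) ` UNIV" by (auto simp: Basis_vec_def)
    have "(\<Prod>b\<in>Basis. (u - l) \<bullet> b) = (\<Prod>i\<in>UNIV. (u - l) $ i)"
      unfolding B by (subst prod.reindex) (auto simp: inj_on_def axis_eq_axis inner_axis)
    then show ?thesis unfolding UNIV_3 by simp
  qed
  finally show "emeasure (distr lborel borel vec_of_pair) (box l u) = (\<Prod>b\<in>Basis. (u - l) \<bullet> b)" .
qed simp

text \<open>Slicing by height: the apex is the origin, the slice at height \<open>z\<close> is
  \<open>z\<close> times the base and has \<open>z ^ 2\<close> times its area, and integrating up to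
  height \<open>s\<close> gives \<open>s ^ 3 / 3\<close>.\<close>

lemma emeasure_standard_pyramid:
  fixes B :: "(real \<times> real) set"
  assumes B: "B \<in> sets borel" and s: "0 < s"
  shows "{w::real^3. 0 < w $ 3 \<and> w $ 3 \<le> s \<and> (w $ 1 / w $ 3, w $ 2 / w $ 3) \<in> B} \<in> sets borel"
    "emeasure lborel {w::real^3. 0 < w $ 3 \<and> w $ 3 \<le> s \<and> (w $ 1 / w $ 3, w $ 2 / w $ 3) \<in> B}
      = ennreal (s ^ 3 / 3) * emeasure lborel B"
proof -
  let ?S = "{w::real^3. 0 < w $ 3 \<and> w $ 3 \<le> s \<and> (w $ 1 / w $ 3, w $ 2 / w $ 3) \<in> B}"
  have nth [measurable]: "(\<lambda>w::real^3. w $ i) \<in> borel_measurable borel" for i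
    by (intro borel_measurable_continuous_onI continuous_intros)
  have m: "(\<lambda>w::real^3. (w $ 1 / w $ 3, w $ 2 / w $ 3)) \<in> borel \<rightarrow>\<^sub>M borel"
    unfolding borel_prod[symmetric] by measurable
  have "?S = {w. 0 < w $ 3 \<and> w $ 3 \<le> s} \<inter> (\<lambda>w. (w $ 1 / w $ 3, w $ 2 / w $ 3)) -` B" by auto
  also have "\<dots> \<in> sets borel"
  proof (intro sets.Int)
    show "{w::real^3. 0 < w $ 3 \<and> w $ 3 \<le> s} \<in> sets borel" by measurable
    show "(\<lambda>w::real^3. (w $ 1 / w $ 3, w $ 2 / w $ 3)) -` B \<in> sets borel"
      using measurable_sets[OF m B] by simp
  qed
  finally show S: "?S \<in> sets borel" .
  define X where "X = vec_of_pair -` ?S"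
  have X: "X \<in> sets (lborel \<Otimes>\<^sub>M lborel)"
    using measurable_sets[OF vec_of_pair_measurable S] unfolding X_def lborel_prod by simp
  have "emeasure lborel ?S = emeasure (distr lborel borel vec_of_pair) ?S" by (simp flip: vec_of_pair_lborel)
  also have "\<dots> = emeasure (lborel \<Otimes>\<^sub>M lborel) X" 
    using S unfolding X_def lborel_prod by (subst emeasure_distr) auto
  also have "\<dots> = (\<integral>\<^sup>+z. emeasure lborel ((\<lambda>q. (q, z)) -` X) \<partial>lborel)"
    by (rule lborel_pair.emeasure_pair_measure_alt2[OF X])
  also have "\<dots> = (\<integral>\<^sup>+z. ennreal (z\<^sup>2) * indicator {0..s} z * emeasure lborel B \<partial>lborel)"
  proof (intro nn_integral_cong)
    fix z :: real
    have "(\<lambda>q. (q, z)) -` X = (if 0 < z \<and> z \<le> s then (*\<^sub>R) z ` B else {})"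
    proof (cases "0 < z \<and> z \<le> s")
      case True
      have "(fst q / z, snd q / z) = (1 / z) *\<^sub>R q" for q :: "real \<times> real" by (simp add: prod_eq_iff)
      moreover have "(1 / z) *\<^sub>R q \<in> B \<longleftrightarrow> q \<in> (*\<^sub>R) z ` B" for q
        using True by (auto simp: image_iff intro!: bexI[of _ "(1 / z) *\<^sub>R q"])
      ultimately show ?thesis using True by (auto simp: X_def)
    qed (auto simp: X_def)
    moreover have "emeasure lborel ((*\<^sub>R) z ` B) = ennreal (z\<^sup>2) * emeasure lborel B" if z: "z > 0"
    proof -
      have "(*\<^sub>R) z ` B = (\<lambda>q. (1 / z) *\<^sub>R q) -` B"
        using z by (auto simp: image_iff intro!: bexI[of _ "(1 / z) *\<^sub>R _"])
      also have "\<dots> \<in> sets borel"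
        using measurable_sets[of "\<lambda>q. (1 / z) *\<^sub>R q" borel borel B] B by simp
      finally have "emeasure lborel ((*\<^sub>R) z ` B) = emeasure lebesgue ((*\<^sub>R) z ` B)" by simp
      also have "\<dots> = ennreal (z\<^sup>2) * emeasure lebesgue B"
        using emeasure_lebesgue_affine[of z 0 B] z by (simp add: power2_eq_square)
      finally show ?thesis using B by simp
    qed
    ultimately show "emeasure lborel ((\<lambda>q. (q, z)) -` X) = ennreal (z\<^sup>2) * indicator {0..s} z * emeasure lborel B"
      by (auto simp: indicator_def)
  qed
  also have "\<dots> = (\<integral>\<^sup>+z. ennreal (z\<^sup>2) * indicator {0..s} z \<partial>lborel) * emeasure lborel B"
    by (rule nn_integral_multc) measurable
  also have "(\<integral>\<^sup>+z. ennreal (z\<^sup>2) * indicator {0..s} z \<partial>lborel) = ennreal (s ^ 3 / 3 - 0 ^ 3 / 3)"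
    using s by (intro nn_integral_FTC_Icc) (auto intro!: derivative_eq_intros)
  finally show "emeasure lborel ?S = ennreal (s ^ 3 / 3) * emeasure lborel B" by simp
qed

text \<open>The orientation \<open>e1 \<times> e2 = sgn p\<close> allows the determinant formed with
  a third vector to be evaluated as a triple product.\<close>

lemma plane_frame:
  fixes p :: "real^3" assumes p: "p \<noteq> 0"
  obtains e1 e2 where "norm e1 = 1" "norm e2 = 1" "e1 \<bullet> e2 = 0" "p \<bullet> e1 = 0" "p \<bullet> e2 = 0"
    "e1 \<times> e2 = sgn p" "\<And>y. p \<bullet> y = 0 \<Longrightarrow> y = (y \<bullet> e1) *\<^sub>R e1 + (y \<bullet> e2) *\<^sub>R e2"
proof -
  obtain w where w: "w \<noteq> 0" "orthogonal p w"
    using orthogonal_to_vector_exists[of p] by auto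
  define e1 where "e1 = sgn w"
  define u where "u = sgn p"
  define e2 where "e2 = u \<times> e1"
  have n1: "e1 \<bullet> e1 = 1" using w by (simp add: e1_def norm_sgn flip: power2_norm_eq_inner)
  have nu: "u \<bullet> u = 1" using p by (simp add: u_def norm_sgn flip: power2_norm_eq_inner)
  have o: "u \<bullet> e1 = 0" using w by (simp add: u_def e1_def sgn_div_norm orthogonal_def)
  have o2: "e1 \<bullet> e2 = 0" "u \<bullet> e2 = 0" by (simp_all add: e2_def dot_cross_self)
  have c12: "e1 \<times> e2 = u" using n1 o by (simp add: e2_def Lagrange inner_commute)
  have n2: "e2 \<bullet> e2 = 1"
    unfolding e2_def dot_cross using n1 nu o by (simp add: inner_commute)
  have pu: "p = norm p *\<^sub>R u" using p by (simp add: u_def sgn_div_norm)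
  have dec: "y = (y \<bullet> e1) *\<^sub>R e1 + (y \<bullet> e2) *\<^sub>R e2" if "p \<bullet> y = 0" for y
  proof -
    have uy: "u \<bullet> y = 0" using that by (simp add: u_def sgn_div_norm)
    \<comment> \<open>True for \<open>y\<close> orthogonal to the unit vector \<open>u\<close>;
      expanding \<open>y \<times> u\<close> through \<open>u = e1 \<times> e2\<close> then produces
      the coordinates.\<close>
    have "y = u \<times> (y \<times> u)" using uy nu by (simp add: Lagrange)
    also have "y \<times> u = (y \<bullet> e2) *\<^sub>R e1 - (y \<bullet> e1) *\<^sub>R e2"
      unfolding c12[symmetric] by (rule Lagrange)
    also have "u \<times> ((y \<bullet> e2) *\<^sub>R e1 - (y \<bullet> e1) *\<^sub>R e2) = (y \<bullet> e2) *\<^sub>R (u \<times> e1) - (y \<bullet> e1) *\<^sub>R (u \<times> e2)"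
      by (simp add: Cross3.right_diff_distrib cross_mult_right)
    also have "u \<times> e1 = e2" by (simp add: e2_def)
    also have "u \<times> e2 = - e1" unfolding e2_def Lagrange using nu o by simp
    finally show ?thesis by (simp add: add.commute)
  qed
  show ?thesis
  proof (rule that[of e1 e2])
    show "norm e1 = 1" "norm e2 = 1" using n1 n2 by (simp_all add: norm_eq_sqrt_inner)
    show "p \<bullet> e1 = 0" "p \<bullet> e2 = 0" using o o2 by (subst pu; simp)+
  qed (use o2 c12 dec u_def in auto)
qed

text \<open>The set is the image of the standard pyramid under the linear map with columns
  \<open>e1\<close>, \<open>e2\<close>, \<open>x\<close>. Its determinant is
  \<open>sgn p \<bullet> x = 1 / norm p\<close>, the distance of the base plane from the
  origin.\<close>

lemma emeasure_pyramid:
  fixes B :: "(real \<times> real) set" and p x e1 e2 :: "real^3"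
  assumes B: "B \<in> sets borel" "bounded B" and s: "0 < s" and p: "p \<noteq> 0" and x: "p \<bullet> x = 1" and c: "e1 \<times> e2 = sgn p"
  shows "{z *\<^sub>R (x + fst q *\<^sub>R e1 + snd q *\<^sub>R e2) | q z. q \<in> B \<and> 0 < z \<and> z \<le> s} \<in> sets lebesgue"
    "emeasure lebesgue {z *\<^sub>R (x + fst q *\<^sub>R e1 + snd q *\<^sub>R e2) | q z. q \<in> B \<and> 0 < z \<and> z \<le> s}
     = ennreal (s ^ 3 / (3 * norm p) * measure lborel B)"
proof -
  let ?S = "{w::real^3. 0 < w $ 3 \<and> w $ 3 \<le> s \<and> (w $ 1 / w $ 3, w $ 2 / w $ 3) \<in> B}"
  let ?V = "{z *\<^sub>R (x + fst q *\<^sub>R e1 + snd q *\<^sub>R e2) | q z. q \<in> B \<and> 0 < z \<and> z \<le> s}"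
  define A where "A w = w $ 1 *\<^sub>R e1 + w $ 2 *\<^sub>R e2 + w $ 3 *\<^sub>R x" for w :: "real^3"
  have lin: "linear A" unfolding A_def by (intro linearI) (auto simp: algebra_simps)
  have "det (matrix A) = e1 \<times> e2 \<bullet> x"
    by (simp add: matrix_def A_def det_3 cross3_simps axis_def)
  also have "\<dots> = 1 / norm p" using x by (simp add: c sgn_div_norm inverse_eq_divide)
  finally have det: "det (matrix A) = 1 / norm p" .
  have finB: "emeasure lborel B = ennreal (measure lborel B)"
    using emeasure_bounded_finite[OF B(2)] by (intro emeasure_eq_ennreal_measure) auto
  have mS: "emeasure lebesgue ?S = ennreal (s ^ 3 / 3 * measure lborel B)"
    using emeasure_standard_pyramid[OF B(1) s] s finB by (simp add: ennreal_mult[symmetric])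
  have S: "?S \<in> lmeasurable"
    using emeasure_standard_pyramid(1)[OF B(1) s] mS by (intro fmeasurableI) auto
  have meS: "measure lebesgue ?S = s ^ 3 / 3 * measure lborel B"
    using mS s by (intro measure_eq_emeasure_eq_ennreal) auto
  have "?V = A ` ?S"
  proof (intro equalityI subsetI)
    fix y assume "y \<in> ?V"
    then obtain q z where q: "y = z *\<^sub>R (x + fst q *\<^sub>R e1 + snd q *\<^sub>R e2)" "q \<in> B" "0 < z" "z \<le> s" by blast
    define w where "w = vec_of_pair (z *\<^sub>R q, z)"
    have "w \<in> ?S" using q by (simp add: w_def)
    moreover have "y = A w" by (simp add: q(1) A_def w_def scaleR_add_right)
    ultimately show "y \<in> A ` ?S" by blast
  next
    fix y assume "y \<in> A ` ?S"
    then obtain w where w: "y = A w" "w \<in> ?S" by blast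
    then have "y = w $ 3 *\<^sub>R (x + fst (w $ 1 / w $ 3, w $ 2 / w $ 3) *\<^sub>R e1 + snd (w $ 1 / w $ 3, w $ 2 /
        w $ 3) *\<^sub>R e2)"
      by (simp add: A_def scaleR_add_right)
    then show "y \<in> ?V" using w(2) by blast
  qed
  moreover have "A ` ?S \<in> lmeasurable" "measure lebesgue (A ` ?S) = \<bar>det (matrix A)\<bar> * measure lebesgue ?S"
    using measurable_linear_image[OF lin S] measure_linear_image[OF lin S] by auto
  ultimately have V: "?V \<in> lmeasurable" "measure lebesgue ?V = s ^ 3 / (3 * norm p) * measure lborel B"
    using det meS by auto
  show "?V \<in> sets lebesgue" using V(1) by auto
  show "emeasure lebesgue ?V = ennreal (s ^ 3 / (3 * norm p) * measure lborel B)"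
    using V by (simp add: emeasure_eq_measure2)
qed

section \<open>Surface area and cone volume\<close>

text \<open>Each bounded expression tends to 1 as \<open>e\<close> decreases to 0. They control the
  Lipschitz constants of the radial projection and of its inverse, and the gauge on the tangent
  plane together with its reciprocal.\<close>

lemma bilipschitz_constant:
  fixes T C :: real assumes T: "T > 1"
  obtains e where "0 < e" "e < 1" "1 / (1 - e) + C * e / (1 - e)\<^sup>2 \<le> T" "1 / T \<le> 1 / (1 + e) - C * e / (1 - e)\<^sup>2"
    "1 + e \<le> T" "1 / (1 - e) \<le> T"
proof -
  have "((\<lambda>e. 1 / (1 - e) + C * e / (1 - e)\<^sup>2) \<longlongrightarrow> 1 / (1 - 0) + C * 0 / (1 - 0)\<^sup>2) (at_right 0)"
    by (intro tendsto_intros) auto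
  then have 1: "\<forall>\<^sub>F e in at_right 0. 1 / (1 - e) + C * e / (1 - e)\<^sup>2 < T" by (rule order_tendstoD) (use T in simp)
  have "((\<lambda>e. 1 / (1 + e) - C * e / (1 - e)\<^sup>2) \<longlongrightarrow> 1 / (1 + 0) - C * 0 / (1 - 0)\<^sup>2) (at_right 0)"
    by (intro tendsto_intros) auto
  then have 2: "\<forall>\<^sub>F e in at_right 0. 1 / T < 1 / (1 + e) - C * e / (1 - e)\<^sup>2" by (rule order_tendstoD) (use T in simp)
  have "((\<lambda>e::real. 1 + e) \<longlongrightarrow> 1 + 0) (at_right 0)" by (intro tendsto_intros)
  then have 3: "\<forall>\<^sub>F e in at_right 0. 1 + e < T" by (rule order_tendstoD) (use T in simp)
  have "((\<lambda>e::real. 1 / (1 - e)) \<longlongrightarrow> 1 / (1 - 0)) (at_right 0)" by (intro tendsto_intros) auto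
  then have 4: "\<forall>\<^sub>F e in at_right 0. 1 / (1 - e) < T" by (rule order_tendstoD) (use T in simp)
  have 5: "\<forall>\<^sub>F e in at_right (0::real). 0 < e \<and> e < 1"
    using eventually_at_right_real[of 0 1] by (auto elim: eventually_mono)
  have "\<forall>\<^sub>F e in at_right 0. (1 / (1 - e) + C * e / (1 - e)\<^sup>2 < T \<and> 1 / T < 1 / (1 + e) - C * e / (1 -
      e)\<^sup>2) \<and> (1 + e < T \<and> 1 / (1 - e) < T) \<and> 0 < e \<and> e < 1"
    by (intro eventually_conj 1 2 3 4 5)
  then obtain e where "(1 / (1 - e) + C * e / (1 - e)\<^sup>2 < T \<and> 1 / T < 1 / (1 + e) - C * e / (1 - e)\<^sup>2) \<and>
      (1 + e < T \<and> 1 / (1 - e) < T) \<and> 0 < e \<and> e < 1"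
    using eventually_happens'[OF trivial_limit_at_right_real] by blast
  then show ?thesis using that[of e] by linarith
qed

section \<open>Surface area as an image of a weighted Lebesgue measure on the body\<close>

locale gauged_body3 = gauged_body K for K :: "(real^3) set"
begin

definition "rad y = (1 / g y) *\<^sub>R y"

text \<open>A cone from the origin over a small boundary patch with normal \<open>p = gr y\<close>
  has height \<open>1 / norm p\<close>, so its volume is the area of the patch divided by
  \<open>3 * norm p\<close>. The density compensates this factor, and \<open>rad\<close> carries the
  mass to the boundary.\<close>

definition "surf = distr (density lborel (\<lambda>y. indicator K y * ennreal (3 * norm (gr y)))) borel rad"

lemma rad_measurable [measurable]: "rad \<in> borel_measurable borel"
  unfolding rad_def by measurable

lemma K_borel [measurable]: "K \<in> sets borel"
  using closed_K by simp

lemma sets_surf [simp]: "sets surf = sets borel" by (simp add: surf_def)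

lemma emeasure_surf:
  assumes A: "A \<in> sets borel"
  shows "emeasure surf A = (\<integral>\<^sup>+y. ennreal (3 * norm (gr y)) * indicator {y \<in> K. rad y \<in> A} y \<partial>lborel)"
proof -
  have "rad -` A \<in> sets borel" using measurable_sets[OF rad_measurable A] by simp
  then have "emeasure surf A = (\<integral>\<^sup>+y. (indicator K y * ennreal (3 * norm (gr y))) * indicator (rad -` A) y \<partial>lborel)"
    unfolding surf_def using A by (simp add: emeasure_distr emeasure_density)
  also have "\<dots> = (\<integral>\<^sup>+y. ennreal (3 * norm (gr y)) * indicator {y \<in> K. rad y \<in> A} y \<partial>lborel)"
    by (intro nn_integral_cong) (auto simp: indicator_def)
  finally show ?thesis .
qed

text \<open>
  Near a regular boundary point \<open>x\<close> with normal \<open>p\<close> the radial projection \<open>\<psi>\<close> from the tangent plane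
  \<open>x + J q\<close> onto the boundary is almost an isometry, because the gauge is strictly differentiable at \<open>x\<close>
  and its derivative vanishes along the plane.
\<close>
lemma local_area_comparison:
  assumes x: "x \<in> Rg" "g x = 1" and T: "T > 1"
  shows "\<exists>\<rho>>0. \<forall>A. A \<in> sets borel \<longrightarrow> A \<subseteq> Rg \<inter> frontier K \<inter> ball x \<rho> \<longrightarrow>
     hausdorff_measure 2 A \<le> ennreal (T ^ 6) * emeasure surf A \<and>
     (\<forall>d\<ge>0. (\<forall>a\<in>A. \<forall>b\<in>A. dist a b \<le> d) \<longrightarrow> emeasure surf A \<le> ennreal (T ^ 6) * ennreal (unit_ball_vol (real
         2) / 2 ^ 2 * d ^ 2))"
proof -
  define p where "p = gr x"
  have px: "p \<bullet> x = 1" using grad_mem(2)[OF x(1)] x(2) by (simp add: p_def)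
  have p0: "p \<noteq> 0" unfolding p_def by (rule grad_nonzero[OF x(1)])
  then have np: "norm p > 0" by simp
  have T0: "T > 0" using T by simp
  obtain e1 e2 where e: "norm e1 = 1" "norm e2 = 1" "e1 \<bullet> e2 = 0" "p \<bullet> e1 = 0" "p \<bullet> e2 = 0"
    "e1 \<times> e2 = sgn p" "\<And>y. p \<bullet> y = 0 \<Longrightarrow> y = (y \<bullet> e1) *\<^sub>R e1 + (y \<bullet> e2) *\<^sub>R e2"
    using plane_frame[OF p0] by metis
  define J where "J q = fst q *\<^sub>R e1 + snd q *\<^sub>R e2" for q :: "real \<times> real"
  have Jdiff: "J q - J q' = J (q - q')" for q q' by (simp add: J_def algebra_simps)
  have e11: "e1 \<bullet> e1 = 1" "e2 \<bullet> e2 = 1" using e(1,2) by (simp_all add: norm_eq_1)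
  have Jnorm: "norm (J q) = norm q" for q
  proof -
    have "(norm (J q))\<^sup>2 = (fst q)\<^sup>2 + (snd q)\<^sup>2"
      unfolding power2_norm_eq_inner J_def
      by (simp add: inner_add_left inner_add_right e11 e(3) inner_commute[of e2 e1] power2_eq_square)
    then show ?thesis by (simp add: norm_prod_def real_sqrt_unique[symmetric])
  qed
  have pJ: "p \<bullet> J q = 0" for q by (simp add: J_def inner_add_right e)
  define E where "E q = x + J q" for q
  define w where "w q = g (E q)" for q
  define \<psi> where "\<psi> q = (1 / w q) *\<^sub>R E q" for q
  have pE: "p \<bullet> E q = 1" for q by (simp add: E_def inner_add_right px pJ)
  have E0: "E q \<noteq> 0" for q using pE[of q] by auto
  have w0: "w q > 0" for q unfolding w_def by (rule gauge_pos[OF E0])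
  \<comment> \<open>Bounds \<open>norm (E q)\<close>, because the parameters \<open>q\<close> will
    have norm below \<open>\<delta> \<le> 1\<close>.\<close>
  define C where "C = norm x + 1"
  obtain \<epsilon> where ep: "0 < \<epsilon>" "\<epsilon> < 1" "1 / (1 - \<epsilon>) + C * \<epsilon> / (1 - \<epsilon>)\<^sup>2 \<le> T" "1 / T \<le> 1 / (1 + \<epsilon>) - C * \<epsilon> / (1 - \<epsilon>)\<^sup>2"
    "1 + \<epsilon> \<le> T" "1 / (1 - \<epsilon>) \<le> T" using bilipschitz_constant[OF T] by metis
  obtain \<delta>1 where d1: "\<delta>1 > 0" "\<And>a b. a \<in> ball x \<delta>1 \<Longrightarrow> b \<in> ball x \<delta>1 \<Longrightarrow> \<bar>g a - g b - p \<bullet> (a - b)\<bar> \<le> \<epsilon> * norm (a - b)"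
    using gauge_strict_deriv[OF x(1) ep(1)] unfolding p_def by blast
  \<comment> \<open>This tolerance keeps \<open>norm (gr z)\<close> between
    \<open>norm p / T\<close> and \<open>T * norm p\<close>; the upper bound uses
    \<open>2 - 1 / T \<le> T\<close>.\<close>
  have eg: "(1 - 1 / T) * norm p > 0" using T np by simp
  obtain \<delta>2 where d2: "\<delta>2 > 0" "\<And>z q. dist z x < \<delta>2 \<Longrightarrow> q \<in> N z \<Longrightarrow> dist q p < (1 - 1 / T) * norm p"
    using subgrads_usc[OF x(1) eg] unfolding p_def by blast
  have grb: "norm p / T \<le> norm (gr z)" "norm (gr z) \<le> T * norm p" if z: "z \<in> Rg" "dist z x < \<delta>2" for z
  proof -
    have "dist (gr z) p < (1 - 1 / T) * norm p" using d2(2)[OF z(2)] grad_subgrads[OF z(1)] by simp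
    then have d: "norm (gr z - p) < norm p - norm p / T" by (simp add: dist_norm algebra_simps)
    then show "norm p / T \<le> norm (gr z)" using norm_triangle_ineq2[of p "gr z"] by (simp add: norm_minus_commute)
    have "1 \<le> 1 / T + (T - 1)" 
    proof -
      have "(T - 1) * (T - 1) \<ge> 0" by simp
      then show ?thesis using T by (simp add: field_simps)
    qed
    then have "norm p * 1 \<le> norm p * (1 / T + (T - 1))" by (intro mult_left_mono) auto
    then have "2 * norm p - norm p / T \<le> T * norm p" by (simp add: algebra_simps)
    then show "norm (gr z) \<le> T * norm p" using d norm_triangle_ineq2[of "gr z" p] by linarith
  qed
  define \<delta> where "\<delta> = min \<delta>1 1"
  have dl: "\<delta> > 0" using d1 by (simp add: \<delta>_def)
  have Eb: "E q \<in> ball x \<delta>1" "norm (E q) \<le> C" if "q \<in> ball 0 \<delta>" for q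
  proof -
    have "norm (J q) < \<delta>" using that Jnorm by simp
    then show "E q \<in> ball x \<delta>1" by (simp add: E_def dist_norm \<delta>_def)
    show "norm (E q) \<le> C" using norm_triangle_ineq[of x "J q"] \<open>norm (J q) < \<delta>\<close> by (simp add: E_def C_def \<delta>_def)
  qed
  have Ediff: "E q - E q' = J (q - q')" for q q' by (simp add: E_def Jdiff[symmetric])
  have wd: "\<bar>w q - w q'\<bar> \<le> \<epsilon> * norm (q - q')" if "q \<in> ball 0 \<delta>" "q' \<in> ball 0 \<delta>" for q q'
    using d1(2)[OF Eb(1)[OF that(1)] Eb(1)[OF that(2)]] unfolding Ediff pJ Jnorm by (simp add: w_def)
  have w1: "1 - \<epsilon> \<le> w q" "w q \<le> 1 + \<epsilon>" if q: "q \<in> ball 0 \<delta>" for q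
  proof -
    have "w 0 = 1" by (simp add: w_def E_def J_def x(2))
    moreover have "\<bar>w q - w 0\<bar> \<le> \<epsilon> * norm (q - 0)" by (rule wd[OF q]) (use dl in simp)
    moreover have "\<epsilon> * norm (q - 0) \<le> \<epsilon> * 1" using q ep(1) by (intro mult_left_mono) (auto simp: \<delta>_def)
    ultimately show "1 - \<epsilon> \<le> w q" "w q \<le> 1 + \<epsilon>" by linarith+
  qed
  have \<psi>diff: "\<psi> q - \<psi> q' = (1 / w q) *\<^sub>R J (q - q') + (1 / w q - 1 / w q') *\<^sub>R E q'" for q q'
    unfolding \<psi>_def Ediff[symmetric] by (simp add: algebra_simps)
  have rest: "norm ((1 / w q - 1 / w q') *\<^sub>R E q') \<le> C * \<epsilon> / (1 - \<epsilon>)\<^sup>2 * norm (q - q')" if q: "q \<in> ball 0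
      \<delta>" "q' \<in> ball 0 \<delta>" for q q'
  proof -
    have "1 / w q - 1 / w q' = (w q' - w q) / (w q * w q')" using w0[of q] w0[of q'] by (simp add: field_simps)
    then have "\<bar>1 / w q - 1 / w q'\<bar> = \<bar>w q - w q'\<bar> / (w q * w q')"
      using w0[of q] w0[of q'] by (simp add: abs_divide abs_minus_commute)
    also have "\<dots> \<le> (\<epsilon> * norm (q - q')) / ((1 - \<epsilon>) * (1 - \<epsilon>))"
      using wd[OF q] w1[OF q(1)] w1[OF q(2)] ep by (intro frac_le mult_mono) auto
    finally have "norm ((1 / w q - 1 / w q') *\<^sub>R E q') \<le> (\<epsilon> * norm (q - q')) / ((1 - \<epsilon>) * (1 - \<epsilon>)) * C"
      unfolding norm_scaleR real_norm_def using Eb(2)[OF q(2)] ep by (intro mult_mono) auto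
    then show ?thesis by (simp add: power2_eq_square mult_ac)
  qed
  have lip: "dist (\<psi> q) (\<psi> q') \<le> T * dist q q'" if q: "q \<in> ball 0 \<delta>" "q' \<in> ball 0 \<delta>" for q q'
  proof -
    have "norm (\<psi> q - \<psi> q') \<le> norm ((1 / w q) *\<^sub>R J (q - q')) + norm ((1 / w q - 1 / w q') *\<^sub>R E q')"
      unfolding \<psi>diff by (rule norm_triangle_ineq)
    also have "norm ((1 / w q) *\<^sub>R J (q - q')) = (1 / w q) * norm (q - q')" using w0[of q] by (simp add: Jnorm)
    also have "\<dots> \<le> 1 / (1 - \<epsilon>) * norm (q - q')"
      using w1[OF q(1)] ep w0[of q] by (intro mult_right_mono divide_left_mono) auto
    finally have "norm (\<psi> q - \<psi> q') \<le> (1 / (1 - \<epsilon>) + C * \<epsilon> / (1 - \<epsilon>)\<^sup>2) * norm (q - q')"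
      using rest[OF q] by (simp add: distrib_right)
    also have "\<dots> \<le> T * norm (q - q')" using ep(3) by (rule mult_right_mono) simp
    finally show ?thesis by (simp add: dist_norm)
  qed
  have colip: "dist q q' \<le> T * dist (\<psi> q) (\<psi> q')" if q: "q \<in> ball 0 \<delta>" "q' \<in> ball 0 \<delta>" for q q'
  proof -
    have "norm ((1 / w q) *\<^sub>R J (q - q')) - norm ((1 / w q - 1 / w q') *\<^sub>R E q') \<le> norm (\<psi> q - \<psi> q')"
      unfolding \<psi>diff using norm_diff_ineq by blast
    moreover have "norm ((1 / w q) *\<^sub>R J (q - q')) = (1 / w q) * norm (q - q')" using w0[of q] by (simp add: Jnorm)
    moreover have "1 / (1 + \<epsilon>) * norm (q - q') \<le> (1 / w q) * norm (q - q')"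
      using w1[OF q(1)] ep w0[of q] by (intro mult_right_mono divide_left_mono) auto
    ultimately have "(1 / (1 + \<epsilon>) - C * \<epsilon> / (1 - \<epsilon>)\<^sup>2) * norm (q - q') \<le> norm (\<psi> q - \<psi> q')"
      using rest[OF q] by (simp add: left_diff_distrib)
    moreover have "1 / T * norm (q - q') \<le> (1 / (1 + \<epsilon>) - C * \<epsilon> / (1 - \<epsilon>)\<^sup>2) * norm (q - q')"
      using ep(4) by (rule mult_right_mono) simp
    ultimately have "1 / T * norm (q - q') \<le> norm (\<psi> q - \<psi> q')" by linarith
    then show ?thesis using T0 by (simp add: dist_norm pos_divide_le_eq mult.commute)
  qed
  \<comment> \<open>Central projection to the plane \<open>p \<bullet> y = 1\<close> inverts
    \<open>\<psi>\<close>. Its continuity at \<open>x\<close> turns closeness to \<open>x\<close>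
    into a parameter of norm below \<open>\<delta>\<close>.\<close>
  have "isCont (\<lambda>a. (1 / (p \<bullet> a)) *\<^sub>R a) x" using px by (intro continuous_intros) auto
  then obtain \<rho>1 where r1: "\<rho>1 > 0" "\<And>a. dist a x < \<rho>1 \<Longrightarrow> dist ((1 / (p \<bullet> a)) *\<^sub>R a) ((1 / (p \<bullet> x)) *\<^sub>R x) < \<delta>"
    using dl unfolding continuous_at_eps_delta by blast
  have "isCont (\<lambda>a. p \<bullet> a) x" by (intro continuous_intros)
  then obtain \<rho>2 where r2: "\<rho>2 > 0" "\<And>a. dist a x < \<rho>2 \<Longrightarrow> dist (p \<bullet> a) (p \<bullet> x) < 1"
    unfolding continuous_at_eps_delta using zero_less_one by blast
  define \<rho> where "\<rho> = min \<rho>1 (min \<rho>2 \<delta>2)"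
  have \<rho>: "\<rho> > 0" using r1 r2 d2 by (simp add: \<rho>_def)
  have param: "\<exists>q\<in>ball 0 \<delta>. a = \<psi> q" if a: "g a = 1" "dist a x < \<rho>" for a
  proof -
    have pa: "p \<bullet> a > 0" using r2(2)[of a] a(2) px by (simp add: \<rho>_def dist_real_def)
    define v where "v = (1 / (p \<bullet> a)) *\<^sub>R a - x"
    have nv: "norm v < \<delta>" using r1(2)[of a] a(2) px by (simp add: v_def \<rho>_def dist_norm)
    have "p \<bullet> v = 0" using pa px by (simp add: v_def inner_diff_right)
    then have vJ: "v = J (v \<bullet> e1, v \<bullet> e2)" unfolding J_def using e(7) by simp
    define q where "q = (v \<bullet> e1, v \<bullet> e2)"
    have q: "q \<in> ball 0 \<delta>" using nv vJ Jnorm[of q] by (simp add: q_def)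
    have "x + v = (1 / (p \<bullet> a)) *\<^sub>R a" by (simp add: v_def)
    then have Eq: "E q = (1 / (p \<bullet> a)) *\<^sub>R a" using vJ by (simp add: E_def q_def)
    have "w q = 1 / (p \<bullet> a)" unfolding w_def Eq using gauge_scale[of "1 / (p \<bullet> a)" a] pa a(1) by simp
    then have "\<psi> q = a" unfolding \<psi>_def Eq using pa by simp
    then show ?thesis using q by blast
  qed
  have main: "hausdorff_measure 2 A \<le> ennreal (T ^ 6) * emeasure surf A \<and>
     (\<forall>d\<ge>0. (\<forall>a\<in>A. \<forall>b\<in>A. dist a b \<le> d) \<longrightarrow> emeasure surf A \<le> ennreal (T ^ 6) * ennreal (unit_ball_vol (real
         2) / 2 ^ 2 * d ^ 2))"
    if A: "A \<in> sets borel" "A \<subseteq> Rg \<inter> frontier K \<inter> ball x \<rho>" for A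
  proof -
    have Ag: "g a = 1" "dist a x < \<rho>" "a \<in> Rg" if "a \<in> A" for a
      using that A(2) frontier_iff_gauge[of a] by (auto simp: dist_commute)
    have \<psi>m: "\<psi> \<in> borel_measurable borel"
    proof -
      have "E \<in> borel_measurable borel" unfolding E_def J_def
        by (intro borel_measurable_continuous_onI continuous_intros)
      then show ?thesis unfolding \<psi>_def w_def by measurable
    qed
    define B where "B = ball 0 \<delta> \<inter> \<psi> -` A"
    have B: "B \<in> sets borel" "bounded B" "B \<subseteq> ball 0 \<delta>"
      unfolding B_def using measurable_sets[OF \<psi>m A(1)] by (auto intro: bounded_subset[OF bounded_ball])
    have AB: "A = \<psi> ` B" unfolding B_def using param Ag by blast
    define l where "l = measure lborel B"
    have lB: "emeasure lborel B = ennreal l" unfolding l_def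
      using emeasure_bounded_finite[OF B(2)] by (intro emeasure_eq_ennreal_measure) auto
    have l0: "l \<ge> 0" by (simp add: l_def)
    \<comment> \<open>Solid cones over the tangent patch, scaled by at most \<open>s\<close>. They
      enclose the part \<open>D\<close> of \<open>K\<close> over \<open>A\<close> from inside and
      outside, since the gauge on the patch is within a factor \<open>T\<close> of 1.\<close>
    define V where "V s = {z *\<^sub>R E q | q z. q \<in> B \<and> 0 < z \<and> z \<le> s}" for s
    have V: "V s \<in> sets lebesgue" "emeasure lebesgue (V s) = ennreal (s ^ 3 / (3 * norm p) * l)" if "s > 0" for s
      using emeasure_pyramid[OF B(1,2) that p0 px e(6)] unfolding V_def E_def J_def l_def add.assoc by auto
    define D where "D = {y \<in> K. rad y \<in> A}"
    have D: "D \<in> sets borel" unfolding D_def using A(1) by measurable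
    have VD: "V (1 / T) \<subseteq> D"
    proof
      fix y assume "y \<in> V (1 / T)"
      then obtain q z where q: "y = z *\<^sub>R E q" "q \<in> B" "0 < z" "z \<le> 1 / T" unfolding V_def by blast
      have qb: "q \<in> ball 0 \<delta>" "\<psi> q \<in> A" using q(2) by (auto simp: B_def)
      have gy: "g y = z * w q" unfolding q(1) w_def using q(3) by (simp add: gauge_scale)
      have "z * w q \<le> 1 / T * T" using q(3,4) w1(2)[OF qb(1)] ep(5) w0[of q] T0 by (intro mult_mono) auto
      then have "y \<in> K" using gy T0 mem_iff_gauge[of y] by simp
      moreover have "rad y = \<psi> q" unfolding rad_def gy unfolding q(1) \<psi>_def using q(3) by simp
      ultimately show "y \<in> D" using qb by (simp add: D_def)
    qed
    have DV: "D \<subseteq> V T"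
    proof
      fix y assume "y \<in> D"
      then have y: "y \<in> K" "rad y \<in> A" by (auto simp: D_def)
      then obtain q where q: "q \<in> B" "rad y = \<psi> q" using AB by auto
      have qb: "q \<in> ball 0 \<delta>" using q(1) by (auto simp: B_def)
      have "y \<noteq> 0" using Ag(1)[OF y(2)] by (auto simp: rad_def)
      then have gy: "g y > 0" "g y \<le> 1" using gauge_pos y(1) mem_iff_gauge by auto
      have "y = g y *\<^sub>R rad y" using gy by (simp add: rad_def)
      also have "\<dots> = (g y / w q) *\<^sub>R E q" by (simp add: q(2) \<psi>_def)
      finally have "y = (g y / w q) *\<^sub>R E q" .
      moreover have "g y / w q \<le> 1 / (1 - \<epsilon>)" using gy w1(1)[OF qb] ep by (intro frac_le) auto
      then have "g y / w q \<le> T" using ep(6) by linarith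
      moreover have "g y / w q > 0" using gy w0[of q] by simp
      ultimately show "y \<in> V T" unfolding V_def using q(1) by blast
    qed
    have grD: "norm p / T \<le> norm (gr y)" "norm (gr y) \<le> T * norm p" if y: "y \<in> D" for y
    proof -
      have r: "rad y \<in> A" using y by (simp add: D_def)
      have "y \<noteq> 0" using Ag(1)[OF r] by (auto simp: rad_def)
      then have "gr (rad y) = gr y" unfolding rad_def using gauge_pos by (intro grad_scale) simp
      then show "norm p / T \<le> norm (gr y)" "norm (gr y) \<le> T * norm p"
        using grb[of "rad y"] Ag[OF r] by (auto simp: \<rho>_def)
    qed
    have DL: "emeasure lborel D = emeasure lebesgue D" using D by simp
    \<comment> \<open>The gradient contributes a factor \<open>T\<close> and the scale of the cone
      \<open>T ^ 3\<close>, hence \<open>T ^ 4\<close>.\<close>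
    have "emeasure surf A \<le> (\<integral>\<^sup>+y. ennreal (3 * (T * norm p)) * indicator D y \<partial>lborel)"
      unfolding emeasure_surf[OF A(1)] D_def[symmetric]
      using grD(2) by (intro nn_integral_mono) (auto simp: indicator_def intro!: ennreal_leI)
    also have "\<dots> = ennreal (3 * (T * norm p)) * emeasure lebesgue D"
      using D by (simp add: nn_integral_cmult_indicator)
    also have "\<dots> \<le> ennreal (3 * (T * norm p)) * emeasure lebesgue (V T)"
      using DV V(1)[OF T0] by (intro mult_left_mono emeasure_mono) auto
    also have "\<dots> = ennreal (3 * (T * norm p) * (T ^ 3 / (3 * norm p) * l))"
      unfolding V(2)[OF T0] using T0 l0 by (intro ennreal_mult[symmetric]) auto
    also have "3 * (T * norm p) * (T ^ 3 / (3 * norm p) * l) = T ^ 4 * l"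
      using np by (simp add: eval_nat_numeral)
    finally have up: "emeasure surf A \<le> ennreal (T ^ 4 * l)" .
    have T1: "1 / T > 0" using T0 by simp
    have "ennreal (l / T ^ 4) = ennreal (3 * (norm p / T) * ((1 / T) ^ 3 / (3 * norm p) * l))"
      using np T0 by (simp add: eval_nat_numeral divide_simps)
    also have "\<dots> = ennreal (3 * (norm p / T)) * emeasure lebesgue (V (1 / T))"
      unfolding V(2)[OF T1] using T0 l0 by (intro ennreal_mult) auto
    also have "\<dots> \<le> ennreal (3 * (norm p / T)) * emeasure lebesgue D"
      using VD D by (intro mult_left_mono emeasure_mono) auto
    also have "\<dots> = (\<integral>\<^sup>+y. ennreal (3 * (norm p / T)) * indicator D y \<partial>lborel)"
      using D by (simp add: nn_integral_cmult_indicator)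
    also have "\<dots> \<le> emeasure surf A"
      unfolding emeasure_surf[OF A(1)] D_def[symmetric]
    proof (intro nn_integral_mono)
      show "ennreal (3 * (norm p / T)) * indicator D y \<le> ennreal (3 * norm (gr y)) * indicator D y" for y
      proof (cases "y \<in> D")
        case True
        then have "3 * (norm p / T) \<le> 3 * norm (gr y)" using grD(1) by (intro mult_left_mono) auto
        then show ?thesis by (intro mult_right_mono ennreal_leI) auto
      qed simp
    qed
    finally have low: "ennreal (l / T ^ 4) \<le> emeasure surf A" .
    \<comment> \<open>The map \<open>\<psi>\<close> enlarges planar area by at most
      \<open>T ^ 2\<close>, which raises the total factor to \<open>T ^ 6\<close>.\<close>
    have "hausdorff_measure 2 A \<le> ennreal (T ^ 2) * hausdorff_measure 2 B"
      unfolding AB by (rule hausdorff_lipschitz_image) (use lip B(3) T0 in blast)+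
    also have "\<dots> \<le> ennreal (T ^ 2) * ennreal l"
      using hausdorff_le_lebesgue[of B] B(1) lB by (intro mult_left_mono) (auto simp: numeral_2_eq_2)
    also have "\<dots> = ennreal (T ^ 6) * ennreal (l / T ^ 4)"
      using T0 l0 by (simp add: ennreal_mult[symmetric] eval_nat_numeral)
    also have "\<dots> \<le> ennreal (T ^ 6) * emeasure surf A" using low by (rule mult_left_mono) simp
    finally have fst: "hausdorff_measure 2 A \<le> ennreal (T ^ 6) * emeasure surf A" .
    have "emeasure surf A \<le> ennreal (T ^ 6) * ennreal (unit_ball_vol (real 2) / 2 ^ 2 * d ^ 2)"
      if d: "d \<ge> 0" "\<forall>a\<in>A. \<forall>b\<in>A. dist a b \<le> d" for d
    proof -
      \<comment> \<open>The isodiametric inequality is applied in the parameter plane, where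
        distances exceed those on the boundary by at most the factor \<open>T\<close>.\<close>
      have "measure lebesgue B \<le> unit_ball_vol (real DIM(real \<times> real)) / 2 ^ DIM(real \<times> real) * (T * d) ^
          DIM(real \<times> real)"
      proof (rule isodiametric)
        fix q q' assume q: "q \<in> B" "q' \<in> B"
        have "dist q q' \<le> T * dist (\<psi> q) (\<psi> q')" using colip q B(3) by blast
        also have "\<dots> \<le> T * d" using d(2) q T0 AB by (intro mult_left_mono) auto
        finally show "dist q q' \<le> T * d" .
      qed (use B d T0 in auto)
      then have "l \<le> unit_ball_vol (real 2) / 2 ^ 2 * (T * d) ^ 2" using B(1) by (simp add: l_def power2_eq_square)
      then have "T ^ 4 * l \<le> T ^ 4 * (unit_ball_vol (real 2) / 2 ^ 2 * (T * d) ^ 2)" using T0 by (intro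
          mult_left_mono) auto
      also have "\<dots> = T ^ 6 * (unit_ball_vol (real 2) / 2 ^ 2 * d ^ 2)" by (simp add: eval_nat_numeral)
      finally have "ennreal (T ^ 4 * l) \<le> ennreal (T ^ 6 * (unit_ball_vol (real 2) / 2 ^ 2 * d ^ 2))" by
          (rule ennreal_leI)
      also have "\<dots> = ennreal (T ^ 6) * ennreal (unit_ball_vol (real 2) / 2 ^ 2 * d ^ 2)"
        using T0 d by (intro ennreal_mult) auto
      finally show ?thesis using up by (rule order_trans[rotated])
    qed
    then show ?thesis using fst by blast
  qed
  then show ?thesis using \<rho> by blast
qed

end

section \<open>From the local comparison to equality of Hausdorff measure and
  \<open>surf\<close>\<close>

lemma ennreal_le_of_power_scaling:
  fixes a b :: ennreal
  assumes "\<And>T::real. T > 1 \<Longrightarrow> a \<le> ennreal (T ^ 6) * b"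
  shows "a \<le> b"
proof (cases b)
  case (real r)
  have "((\<lambda>T::real. ennreal (T ^ 6 * r)) \<longlongrightarrow> ennreal (1 ^ 6 * r)) (at_right 1)"
    by (intro tendsto_intros)
  moreover have "\<forall>\<^sub>F T in at_right 1. a \<le> ennreal (T ^ 6 * r)"
    using assms real by (auto simp: ennreal_mult intro!: eventually_mono[OF eventually_at_right_less])
  ultimately have "a \<le> ennreal (1 ^ 6 * r)"
    by (rule tendsto_lowerbound) (simp add: trivial_limit_at_right_real)
  then show ?thesis using real by simp
qed simp

context gauged_body3
begin

text \<open>Countably many balls of the local comparison cover the regular boundary. The upper bound
  on Hausdorff measure follows by summing over disjoint pieces. The lower bound has to treat
  arbitrary covers, which must be finer than every ball in use; so it is shown for finite unions and
  passed to the limit. Finally \<open>T\<close> tends to 1.\<close>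

lemma hausdorff_eq_surf:
  assumes A: "A \<in> sets borel" "A \<subseteq> Rg \<inter> frontier K"
  shows "hausdorff_measure 2 A = emeasure surf A"
proof -
  have "hausdorff_measure 2 A \<le> ennreal (T ^ 6) * emeasure surf A \<and> emeasure surf A \<le> ennreal (T ^ 6) *
      hausdorff_measure 2 A"
    if T: "T > 1" for T
  proof -
    define S where "S = Rg \<inter> frontier K"
    have "\<exists>\<rho>. \<forall>x\<in>S. \<rho> x > 0 \<and> (\<forall>A. A \<in> sets borel \<longrightarrow> A \<subseteq> S \<inter> ball x (\<rho> x) \<longrightarrow>
       hausdorff_measure 2 A \<le> ennreal (T ^ 6) * emeasure surf A \<and>
       (\<forall>d\<ge>0. (\<forall>a\<in>A. \<forall>b\<in>A. dist a b \<le> d) \<longrightarrow> emeasure surf A \<le> ennreal (T ^ 6) * ennreal (unit_ball_vol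
           (real 2) / 2 ^ 2 * d ^ 2)))"
      unfolding S_def by (rule bchoice) (use local_area_comparison[OF _ _ T] frontier_iff_gauge in blast)
    then obtain \<rho> where \<rho>: "\<And>x. x \<in> S \<Longrightarrow> \<rho> x > 0"
      and upper: "\<And>x A. x \<in> S \<Longrightarrow> A \<in> sets borel \<Longrightarrow> A \<subseteq> S \<inter> ball x (\<rho> x) \<Longrightarrow> hausdorff_measure 2 A \<le> ennreal
          (T ^ 6) * emeasure surf A"
      and lower: "\<And>x A d. x \<in> S \<Longrightarrow> A \<in> sets borel \<Longrightarrow> A \<subseteq> S \<inter> ball x (\<rho> x) \<Longrightarrow> d \<ge> 0 \<Longrightarrow> (\<And>a b. a \<in> A \<Longrightarrow> b \<in> A \<Longrightarrow>
          dist a b \<le> d) \<Longrightarrow>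
          emeasure surf A \<le> ennreal (T ^ 6) * ennreal (unit_ball_vol (real 2) / 2 ^ 2 * d ^ 2)"
      by metis
    show ?thesis
    proof (cases "A = {}")
      case True
      have "hausdorff_measure 2 ({} :: (real^3) set) \<le> 0" by (rule hausdorff_least) (simp add: premeasure_empty)
      then show ?thesis using True by simp
    next
      case False
      have AS: "A \<subseteq> S" using A by (simp add: S_def)
      \<comment> \<open>Half the radius leaves room for a covering set that meets this ball to stay
        inside the full ball.\<close>
      define U where "U x = ball x (\<rho> x / 2)" for x
      obtain F where F: "F \<subseteq> U ` S" "countable F" "\<Union>F = \<Union>(U ` S)"
        by (rule Lindelof[of "U ` S"]) (auto simp: U_def)
      then obtain X where X: "X \<subseteq> S" "countable X" "F = U ` X"
        using countable_subset_image by metis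
      have cov: "S \<subseteq> (\<Union>x\<in>X. U x)"
      proof
        fix x assume "x \<in> S"
        then have "x \<in> U x" using \<rho>[of x] by (simp add: U_def)
        then have "x \<in> \<Union>(U ` S)" using \<open>x \<in> S\<close> by blast
        then show "x \<in> (\<Union>x\<in>X. U x)" using F(3) X(3) by simp
      qed
      have Xne: "X \<noteq> {}" using cov AS False by auto
      define c where "c = from_nat_into X"
      have c: "c n \<in> X" "c n \<in> S" for n using from_nat_into[OF Xne, of n] X(1) by (auto simp: c_def)
      have covn: "S \<subseteq> (\<Union>n. U (c n))"
        using cov range_from_nat_into[OF Xne X(2)] unfolding c_def by (metis image_image)
      define G where "G n = A \<inter> U (c n)" for n
      have G: "G n \<in> sets borel" for n using A(1) by (auto simp: G_def U_def)
      have UG: "(\<Union>n. G n) = A" using covn AS by (auto simp: G_def)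
      have "hausdorff_measure 2 A \<le> ennreal (T ^ 6) * emeasure surf A"
      proof -
        define H where "H = disjointed G"
        have H: "H n \<in> sets borel" for n
          unfolding H_def using sets.range_disjointed_sets[of G borel] G by blast
        have HG: "H n \<subseteq> G n" for n unfolding H_def by (rule disjointed_subset)
        have "hausdorff_measure 2 A = hausdorff_measure 2 (\<Union>n. H n)" by (simp add: H_def UN_disjointed_eq UG)
        also have "\<dots> \<le> (\<Sum>n. hausdorff_measure 2 (H n))" by (rule hausdorff_subadd)
        also have "\<dots> \<le> (\<Sum>n. ennreal (T ^ 6) * emeasure surf (H n))"
        proof (intro suminf_le)
          fix n
          have "U (c n) \<subseteq> ball (c n) (\<rho> (c n))" using \<rho>[OF c(2), of n] by (auto simp: U_def)
          then have "H n \<subseteq> S \<inter> ball (c n) (\<rho> (c n))" using HG[of n] AS by (auto simp: G_def)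
          then show "hausdorff_measure 2 (H n) \<le> ennreal (T ^ 6) * emeasure surf (H n)"
            by (rule upper[OF c(2) H])
        qed auto
        also have "\<dots> = ennreal (T ^ 6) * (\<Sum>n. emeasure surf (H n))" by (rule ennreal_suminf_cmult)
        also have "(\<Sum>n. emeasure surf (H n)) = emeasure surf (\<Union>n. H n)"
          using H by (intro suminf_emeasure) (auto simp: H_def disjoint_family_disjointed)
        also have "(\<Union>n. H n) = A" by (simp add: H_def UN_disjointed_eq UG)
        finally show ?thesis .
      qed
      moreover have "emeasure surf A \<le> ennreal (T ^ 6) * hausdorff_measure 2 A"
      proof -
        define W where "W n = (\<Union>i\<le>n. G i)" for n
        have W: "W n \<in> sets borel" for n unfolding W_def using G by (intro sets.finite_UN) auto
        have bound: "emeasure surf (W n) \<le> ennreal (T ^ 6) * hausdorff_measure 2 A" for n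
        proof -
          \<comment> \<open>Only finitely many balls are involved, so the minimum is
            positive.\<close>
          define \<delta> where "\<delta> = Min ((\<lambda>i. \<rho> (c i) / 2) ` {..n})"
          have \<delta>: "\<delta> > 0" using \<rho>[OF c(2)] by (auto simp: \<delta>_def)
          have \<delta>2: "\<delta> \<le> \<rho> (c i) / 2" if "i \<le> n" for i
            unfolding \<delta>_def using that by (intro Min_le) auto
          have "ennreal (1 / T ^ 6) * emeasure surf (W n) \<le> hausdorff_premeasure 2 \<delta> (W n)"
          proof (rule premeasure_greatest)
            fix Q :: "nat \<Rightarrow> (real^3) set" assume Q: "\<And>i. bounded (Q i)" "\<And>i. diameter (Q i) \<le> \<delta>" "W n \<subseteq> (\<Union>i. Q i)"
            \<comment> \<open>Covering sets are arbitrary; their closures are Borel and have the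
              same diameter.\<close>
            have piece: "emeasure surf (closure (Q i) \<inter> W n) \<le> ennreal (T ^ 6) * hterm 2 (Q i)" for i
            proof (cases "closure (Q i) \<inter> W n = {}")
              case False
              then obtain y j where y: "y \<in> closure (Q i)" "j \<le> n" "y \<in> G j" by (auto simp: W_def)
              have dd: "dist a b \<le> diameter (Q i)" if "a \<in> closure (Q i)" "b \<in> closure (Q i)" for a b
                using that Q(1)[of i] diameter_bounded_bound[of "closure (Q i)" a b] by (simp add:
                    bounded_closure diameter_closure)
              have "closure (Q i) \<subseteq> ball (c j) (\<rho> (c j))"
              proof
                fix a assume "a \<in> closure (Q i)"
                then have "dist y a \<le> \<rho> (c j) / 2" using dd[OF y(1)] Q(2)[of i] \<delta>2[OF y(2)] by force
                moreover have "dist (c j) y < \<rho> (c j) / 2" using y(3) by (simp add: G_def U_def)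
                ultimately show "a \<in> ball (c j) (\<rho> (c j))" using dist_triangle[of "c j" a y] by simp
              qed
              moreover have "W n \<subseteq> S" using AS by (auto simp: W_def G_def)
              ultimately have "emeasure surf (closure (Q i) \<inter> W n) \<le> ennreal (T ^ 6) * ennreal
                  (unit_ball_vol (real 2) / 2 ^ 2 * diameter (Q i) ^ 2)"
                using W dd by (intro lower[OF c(2)] sets.Int) (auto simp: diameter_ge_0[OF Q(1)])
              moreover have "Q i \<noteq> {}" using y(1) by auto
              ultimately show ?thesis by (simp add: hterm_def)
            qed simp
            have "emeasure surf (W n) = emeasure surf (\<Union>i. closure (Q i) \<inter> W n)"
              using Q(3) closure_subset by (intro arg_cong[where f="emeasure surf"]) blast
            also have "\<dots> \<le> (\<Sum>i. emeasure surf (closure (Q i) \<inter> W n))"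
              using W by (intro emeasure_subadditive_countably) auto
            also have "\<dots> \<le> (\<Sum>i. ennreal (T ^ 6) * hterm 2 (Q i))" by (intro suminf_le piece) auto
            also have "\<dots> = ennreal (T ^ 6) * (\<Sum>i. hterm 2 (Q i))" by (rule ennreal_suminf_cmult)
            finally have "ennreal (1 / T ^ 6) * emeasure surf (W n) \<le> ennreal (1 / T ^ 6) * (ennreal (T ^
                6) * (\<Sum>i. hterm 2 (Q i)))"
              by (rule mult_left_mono) simp
            also have "\<dots> = (\<Sum>i. hterm 2 (Q i))"
              using T by (simp add: mult.assoc[symmetric] ennreal_mult[symmetric])
            finally show "ennreal (1 / T ^ 6) * emeasure surf (W n) \<le> (\<Sum>i. hterm 2 (Q i))" .
          qed
          also have "\<dots> \<le> hausdorff_measure 2 (W n)" by (rule premeasure_le_hausdorff[OF \<delta>])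
          also have "\<dots> \<le> hausdorff_measure 2 A" by (rule hausdorff_mono) (auto simp: W_def G_def)
          finally have "ennreal (T ^ 6) * (ennreal (1 / T ^ 6) * emeasure surf (W n)) \<le> ennreal (T ^ 6) *
              hausdorff_measure 2 A"
            by (rule mult_left_mono) simp
          then show ?thesis using T by (simp add: mult.assoc[symmetric] ennreal_mult[symmetric])
        qed
        have "(SUP n. emeasure surf (W n)) = emeasure surf (\<Union>n. W n)"
          using W by (intro SUP_emeasure_incseq) (auto simp: incseq_def W_def intro: order_trans)
        also have "(\<Union>n. W n) = A" unfolding W_def UG[symmetric] by auto
        finally have "emeasure surf A = (SUP n. emeasure surf (W n))" by (rule sym)
        also have "\<dots> \<le> ennreal (T ^ 6) * hausdorff_measure 2 A" using bound by (rule SUP_least)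
        finally show ?thesis .
      qed
      ultimately show ?thesis by blast
    qed
  qed
  note cmp = this
  show ?thesis
  proof (rule antisym)
    show "hausdorff_measure 2 A \<le> emeasure surf A"
      by (rule ennreal_le_of_power_scaling) (rule cmp[THEN conjunct1])
    show "emeasure surf A \<le> hausdorff_measure 2 A"
      by (rule ennreal_le_of_power_scaling) (rule cmp[THEN conjunct2])
  qed
qed

end

section \<open>Support functions and the cone-volume measure\<close>

lemma support_fun_bdd:
  fixes K :: "(real^3) set"
  assumes "compact K" shows "bdd_above ((\<lambda>y. u \<bullet> y) ` K)"
  using assms by (intro bounded_imp_bdd_above compact_imp_bounded compact_continuous_image continuous_intros)

lemma support_fun_upper: "compact K \<Longrightarrow> y \<in> K \<Longrightarrow> u \<bullet> y \<le> support_fun K u"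
  unfolding support_fun_def by (rule cSUP_upper[OF _ support_fun_bdd])

lemma support_fun_least: "K \<noteq> {} \<Longrightarrow> (\<And>y. y \<in> K \<Longrightarrow> u \<bullet> y \<le> c) \<Longrightarrow> support_fun K u \<le> c"
  unfolding support_fun_def by (rule cSUP_least)

lemma support_fun_scale:
  assumes K: "compact K" "K \<noteq> {}" and c: "c > 0" shows "support_fun K (c *\<^sub>R u) = c * support_fun K u"
proof (rule antisym)
  show "support_fun K (c *\<^sub>R u) \<le> c * support_fun K u"
    using c support_fun_upper[OF K(1)] by (intro support_fun_least K) (simp add: mult_left_mono)
  have "support_fun K u \<le> support_fun K (c *\<^sub>R u) / c"
    using c support_fun_upper[OF K(1), of _ "c *\<^sub>R u"]
    by (intro support_fun_least K) (simp add: pos_le_divide_eq mult.commute)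
  then show "c * support_fun K u \<le> support_fun K (c *\<^sub>R u)"
    using c by (simp add: pos_le_divide_eq mult.commute)
qed

lemma support_fun_dilate:
  assumes L: "compact L" "L \<noteq> {}" and c: "c > 0" shows "support_fun ((*\<^sub>R) c ` L) u = c * support_fun L u"
proof -
  have "support_fun ((*\<^sub>R) c ` L) u = (SUP y\<in>L. (c *\<^sub>R u) \<bullet> y)"
    by (simp add: support_fun_def image_image)
  also have "\<dots> = c * support_fun L u" using support_fun_scale[OF L c, of u] by (simp add: support_fun_def)
  finally show ?thesis .
qed

lemma support_fun_continuous:
  assumes K: "compact K" "K \<noteq> {}" shows "continuous_on S (support_fun K)"
proof -
  obtain R where R: "R > 0" "\<And>z. z \<in> K \<Longrightarrow> norm z \<le> R"
    using compact_imp_bounded[OF K(1)] bounded_pos by metis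
  have le: "support_fun K u - support_fun K v \<le> R * norm (u - v)" for u v
  proof -
    have "support_fun K u \<le> support_fun K v + R * norm (u - v)"
    proof (rule support_fun_least[OF K(2)])
      fix y assume y: "y \<in> K"
      have "(u - v) \<bullet> y \<le> norm (u - v) * norm y" by (rule norm_cauchy_schwarz)
      also have "\<dots> \<le> norm (u - v) * R" using R(2)[OF y] by (intro mult_left_mono) auto
      finally show "u \<bullet> y \<le> support_fun K v + R * norm (u - v)"
        using support_fun_upper[OF K(1) y, of v] by (simp add: inner_diff_left mult.commute)
    qed
    then show ?thesis by simp
  qed
  have "\<bar>support_fun K u - support_fun K v\<bar> \<le> R * norm (u - v)" for u v
    using le[of u v] le[of v u] by (simp add: abs_le_iff norm_minus_commute)
  then have "R-lipschitz_on S (support_fun K)"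
    using R(1) by (intro lipschitz_onI) (simp_all add: dist_real_def dist_norm)
  then show ?thesis by (rule lipschitz_on_continuous_on)
qed

lemma support_fun_measurable:
  "compact K \<Longrightarrow> K \<noteq> {} \<Longrightarrow> support_fun K \<in> borel_measurable borel"
  by (rule borel_measurable_continuous_onI[OF support_fun_continuous])

lemma support_fun_ge_norm:
  assumes "compact L" "0 \<in> interior L"
  obtains r where "r > 0" "\<And>u. r * norm u \<le> support_fun L u"
proof -
  obtain r where r: "r > 0" "cball 0 r \<subseteq> L" using assms(2) by (auto simp: mem_interior_cball)
  have "r * norm u \<le> support_fun L u" for u
  proof -
    have "r *\<^sub>R sgn u \<in> L" using r by (auto simp: norm_sgn intro!: subsetD[OF r(2)])
    then have "u \<bullet> (r *\<^sub>R sgn u) \<le> support_fun L u" by (rule support_fun_upper[OF assms(1)])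
    moreover have "u \<bullet> sgn u = norm u"
      by (cases "u = 0") (auto simp: sgn_div_norm power2_norm_eq_inner[symmetric] power2_eq_square)
    ultimately show ?thesis by simp
  qed
  then show ?thesis using that r(1) by blast
qed

section \<open>Unit normals and the measures on the sphere\<close>

context gauged_body3
begin

lemma rad_frontier: "y \<noteq> 0 \<Longrightarrow> rad y \<in> frontier K"
  using gauge_pos[of y] gauge_scale[of "1 / g y" y] by (simp add: frontier_iff_gauge rad_def)

lemma rad_regular: "y \<in> Rg \<Longrightarrow> rad y \<in> Rg" "y \<in> Rg \<Longrightarrow> gr (rad y) = gr y"
  unfolding rad_def using gauge_pos[OF regular_nonzero, of y] by (auto simp: regular_scale grad_scale)

text \<open>Because \<open>K\<close> contains a ball about the origin, a unit normal
  \<open>u\<close> at \<open>x\<close> satisfies \<open>u \<bullet> x > 0\<close>, and dividing by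
  this number gives a subgradient. Conversely, a subgradient is normalized.\<close>

lemma outer_unit_normal_iff:
  assumes x: "g x = 1"
  shows "outer_unit_normal K x u \<longleftrightarrow> (\<exists>p\<in>N x. u = sgn p)"
proof
  assume u: "outer_unit_normal K x u"
  obtain r where r: "r > 0" "cball 0 r \<subseteq> K" using zero by (auto simp: mem_interior_cball)
  have "r *\<^sub>R u \<in> K" using u r by (auto simp: outer_unit_normal_def intro!: subsetD[OF r(2)])
  then have "u \<bullet> (r *\<^sub>R u) \<le> u \<bullet> x" using u unfolding outer_unit_normal_def by blast
  moreover have "u \<bullet> u = 1" using u by (simp add: outer_unit_normal_def norm_eq_1)
  ultimately have h: "u \<bullet> x > 0" using r(1) by simp
  define p where "p = (1 / (u \<bullet> x)) *\<^sub>R u"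
  have "p \<in> P" using u h by (simp add: p_def polar_set_def outer_unit_normal_def divide_le_eq)
  moreover have "p \<bullet> x = 1" using h by (simp add: p_def)
  moreover have "sgn p = u" using h u by (simp add: p_def sgn_scaleR outer_unit_normal_def sgn_div_norm[of u])
  ultimately show "\<exists>p\<in>N x. u = sgn p" using x by (auto simp: subgrads_def)
next
  assume "\<exists>p\<in>N x. u = sgn p"
  then obtain p where p: "p \<in> N x" "u = sgn p" by blast
  have px: "p \<bullet> x = 1" using subgradsD(2)[OF p(1)] x by simp
  then have p0: "p \<noteq> 0" by auto
  have "p \<bullet> y \<le> p \<bullet> x" if "y \<in> K" for y
    using subgradsD(1)[OF p(1)] that px by (simp add: polar_set_def)
  then have "sgn p \<bullet> y \<le> sgn p \<bullet> x" if "y \<in> K" for y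
    using that by (simp add: sgn_div_norm mult_left_mono)
  then show "outer_unit_normal K x u" using p0 by (simp add: p(2) outer_unit_normal_def norm_sgn)
qed

text \<open>The condition \<open>p \<bullet> x = 1\<close> fixes the length once the direction is
  known; so unique subgradient and unique normal mean the same.\<close>

lemma subgrads_eq_of_sgn_eq:
  assumes "g x = 1" "p \<in> N x" "q \<in> N x" "sgn p = sgn q" shows "p = q"
proof -
  have 1: "p \<bullet> x = 1" "q \<bullet> x = 1" using subgradsD(2) assms by auto
  have "v = norm v *\<^sub>R sgn v" for v :: "real^3" by (cases "v = 0") (auto simp: sgn_div_norm)
  then have n: "p = norm p *\<^sub>R sgn p" "q = norm q *\<^sub>R sgn p" using assms(4) by metis+
  then have "norm p * (sgn p \<bullet> x) = 1" "norm q * (sgn p \<bullet> x) = 1" using 1 by (metis inner_scaleR_left)+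
  then have "norm p = norm q" by (metis mult_cancel_right mult_zero_right zero_neq_one)
  then show ?thesis using n by metis
qed

lemma regular_boundary_eq: "regular_boundary K = Rg \<inter> frontier K"
proof (intro equalityI subsetI)
  fix x assume x: "x \<in> regular_boundary K"
  then have f: "x \<in> frontier K" "g x = 1" by (auto simp: regular_boundary_def frontier_iff_gauge)
  obtain u where u: "\<And>v. outer_unit_normal K x v \<Longrightarrow> v = u" using x unfolding regular_boundary_def by blast
  obtain p where p: "p \<in> N x" using subgrads_nonempty by blast
  have "q = p" if q: "q \<in> N x" for q
  proof (rule subgrads_eq_of_sgn_eq[OF f(2) q p])
    show "sgn q = sgn p" using u p q outer_unit_normal_iff[OF f(2)] by metis
  qed
  then have "N x = {p}" using p by blast
  moreover have "x \<noteq> 0" using f(2) by auto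
  ultimately show "x \<in> Rg \<inter> frontier K" using f by (auto simp: regular_points_def)
next
  fix x assume x: "x \<in> Rg \<inter> frontier K"
  then have "g x = 1" by (simp add: frontier_iff_gauge)
  then have "outer_unit_normal K x v \<longleftrightarrow> v = sgn (gr x)" for v
    using outer_unit_normal_iff grad_subgrads x by auto
  then show "x \<in> regular_boundary K" using x by (auto simp: regular_boundary_def)
qed

lemma gauss_map_eq:
  assumes "x \<in> Rg" "g x = 1" shows "gauss_map K x = sgn (gr x)"
proof -
  have "outer_unit_normal K x v \<longleftrightarrow> v = sgn (gr x)" for v
    using outer_unit_normal_iff[OF assms(2)] grad_subgrads[OF assms(1)] by auto
  then show ?thesis by (simp add: gauss_map_def)
qed

text \<open>
  The value outside the regular points is irrelevant; it only keeps \<open>nu\<close> in the sphere.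
\<close>
definition "nu y = (if y \<in> Rg then sgn (gr y) else axis 1 1)"

lemma nu_norm: "norm (nu y) = 1"
  by (simp add: nu_def norm_sgn grad_nonzero)

lemma sgn_measurable: "(sgn :: real^3 \<Rightarrow> real^3) \<in> borel_measurable borel"
  unfolding sgn_div_norm by measurable

lemma nu_measurable: "nu \<in> borel_measurable borel"
  unfolding nu_def using measurable_compose[OF grad_measurable sgn_measurable] by measurable

lemma nu_measurable_sphere: "nu \<in> borel \<rightarrow>\<^sub>M restrict_space borel (sphere 0 1)"
  using nu_measurable by (intro measurable_restrict_space2) (auto simp: nu_norm)

text \<open>The support function is 1 at \<open>gr y\<close>: membership in the polar set gives one
  bound, the radial projection of \<open>y\<close> attains it. Homogeneity does the rest.\<close>

lemma support_fun_normal: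
  assumes y: "y \<in> Rg" shows "support_fun K (nu y) = 1 / norm (gr y)"
proof -
  have "support_fun K (gr y) = 1"
  proof (rule antisym)
    show "support_fun K (gr y) \<le> 1" using zero_mem grad_mem(1)[OF y] by (intro support_fun_least) (auto
        simp: polar_set_def)
    have gp: "g y > 0" by (rule gauge_pos[OF regular_nonzero[OF y]])
    have "rad y \<in> K" using rad_frontier[OF regular_nonzero[OF y]] mem_iff_gauge[of "rad y"] by (simp add:
        frontier_iff_gauge)
    moreover have "gr y \<bullet> rad y = 1" using grad_mem(2)[OF y] gp by (simp add: rad_def)
    ultimately show "1 \<le> support_fun K (gr y)" using support_fun_upper[OF K(1), of "rad y" "gr y"] by simp
  qed
  then show ?thesis
    using support_fun_scale[of K "inverse (norm (gr y))" "gr y"] K(1) zero_mem grad_nonzero[OF y] y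
    by (auto simp: nu_def sgn_div_norm inverse_eq_divide)
qed

text \<open>The right-hand side is a measure by construction. Agreement with the Hausdorff set
  function on every Borel set of the sphere therefore shows that \<open>measure_of\<close> does not
  collapse to the zero measure.\<close>

lemma surface_area_measure_eq:
  "surface_area_measure K = distr (density lborel (\<lambda>y. indicator K y * ennreal (3 * norm (gr y))))
      (restrict_space borel (sphere 0 1)) nu"
  (is "_ = ?D")
proof -
  let ?R = "restrict_space borel (sphere 0 1) :: (real^3) measure"
  have m [measurable]: "nu \<in> density lborel (\<lambda>y. indicator K y * ennreal (3 * norm (gr y))) \<rightarrow>\<^sub>M ?R"
    using nu_measurable_sphere by simp
  have eq: "hausdorff_measure 2 {x \<in> regular_boundary K. gauss_map K x \<in> \<omega>} = emeasure ?D \<omega>" if w: "\<omega> \<in> sets ?R" for \<omega>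
  proof -
    define A where "A = Rg \<inter> frontier K \<inter> nu -` \<omega>"
    have nw: "nu -` \<omega> \<in> sets borel" using measurable_sets[OF nu_measurable_sphere w] by simp
    have A: "A \<in> sets borel" unfolding A_def using nw regular_borel by (intro sets.Int) auto
    have sub: "A \<subseteq> Rg \<inter> frontier K" by (auto simp: A_def)
    have "{x \<in> regular_boundary K. gauss_map K x \<in> \<omega>} = A"
      unfolding regular_boundary_eq A_def using gauss_map_eq by (auto simp: frontier_iff_gauge nu_def)
    then have "hausdorff_measure 2 {x \<in> regular_boundary K. gauss_map K x \<in> \<omega>} = emeasure surf A"
      using hausdorff_eq_surf[OF A sub] by (simp only:)
    also have "\<dots> = (\<integral>\<^sup>+y. (indicator K y * ennreal (3 * norm (gr y))) * indicator (nu -` \<omega>) y \<partial>lborel)"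
      unfolding emeasure_surf[OF A]
    proof (intro nn_integral_cong)
      fix y
      show "ennreal (3 * norm (gr y)) * indicator {y \<in> K. rad y \<in> A} y = (indicator K y * ennreal (3 *
          norm (gr y))) * indicator (nu -` \<omega>) y"
      \<comment> \<open>Off the regular points both sides vanish through the default value 0 of
        \<open>gauge_grad\<close>.\<close>
      proof (cases "y \<in> Rg")
        case True
        then have "rad y \<in> A \<longleftrightarrow> nu y \<in> \<omega>"
          using rad_frontier[OF regular_nonzero[OF True]] rad_regular[OF True] by (simp add: A_def nu_def)
        then show ?thesis by (auto simp: indicator_def)
      qed (simp add: gauge_grad_def)
    qed
    also have "\<dots> = emeasure ?D \<omega>"
      using w nw by (simp add: emeasure_distr emeasure_density)
    finally show ?thesis .
  qed
  have "surface_area_measure K = measure_of (space ?R) (sets ?R) (\<lambda>\<omega>. hausdorff_measure 2 {x \<in>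
      regular_boundary K. gauss_map K x \<in> \<omega>})"
    by (simp add: surface_area_measure_def space_restrict_space)
  also have "\<dots> = measure_of (space ?R) (sets ?R) (emeasure ?D)"
  proof (intro measure_of_eq sets.space_closed)
    fix \<omega> assume "\<omega> \<in> sigma_sets (space ?R) (sets ?R)"
    then have "\<omega> \<in> sets ?R" by (simp only: sets.sigma_sets_eq)
    then show "hausdorff_measure 2 {x \<in> regular_boundary K. gauss_map K x \<in> \<omega>} = emeasure ?D \<omega>" by (rule eq)
  qed
  also have "\<dots> = ?D" using measure_of_of_measure[of ?D] by simp
  finally show ?thesis .
qed

text \<open>The density \<open>3 * norm (gr y)\<close> of surface area cancels against a third of
  the support function, which is \<open>1 / (3 * norm (gr y))\<close> at the normal.\<close>

lemma cone_volume_measure_eq: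
  "cone_volume_measure K = distr (density lborel (\<lambda>y. ennreal (indicator (K \<inter> Rg) y))) (restrict_space
      borel (sphere 0 1)) nu"
proof -
  let ?R = "restrict_space borel (sphere 0 1) :: (real^3) measure"
  have sm: "support_fun K \<in> borel_measurable borel" using K(1) zero_mem by (intro support_fun_measurable) auto
  then have [measurable]: "support_fun K \<in> borel_measurable ?R" by (rule measurable_restrict_space1)
  have [measurable]: "nu \<in> borel \<rightarrow>\<^sub>M ?R" by (rule nu_measurable_sphere)
  have m: "nu \<in> density lborel (\<lambda>y. indicator K y * ennreal (3 * norm (gr y))) \<rightarrow>\<^sub>M ?R" by simp
  have hm [measurable]: "(\<lambda>y. support_fun K (nu y)) \<in> borel_measurable borel"
    using nu_measurable sm by (rule measurable_compose)
  have "cone_volume_measure K = distr (density (density lborel (\<lambda>y. indicator K y * ennreal (3 * norm (gr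
      y)))) (\<lambda>y. ennreal (support_fun K (nu y) / 3))) ?R nu"
    unfolding cone_volume_measure_def surface_area_measure_eq
    by (rule density_distr[OF _ m]) measurable
  also have "density (density lborel (\<lambda>y. indicator K y * ennreal (3 * norm (gr y)))) (\<lambda>y. ennreal
      (support_fun K (nu y) / 3))
     = density lborel (\<lambda>y. (indicator K y * ennreal (3 * norm (gr y))) * ennreal (support_fun K (nu y) / 3))"
    by (rule density_density_eq) measurable
  also have "(\<lambda>y. (indicator K y * ennreal (3 * norm (gr y))) * ennreal (support_fun K (nu y) / 3)) =
      (\<lambda>y. ennreal (indicator (K \<inter> Rg) y))"
  proof
    fix y
    show "(indicator K y * ennreal (3 * norm (gr y))) * ennreal (support_fun K (nu y) / 3) = ennreal
        (indicator (K \<inter> Rg) y)"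
    proof (cases "y \<in> Rg")
      case True
      have "ennreal (3 * norm (gr y)) * ennreal (1 / norm (gr y) / 3) = ennreal (3 * norm (gr y) * (1 /
          norm (gr y) / 3))"
        by (intro ennreal_mult[symmetric]) auto
      also have "3 * norm (gr y) * (1 / norm (gr y) / 3) = 1" using grad_nonzero[OF True] by simp
      finally show ?thesis using True unfolding support_fun_normal[OF True] by (auto simp: indicator_def mult.assoc)
    qed (simp add: gauge_grad_def)
  qed
  finally show ?thesis .
qed

lemma cone_volume_integral:
  fixes F :: "real^3 \<Rightarrow> real"
  assumes F: "F \<in> borel_measurable borel"
  shows "(\<integral>u. F u \<partial>cone_volume_measure K) = (\<integral>y. indicator (K \<inter> Rg) y * F (nu y) \<partial>lborel)"
proof -
  let ?R = "restrict_space borel (sphere 0 1) :: (real^3) measure"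
  have FR: "F \<in> borel_measurable ?R" using F by (rule measurable_restrict_space1)
  have m: "nu \<in> density lborel (\<lambda>y. ennreal (indicator (K \<inter> Rg) y)) \<rightarrow>\<^sub>M ?R" using nu_measurable_sphere by simp
  have Fn: "(\<lambda>y. F (nu y)) \<in> borel_measurable lborel" using measurable_compose[OF nu_measurable F] by simp
  have i: "(indicator (K \<inter> Rg) :: real^3 \<Rightarrow> real) \<in> borel_measurable lborel"
    by (intro borel_measurable_indicator sets.Int) (auto simp: regular_borel)
  show ?thesis unfolding cone_volume_measure_eq integral_distr[OF m FR]
    by (subst integral_density[OF Fn i]) (auto simp: indicator_def)
qed

lemma measure_K_regular: "(\<integral>y. indicator (K \<inter> Rg) y \<partial>lborel) = vol K"
proof -
  have "(\<integral>y. indicator (K \<inter> Rg) y \<partial>lborel) = (\<integral>y. (indicator K y :: real) \<partial>lborel)"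
    using AE_regular regular_borel by (intro integral_cong_AE) (auto simp: indicator_def elim: eventually_mono)
  also have "\<dots> = vol K" by (simp add: vol_def)
  finally show ?thesis .
qed

lemma integrable_bounded_on_K:
  fixes F :: "real^3 \<Rightarrow> real"
  assumes F: "F \<in> borel_measurable borel" and B: "\<And>y. y \<in> K \<inter> Rg \<Longrightarrow> \<bar>F y\<bar> \<le> B"
  shows "integrable lborel (\<lambda>y. indicator (K \<inter> Rg) y * F y)"
proof (rule Bochner_Integration.integrable_bound)
  have "emeasure lborel (K \<inter> Rg) < \<infinity>"
    using K(1) by (intro emeasure_bounded_finite) (auto intro: bounded_subset[OF compact_imp_bounded])
  then show "integrable lborel (\<lambda>y. B * indicator (K \<inter> Rg) y)"
    by (intro integrable_mult_right integrable_real_indicator) (auto simp: regular_borel)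
  show "(\<lambda>y. indicator (K \<inter> Rg) y * F y) \<in> borel_measurable lborel"
    using F regular_borel by measurable
  show "AE y in lborel. norm (indicator (K \<inter> Rg) y * F y) \<le> norm (B * indicator (K \<inter> Rg) y)"
    using B by (auto simp: indicator_def intro: order_trans[OF _ abs_ge_self])
qed

end

section \<open>Two lemmas on real functions: comparison of coefficients, a chord of the
  logarithm\<close>

lemma linear_coeff_le:
  fixes b0 :: real
  assumes "\<And>t. t > 0 \<Longrightarrow> b0 + b1 * t + b2 * t\<^sup>2 + b3 * t ^ 3 \<le> b0 + d1 * t + d2 * t\<^sup>2 + d3 * t ^ 3"
  shows "b1 \<le> d1"
proof -
  \<comment> \<open>Cancelling \<open>b0\<close> and dividing by \<open>t\<close> leaves the linear
    coefficients as the limits at 0 from the right.\<close>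
  have "b1 + b2 * t + b3 * t\<^sup>2 \<le> d1 + d2 * t + d3 * t\<^sup>2" if t: "t > 0" for t
  proof -
    have "(b1 + b2 * t + b3 * t\<^sup>2) * t \<le> (d1 + d2 * t + d3 * t\<^sup>2) * t"
      using assms[OF t] by (simp add: algebra_simps power2_eq_square power3_eq_cube)
    then show ?thesis using t by simp
  qed
  then have ev: "\<forall>\<^sub>F t in at_right 0. b1 + b2 * t + b3 * t\<^sup>2 \<le> d1 + d2 * t + d3 * t\<^sup>2"
    by (auto intro: eventually_mono[OF eventually_at_right_less])
  have "((\<lambda>t. b1 + b2 * t + b3 * t\<^sup>2) \<longlongrightarrow> b1 + b2 * 0 + b3 * 0\<^sup>2) (at_right 0)" "((\<lambda>t. d1 + d2 * t + d3 *
      t\<^sup>2) \<longlongrightarrow> d1 + d2 * 0 + d3 * 0\<^sup>2) (at_right 0)"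
    by (intro tendsto_intros)+
  from tendsto_le[OF trivial_limit_at_right_real this(2,1) ev] show ?thesis by simp
qed

text \<open>The chord is passed on as an affine function, ready to be integrated. Its slope is
  nonnegative since \<open>ln\<close> increases. At \<open>b / a\<close>, the midpoint of the roots,
  it equals the mean of \<open>ln\<close> over the roots, whose product is
  \<open>c / a\<close>.\<close>

lemma ln_chord:
  fixes a b c :: real
  assumes a: "a > 0" and c: "c > 0"
  obtains \<alpha> \<beta> where "\<beta> \<ge> 0" "\<alpha> + \<beta> * (b / a) = ln (c / a) / 2"
    "\<And>x. x > 0 \<Longrightarrow> a * x\<^sup>2 - 2 * b * x + c \<le> 0 \<Longrightarrow> \<alpha> + \<beta> * x \<le> ln x"
proof -
  \<comment> \<open>A quarter of the discriminant; completing the square turns the quadratic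
    condition into \<open>(a * x - b)\<^sup>2 \<le> D\<close>.\<close>
  define D where "D = b\<^sup>2 - a * c"
  have sq: "(a * x - b)\<^sup>2 \<le> D" if "a * x\<^sup>2 - 2 * b * x + c \<le> 0" for x
  proof -
    have "a * (a * x\<^sup>2 - 2 * b * x + c) \<le> 0" using that a by (simp add: mult_le_0_iff)
    then show ?thesis by (simp add: D_def power2_eq_square algebra_simps)
  qed
  have bpos: "b > 0" if "x > 0" "a * x\<^sup>2 - 2 * b * x + c \<le> 0" for x
  proof -
    have "a * x\<^sup>2 > 0" using that a by simp
    then have "b * x > 0" using that c by linarith
    then show ?thesis using that(1) by (simp add: zero_less_mult_iff)
  qed
  \<comment> \<open>Without a positive solution the condition on \<open>x\<close> is vacuous, and a
    double root admits a single \<open>x\<close>. In both cases the constant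
    \<open>ln (c / a) / 2\<close> serves.\<close>
  consider "b \<le> 0 \<or> D < 0" | "b > 0" "D = 0" | "b > 0" "D > 0" by linarith
  then show ?thesis
  proof cases
    case 1
    have "False" if "x > 0" "a * x\<^sup>2 - 2 * b * x + c \<le> 0" for x
      using 1 bpos[OF that] sq[OF that(2)] zero_le_power2[of "a * x - b"] by linarith
    then show ?thesis by (intro that[of 0 "ln (c / a) / 2"]) auto
  next
    case 2
    have "ln (c / a) / 2 + 0 * x \<le> ln x" if x: "x > 0" "a * x\<^sup>2 - 2 * b * x + c \<le> 0" for x
    proof -
      have "(a * x - b)\<^sup>2 \<le> 0" using sq[OF x(2)] 2 by simp
      then have "a * x = b" by simp
      then have "a * c = (a * x) * (a * x)" using 2 by (simp add: D_def power2_eq_square)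
      then have "c = a * (x * x)" using a by simp
      then have "c / a = x ^ 2" using a by (simp add: power2_eq_square)
      then show ?thesis using x(1) by (simp add: ln_realpow)
    qed
    then show ?thesis by (intro that[of 0 "ln (c / a) / 2"]) auto
  next
    case 3
    define d where "d = sqrt D"
    have d: "d > 0" "d\<^sup>2 = D" using 3 by (auto simp: d_def)
    have db: "d < b"
    proof (rule power2_less_imp_less)
      show "d\<^sup>2 < b\<^sup>2" using d(2) a c by (simp add: D_def)
    qed (use 3 in simp)
    define l u where "l = (b - d) / a" and "u = (b + d) / a"
    have lu: "0 < l" "l < u" using db d a 3 by (auto simp: l_def u_def divide_strict_right_mono)
    have prod: "l * u = c / a"
    proof -
      have "(b - d) * (b + d) = a * c" using d(2) by (simp add: D_def power2_eq_square algebra_simps)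
      then show ?thesis using a by (simp add: l_def u_def field_simps)
    qed
    define \<beta> where "\<beta> = (ln u - ln l) / (u - l)"
    define \<alpha> where "\<alpha> = ln l - \<beta> * l"
    show ?thesis
    proof (rule that[of \<beta> \<alpha>])
      show "\<beta> \<ge> 0" using lu by (simp add: \<beta>_def)
      have mid: "b / a - l = (u - l) / 2" using a by (simp add: l_def u_def field_simps)
      have "\<alpha> + \<beta> * (b / a) = ln l + \<beta> * (b / a - l)" by (simp add: \<alpha>_def algebra_simps)
      also have "\<dots> = ln l + (ln u - ln l) / 2" unfolding mid using lu by (simp add: \<beta>_def)
      also have "\<dots> = ln (l * u) / 2" using lu by (simp add: ln_mult field_simps)
      finally show "\<alpha> + \<beta> * (b / a) = ln (c / a) / 2" by (simp add: prod)
      fix x assume x: "x > 0" "a * x\<^sup>2 - 2 * b * x + c \<le> 0"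
      have "\<bar>a * x - b\<bar> \<le> d" 
        using sq[OF x(2)] d abs_le_square_iff[of "a * x - b" d] by simp
      then have xl: "l \<le> x" "x \<le> u" using a by (auto simp: l_def u_def field_simps abs_le_iff)
      define t where "t = (x - l) / (u - l)"
      have t: "0 \<le> t" "t \<le> 1" using xl lu by (auto simp: t_def divide_le_eq)
      have xt: "x = (1 - t) *\<^sub>R l + t *\<^sub>R u"
      proof -
        have "t * (u - l) = x - l" using lu by (simp add: t_def)
        then show ?thesis by (simp add: algebra_simps)
      qed
      have "(1 - t) * ln l + t * ln u \<le> ln ((1 - t) *\<^sub>R l + t *\<^sub>R u)"
        using ln_concave lu t by (intro concave_onD) auto
      moreover have "\<alpha> + \<beta> * x = (1 - t) * ln l + t * ln u"
        using lu by (simp add: \<alpha>_def \<beta>_def t_def field_simps)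
      ultimately show "\<alpha> + \<beta> * x \<le> ln x" using xt by simp
    qed
  qed
qed

section \<open>The log-Minkowski inequality\<close>

locale body_pair = gauged_body3 K for K :: "(real^3) set" +
  fixes L :: "(real^3) set"
  assumes L: "compact L" "convex L" and zeroL: "0 \<in> interior L"
begin

lemma L_ne: "L \<noteq> {}" using zeroL by auto
lemma K_ne: "K \<noteq> {}" using zero_mem by auto

lemma bodies: "convex_body K" "convex_body L"
  using K zero L zeroL by (auto simp: convex_body_def)

text \<open>At regular points this is the ratio of the support functions of \<open>L\<close> and
  \<open>K\<close> at the normal: by homogeneity the gradient may replace the unit normal, and the
  support function of \<open>K\<close> is 1 at the gradient.\<close>

definition "\<xi> y = support_fun L (gr y)"

lemma xi_measurable: "\<xi> \<in> borel_measurable borel"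
  unfolding \<xi>_def by (rule measurable_compose[OF grad_measurable support_fun_measurable[OF L(1) L_ne]])

text \<open>Two-sided positive bounds make \<open>\<xi>\<close> and its logarithm integrable over
  \<open>K\<close>. They come from balls inside and around the bodies, since
  \<open>norm (gr y)\<close> is at least \<open>1 / R\<close> and at most \<open>M\<close>.\<close>

lemma xi_bounds:
  obtains l u where "0 < l" "0 < u" "\<And>y. y \<in> Rg \<Longrightarrow> l \<le> \<xi> y" "\<And>y. y \<in> Rg \<Longrightarrow> \<xi> y \<le> u"
proof -
  obtain r where r: "r > 0" "\<And>u. r * norm u \<le> support_fun L u" using support_fun_ge_norm[OF L(1) zeroL] by metis
  obtain R where R: "R > 0" "\<And>z. z \<in> K \<Longrightarrow> norm z \<le> R" using compact_imp_bounded[OF K(1)] bounded_pos by metis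
  obtain S where S: "S > 0" "\<And>z. z \<in> L \<Longrightarrow> norm z \<le> S" using compact_imp_bounded[OF L(1)] bounded_pos by metis
  have 1: "r / R \<le> \<xi> y" if y: "y \<in> Rg" for y
  proof -
    have gp: "g y > 0" by (rule gauge_pos[OF regular_nonzero[OF y]])
    have "rad y \<in> K" using rad_frontier[OF regular_nonzero[OF y]] closed_K frontier_subset_eq by blast
    have "1 = gr y \<bullet> rad y" using grad_mem(2)[OF y] gp by (simp add: rad_def)
    also have "\<dots> \<le> norm (gr y) * norm (rad y)" by (rule norm_cauchy_schwarz)
    also have "\<dots> \<le> norm (gr y) * R" using R(2)[OF \<open>rad y \<in> K\<close>] by (intro mult_left_mono) auto
    finally have "1 / R \<le> norm (gr y)" using R(1) by (simp add: pos_divide_le_eq)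
    then have "r * (1 / R) \<le> r * norm (gr y)" using r(1) by (intro mult_left_mono) auto
    then show ?thesis using r(2)[of "gr y"] by (simp add: \<xi>_def)
  qed
  have 2: "\<xi> y \<le> M * S" for y
    unfolding \<xi>_def
  proof (rule support_fun_least[OF L_ne])
    fix z assume z: "z \<in> L"
    have "gr y \<bullet> z \<le> norm (gr y) * norm z" by (rule norm_cauchy_schwarz)
    also have "\<dots> \<le> M * S" using grad_norm_le S(2)[OF z] M(1) by (intro mult_mono) auto
    finally show "gr y \<bullet> z \<le> M * S" .
  qed
  show ?thesis using that[of "r / R" "M * S"] 1 2 r(1) R(1) S(1) M(1) by simp
qed

lemma xi_ratio:
  assumes y: "y \<in> Rg" shows "support_fun L (nu y) / support_fun K (nu y) = \<xi> y"
proof -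
  have n: "norm (gr y) > 0" using grad_nonzero[OF y] by simp
  have "support_fun L (nu y) = inverse (norm (gr y)) * \<xi> y"
    using y n support_fun_scale[OF L(1) L_ne, of "inverse (norm (gr y))" "gr y"] by (simp add: nu_def
        sgn_div_norm \<xi>_def)
  then show ?thesis using n by (simp add: support_fun_normal[OF y])
qed

lemma xi_integrable: "integrable lborel (\<lambda>y. indicator (K \<inter> Rg) y * \<xi> y)"
proof -
  obtain l u where lu: "0 < l" "0 < u" "\<And>y. y \<in> Rg \<Longrightarrow> l \<le> \<xi> y" "\<And>y. y \<in> Rg \<Longrightarrow> \<xi> y \<le> u" using xi_bounds by metis
  show ?thesis
  proof (rule integrable_bounded_on_K[OF xi_measurable])
    fix y assume "y \<in> K \<inter> Rg"
    then show "\<bar>\<xi> y\<bar> \<le> u" using lu(1) lu(3)[of y] lu(4)[of y] by auto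
  qed
qed

section \<open>The volume of \<open>K + t L\<close> and the first quermassintegral\<close>

lemma gauge_sum_le:
  assumes y: "y \<in> Rg" and t: "t \<ge> 0" and m: "y \<in> {a + t *\<^sub>R b | a b. a \<in> K \<and> b \<in> L}"
  shows "g y \<le> 1 + t * \<xi> y"
proof -
  obtain a b where ab: "y = a + t *\<^sub>R b" "a \<in> K" "b \<in> L" using m by blast
  have "q \<bullet> y = q \<bullet> a + t * (q \<bullet> b)" for q unfolding ab(1) by (simp add: inner_add_right)
  then have "g y = gr y \<bullet> a + t * (gr y \<bullet> b)" using grad_mem(2)[OF y] by metis
  also have "\<dots> \<le> 1 + t * \<xi> y"
    using grad_mem(1)[OF y] ab t support_fun_upper[OF L(1) ab(3), of "gr y"]
    by (intro add_mono mult_left_mono) (auto simp: polar_set_def \<xi>_def)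
  finally show ?thesis .
qed

lemma xi_scale: "c > 0 \<Longrightarrow> \<xi> (c *\<^sub>R y) = \<xi> y"
  by (simp add: \<xi>_def grad_scale)

lemma sum_measurable: "{a + t *\<^sub>R b | a b. a \<in> K \<and> b \<in> L} \<in> sets borel"
proof -
  have "{a + t *\<^sub>R b | a b. a \<in> K \<and> b \<in> L} = {a + b | a b. a \<in> K \<and> b \<in> (*\<^sub>R) t ` L}" by blast
  moreover have "compact {a + b | a b. a \<in> K \<and> b \<in> (*\<^sub>R) t ` L}"
    using K(1) L(1) by (intro compact_sums compact_scaling)
  ultimately show ?thesis by (simp add: borel_compact)
qed

text \<open>
  The level sets of \<open>\<xi>\<close> are cones, and by \<open>gauge_sum_le\<close> the part of \<open>K + t L\<close> in such a cone
  is contained in a dilate of \<open>K\<close>.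
\<close>
lemma vol_slice_le:
  fixes \<eta> :: real
  assumes \<eta>: "\<eta> > 0" and t: "t > 0"
  defines "S \<equiv> \<lambda>j::nat. {y \<in> Rg. real j * \<eta> \<le> \<xi> y \<and> \<xi> y < (real j + 1) * \<eta>}"
  shows "measure lborel ({a + t *\<^sub>R b | a b. a \<in> K \<and> b \<in> L} \<inter> S j) \<le> (1 + t * ((real j + 1) * \<eta>)) ^ 3 *
      measure lborel (K \<inter> S j)"
    "S j \<in> sets borel"
proof -
  have "S j = Rg \<inter> {y. real j * \<eta> \<le> \<xi> y \<and> \<xi> y < (real j + 1) * \<eta>}" by (auto simp: S_def)
  also have "\<dots> \<in> sets borel" using xi_measurable regular_borel by measurable
  finally show S: "S j \<in> sets borel" .
  \<comment> \<open>The bound of \<open>gauge_sum_le\<close> at the upper end of the slice.\<close>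
  define r where "r = 1 + t * ((real j + 1) * \<eta>)"
  have r: "r > 0" using \<eta> t by (simp add: r_def add_pos_nonneg)
  have KS: "K \<inter> S j \<in> sets borel" using S K_borel by (intro sets.Int)
  have b: "bounded (K \<inter> S j)" using compact_imp_bounded[OF K(1)] by (rule bounded_subset) auto
  have lm: "K \<inter> S j \<in> lmeasurable" using KS emeasure_bounded_finite[OF b] by (intro fmeasurableI) auto
  have sub: "{a + t *\<^sub>R b | a b. a \<in> K \<and> b \<in> L} \<inter> S j \<subseteq> (*\<^sub>R) r ` (K \<inter> S j)"
  proof
    fix y assume y: "y \<in> {a + t *\<^sub>R b | a b. a \<in> K \<and> b \<in> L} \<inter> S j"
    then have yR: "y \<in> Rg" and yx: "\<xi> y < (real j + 1) * \<eta>" by (auto simp: S_def)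
    have "g y \<le> 1 + t * \<xi> y" using gauge_sum_le[OF yR] y t by auto
    also have "\<dots> \<le> r" using yx t by (simp add: r_def)
    finally have "g ((1 / r) *\<^sub>R y) \<le> 1" using r by (simp add: gauge_scale)
    then have "(1 / r) *\<^sub>R y \<in> K" using mem_iff_gauge by blast
    moreover have "(1 / r) *\<^sub>R y \<in> S j" using y r by (auto simp: S_def xi_scale regular_scale)
    ultimately show "y \<in> (*\<^sub>R) r ` (K \<inter> S j)" using r by (intro image_eqI[of _ _ "(1 / r) *\<^sub>R y"]) auto
  qed
  have im: "(*\<^sub>R) r ` (K \<inter> S j) \<in> lmeasurable"
    using measurable_linear_image[OF linear_scaleR lm, of r] by simp
  have "measure lebesgue ({a + t *\<^sub>R b | a b. a \<in> K \<and> b \<in> L} \<inter> S j) \<le> measure lebesgue ((*\<^sub>R) r ` (K \<inter> S j))"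
    using sub im S sum_measurable by (intro measure_mono_fmeasurable) auto
  also have "\<dots> = r ^ 3 * measure lebesgue (K \<inter> S j)"
    using measure_lebesgue_affine[of r 0 "K \<inter> S j"] r by simp
  finally show "measure lborel ({a + t *\<^sub>R b | a b. a \<in> K \<and> b \<in> L} \<inter> S j) \<le> (1 + t * ((real j + 1) * \<eta>))
      ^ 3 * measure lborel (K \<inter> S j)"
    using S KS sum_measurable by (simp add: r_def)
qed

lemma measure_slices:
  fixes S :: "nat \<Rightarrow> (real^3) set"
  assumes S: "\<And>j. S j \<in> sets borel" "disjoint_family S" and n: "Rg \<subseteq> (\<Union>j<n. S j)"
    and A: "A \<in> sets borel" "bounded A"
  shows "measure lborel A = (\<Sum>j<n. measure lborel (A \<inter> S j))"
proof -
  have fin: "emeasure lborel (A \<inter> B) \<noteq> \<infinity>" for B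
    using emeasure_bounded_finite[of "A \<inter> B"] A(2) bounded_subset by (metis inf_le1 less_irrefl)
  have "measure lborel A = measure lborel (\<Union>j<n. A \<inter> S j)"
  proof (rule measure_eq_AE)
    show "AE x in lborel. x \<in> A \<longleftrightarrow> x \<in> (\<Union>j<n. A \<inter> S j)"
      using AE_regular by (rule eventually_mono) (use n in blast)
  qed (use A S in auto)
  also have "\<dots> = (\<Sum>j<n. measure lborel (A \<inter> S j))"
    using A S fin by (intro measure_finite_Union) (auto simp: disjoint_family_on_def)
  finally show ?thesis .
qed

text \<open>
  Equality holds, but one inequality is enough here, and it needs no differentiability of the
  volume of \<open>K + t L\<close> beyond the Steiner polynomial.
\<close>
lemma quermass_1_le: "quermass 1 K L \<le> (\<integral>y. indicator (K \<inter> Rg) y * \<xi> y \<partial>lborel)" (is "_ \<le> ?I")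
proof -
  have approx: "quermass 1 K L \<le> ?I + \<eta> * vol K" if \<eta>: "\<eta> > 0" for \<eta>
  proof -
    obtain l u where lu: "0 < l" "0 < u" "\<And>y. y \<in> Rg \<Longrightarrow> l \<le> \<xi> y" "\<And>y. y \<in> Rg \<Longrightarrow> \<xi> y \<le> u" using xi_bounds by metis
    define S where "S j = {y \<in> Rg. real j * \<eta> \<le> \<xi> y \<and> \<xi> y < (real j + 1) * \<eta>}" for j :: nat
    have Sm: "S j \<in> sets borel" for j unfolding S_def by (rule vol_slice_le(2)[OF \<eta> zero_less_one])
    have Sj: "j = nat \<lfloor>\<xi> y / \<eta>\<rfloor>" if "y \<in> S j" for y j
    proof -
      have "\<lfloor>\<xi> y / \<eta>\<rfloor> = int j" using that \<eta> unfolding S_def by (intro floor_unique) (auto simp: field_simps)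
      then show ?thesis by simp
    qed
    have Sd: "disjoint_family S" unfolding disjoint_family_on_def using Sj by blast
    \<comment> \<open>Finitely many slices suffice because \<open>u\<close> bounds
      \<open>\<xi>\<close>.\<close>
    define n where "n = Suc (nat \<lfloor>u / \<eta>\<rfloor>)"
    have Sn: "Rg \<subseteq> (\<Union>j<n. S j)"
    proof
      fix y assume y: "y \<in> Rg"
      have pos: "\<xi> y / \<eta> \<ge> 0" using lu(1) lu(3)[OF y] \<eta> by simp
      define j where "j = nat \<lfloor>\<xi> y / \<eta>\<rfloor>"
      have j: "real j = of_int \<lfloor>\<xi> y / \<eta>\<rfloor>" using pos by (simp add: j_def)
      have "real j \<le> \<xi> y / \<eta>" "\<xi> y / \<eta> < real j + 1" unfolding j by linarith+
      then have "y \<in> S j" using y \<eta> by (simp add: S_def field_simps)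
      moreover have "\<xi> y / \<eta> \<le> u / \<eta>" using lu(4)[OF y] \<eta> by (simp add: divide_right_mono)
      then have "j < n" unfolding n_def j_def using floor_mono[of "\<xi> y / \<eta>" "u / \<eta>"] by (simp add:
          less_Suc_eq_le nat_mono)
      ultimately show "y \<in> (\<Union>j<n. S j)" by blast
    qed
    define v where "v j = measure lborel (K \<inter> S j)" for j
    define a where "a j = (real j + 1) * \<eta>" for j :: nat
    have Kv: "vol K = (\<Sum>j<n. v j)"
      using measure_slices[OF Sm Sd Sn K_borel compact_imp_bounded[OF K(1)]] by (simp add: vol_def v_def)
    have le: "vol {a + t *\<^sub>R b | a b. a \<in> K \<and> b \<in> L} \<le> (\<Sum>j<n. (1 + t * a j) ^ 3 * v j)" if t: "t > 0" for t
    proof -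
      let ?A = "{a + t *\<^sub>R b | a b. a \<in> K \<and> b \<in> L}"
      have "?A = {a + b | a b. a \<in> K \<and> b \<in> (*\<^sub>R) t ` L}" by blast
      then have "bounded ?A"
        using compact_imp_bounded[OF K(1)] compact_imp_bounded[OF L(1)] bounded_msum[of K "(*\<^sub>R) t ` L"]
        by (simp add: msum_def bounded_scaling)
      then have "measure lborel ?A = (\<Sum>j<n. measure lborel (?A \<inter> S j))"
        by (rule measure_slices[OF Sm Sd Sn sum_measurable])
      also have "\<dots> \<le> (\<Sum>j<n. (1 + t * a j) ^ 3 * v j)"
        unfolding a_def v_def S_def by (intro sum_mono vol_slice_le(1)[OF \<eta> t])
      finally show ?thesis using sum_measurable by (simp add: vol_def)
    qed
    \<comment> \<open>Both polynomials in \<open>t\<close> have the constant term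
      \<open>vol K\<close>, so the inequality for all \<open>t > 0\<close> passes to the linear
      coefficients.\<close>
    have "3 * quermass 1 K L \<le> 3 * (\<Sum>j<n. a j * v j)"
    proof (rule linear_coeff_le)
      fix t :: real assume t: "t > 0"
      have "vol K + 3 * quermass 1 K L * t + 3 * quermass 2 K L * t\<^sup>2 + quermass 3 K L * t ^ 3 \<le> (\<Sum>j<n.
          (1 + t * a j) ^ 3 * v j)"
        using le[OF t] quermass_steiner[OF bodies, of t] t by (simp add: quermass_0[OF bodies])
      also have "\<dots> = (\<Sum>j<n. v j + 3 * (a j * v j) * t + 3 * (a j ^ 2 * v j) * t\<^sup>2 + (a j ^ 3 * v j) * t ^ 3)"
        by (intro sum.cong refl) (simp add: power2_eq_square power3_eq_cube algebra_simps)
      also have "\<dots> = vol K + 3 * (\<Sum>j<n. a j * v j) * t + 3 * (\<Sum>j<n. a j ^ 2 * v j) * t\<^sup>2 + (\<Sum>j<n. a j ^ 3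
          * v j) * t ^ 3"
        by (simp add: sum.distrib Kv sum_distrib_left sum_distrib_right)
      finally show "vol K + 3 * quermass 1 K L * t + 3 * quermass 2 K L * t\<^sup>2 + quermass 3 K L * t ^ 3
        \<le> vol K + 3 * (\<Sum>j<n. a j * v j) * t + 3 * (\<Sum>j<n. a j ^ 2 * v j) * t\<^sup>2 + (\<Sum>j<n. a j ^ 3 * v j) * t ^ 3" .
    qed
    then have coeff: "quermass 1 K L \<le> (\<Sum>j<n. a j * v j)" by simp
    have ik: "integrable lborel (indicator (K \<inter> S j) :: real^3 \<Rightarrow> real)" for j
      using K_borel Sm compact_imp_bounded[OF K(1)]
      by (intro integrable_real_indicator emeasure_bounded_finite sets.Int) (auto intro: bounded_subset)
    note coeff
    also have "(\<Sum>j<n. a j * v j) = (\<Sum>j<n. (\<integral>y. a j * indicator (K \<inter> S j) y \<partial>lborel))"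
      by (simp add: v_def)
    also have "\<dots> = (\<integral>y. (\<Sum>j<n. a j * indicator (K \<inter> S j) y) \<partial>lborel)"
      by (rule Bochner_Integration.integral_sum[symmetric]) (intro integrable_mult_right ik)
    \<comment> \<open>On each slice the constant \<open>a j\<close> exceeds \<open>\<xi>\<close> by
      at most \<open>\<eta>\<close>.\<close>
    also have "\<dots> \<le> (\<integral>y. indicator (K \<inter> Rg) y * \<xi> y + indicator (K \<inter> Rg) y * \<eta> \<partial>lborel)"
    proof (rule integral_mono)
      show "integrable lborel (\<lambda>y. \<Sum>j<n. a j * indicator (K \<inter> S j) y)"
        by (intro Bochner_Integration.integrable_sum integrable_mult_right ik)
      show "integrable lborel (\<lambda>y. indicator (K \<inter> Rg) y * \<xi> y + indicator (K \<inter> Rg) y * \<eta>)"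
        using xi_integrable integrable_bounded_on_K[of "\<lambda>y. \<eta>" \<eta>] \<eta> by simp
      fix y
      show "(\<Sum>j<n. a j * indicator (K \<inter> S j) y) \<le> indicator (K \<inter> Rg) y * \<xi> y + indicator (K \<inter> Rg) y * \<eta>"
      proof (cases "y \<in> K \<inter> Rg")
        case True
        then obtain i where i: "i < n" "y \<in> S i" using Sn by blast
        have "(\<Sum>j<n. a j * indicator (K \<inter> S j) y) = (\<Sum>j<n. if j = i then a i else 0)"
          using True i Sj by (intro sum.cong) (auto simp: indicator_def)
        also have "\<dots> = a i" using i by simp
        also have "\<dots> \<le> \<xi> y + \<eta>" using i(2) by (simp add: a_def S_def algebra_simps)
        finally show ?thesis using True by simp
      next
        case False
        then have "(\<Sum>j<n. a j * indicator (K \<inter> S j) y) = 0" by (intro sum.neutral) (auto simp: indicator_def S_def)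
        then show ?thesis using False by simp
      qed
    qed
    also have "\<dots> = ?I + \<eta> * vol K"
      using xi_integrable integrable_bounded_on_K[of "\<lambda>y. \<eta>" \<eta>] \<eta> measure_K_regular by simp
    finally show ?thesis .
  qed
  have "quermass 1 K L \<le> ?I + e" if "e > 0" for e
    using approx[of "e / vol K"] that vol_pos[OF bodies(1)] by simp
  then show ?thesis by (rule field_le_epsilon)
qed

section \<open>The Bonnesen condition and the logarithmic integral\<close>

lemma ratio_in_interval:
  assumes u: "norm u = 1"
  shows "inradius_o K L \<le> support_fun K u / support_fun L u" "support_fun K u / support_fun L u \<le> circumradius_o K L"
proof -
  have hL: "support_fun L u > 0"
  proof -
    obtain r where "r > 0" "\<And>u. r * norm u \<le> support_fun L u" using support_fun_ge_norm[OF L(1) zeroL] by metis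
    then show ?thesis using u by (metis less_le_trans mult.right_neutral)
  qed
  have le: "support_fun A u \<le> support_fun B u" if "A \<subseteq> B" "A \<noteq> {}" "compact B" for A B
    using that by (intro support_fun_least support_fun_upper) auto
  show "inradius_o K L \<le> support_fun K u / support_fun L u"
    unfolding inradius_o_def
  proof (rule cSup_least)
    have "(*\<^sub>R) 0 ` L \<subseteq> K" using zero_mem by auto
    then show "{t. 0 \<le> t \<and> (*\<^sub>R) t ` L \<subseteq> K} \<noteq> {}" by blast
    fix t assume "t \<in> {t. 0 \<le> t \<and> (*\<^sub>R) t ` L \<subseteq> K}"
    then have t: "0 \<le> t" "(*\<^sub>R) t ` L \<subseteq> K" by auto
    show "t \<le> support_fun K u / support_fun L u"
    proof (cases "t = 0")
      case True
      have "0 \<le> support_fun K u" using support_fun_upper[OF K(1) zero_mem, of u] by simp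
      then show ?thesis using True hL by simp
    next
      case False
      then have "t * support_fun L u \<le> support_fun K u"
        using le[OF t(2) _ K(1)] t(1) L_ne support_fun_dilate[OF L(1) L_ne, of t u] by simp
      then show ?thesis using hL by (simp add: pos_le_divide_eq)
    qed
  qed
  show "support_fun K u / support_fun L u \<le> circumradius_o K L"
    unfolding circumradius_o_def
  proof (rule cInf_greatest)
    obtain r where r: "r > 0" "cball 0 r \<subseteq> L" using zeroL by (auto simp: mem_interior_cball)
    obtain R where R: "R > 0" "\<And>z. z \<in> K \<Longrightarrow> norm z \<le> R" using compact_imp_bounded[OF K(1)] bounded_pos by metis
    \<comment> \<open>The ball of radius \<open>r\<close> lies in \<open>L\<close> and
      \<open>K\<close> lies in the ball of radius \<open>R\<close>, so \<open>R / r\<close> is an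
      admissible factor and the infimum is taken over a nonempty set.\<close>
    have "K \<subseteq> (*\<^sub>R) (R / r) ` L"
    proof
      fix z assume z: "z \<in> K"
      have "(r / R) *\<^sub>R z \<in> L"
        using r R(1) R(2)[OF z] by (intro subsetD[OF r(2)]) (simp add: pos_divide_le_eq)
      moreover have "z = (R / r) *\<^sub>R ((r / R) *\<^sub>R z)" using r R by simp
      ultimately show "z \<in> (*\<^sub>R) (R / r) ` L" by blast
    qed
    then have "R / r \<in> {t. 0 < t \<and> K \<subseteq> (*\<^sub>R) t ` L}" using r R by simp
    then show "{t. 0 < t \<and> K \<subseteq> (*\<^sub>R) t ` L} \<noteq> {}" by blast
    fix t assume "t \<in> {t. 0 < t \<and> K \<subseteq> (*\<^sub>R) t ` L}"
    then have t: "0 < t" "K \<subseteq> (*\<^sub>R) t ` L" by auto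
    then have "support_fun K u \<le> t * support_fun L u"
      using le[OF t(2) K_ne compact_scaling[OF L(1)]] support_fun_dilate[OF L(1) L_ne, of t u] by simp
    then show "support_fun K u / support_fun L u \<le> t" using hL by (simp add: pos_divide_le_eq)
  qed
qed

lemma log_integral_eq:
  "(\<integral>u. ln (support_fun L u / support_fun K u) \<partial>cone_volume_measure K) = (\<integral>y. indicator (K \<inter> Rg) y * ln
      (\<xi> y) \<partial>lborel)"
proof -
  have "(\<lambda>u. ln (support_fun L u / support_fun K u)) \<in> borel_measurable borel"
    using support_fun_measurable[OF K(1) K_ne] support_fun_measurable[OF L(1) L_ne] by measurable
  from cone_volume_integral[OF this]
  have "(\<integral>u. ln (support_fun L u / support_fun K u) \<partial>cone_volume_measure K)
    = (\<integral>y. indicator (K \<inter> Rg) y * ln (support_fun L (nu y) / support_fun K (nu y)) \<partial>lborel)" .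
  also have "\<dots> = (\<integral>y. indicator (K \<inter> Rg) y * ln (\<xi> y) \<partial>lborel)"
    by (intro Bochner_Integration.integral_cong refl) (auto simp: indicator_def xi_ratio)
  finally show ?thesis .
qed

lemma log_integral_ge:
  assumes R1: "\<forall>r\<in>{inradius_o K L..circumradius_o K L}. 0 \<le> bonnesen0 K L r"
  shows "vol K * ln ((vol L / vol K) powr (1/3)) \<le> (\<integral>y. indicator (K \<inter> Rg) y * ln (\<xi> y) \<partial>lborel)"
proof -
  define W1 W2 where "W1 = quermass 1 K L" and "W2 = quermass 2 K L"
  have V: "vol K > 0" "vol L > 0" using vol_pos bodies by auto
  have W23: "vol K * vol L ^ 2 \<le> W2 ^ 3" unfolding W2_def by (rule quermass_2_ge[OF bodies])
  moreover have "vol K * vol L ^ 2 > 0" using V by simp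
  ultimately have "W2 ^ 3 > 0" by linarith
  then have W2: "W2 > 0" by (simp add: zero_less_power_eq)
  obtain \<alpha> \<beta> where ab: "\<beta> \<ge> 0" "\<alpha> + \<beta> * (W1 / vol K) = ln (W2 / vol K) / 2"
    "\<And>x. x > 0 \<Longrightarrow> vol K * x\<^sup>2 - 2 * W1 * x + W2 \<le> 0 \<Longrightarrow> \<alpha> + \<beta> * x \<le> ln x"
    using ln_chord[OF V(1) W2, of W1] by metis
  obtain l u where lu: "0 < l" "0 < u" "\<And>y. y \<in> Rg \<Longrightarrow> l \<le> \<xi> y" "\<And>y. y \<in> Rg \<Longrightarrow> \<xi> y \<le> u" using xi_bounds by metis
  have low: "\<alpha> + \<beta> * \<xi> y \<le> ln (\<xi> y)" if y: "y \<in> Rg" for y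
  proof (rule ab(3))
    show x: "\<xi> y > 0" using lu(1) lu(3)[OF y] by linarith
    define r where "r = support_fun K (nu y) / support_fun L (nu y)"
    have r: "r = 1 / \<xi> y" unfolding r_def xi_ratio[OF y, symmetric] by simp
    have "r \<in> {inradius_o K L..circumradius_o K L}"
      unfolding r_def using ratio_in_interval[OF nu_norm, of y] by simp
    then have "0 \<le> bonnesen0 K L r" using R1 by blast
    \<comment> \<open>Multiplication by the square of \<open>\<xi> y\<close> turns the Bonnesen
      polynomial at \<open>r = 1 / \<xi> y\<close> into the quadratic of
      \<open>ln_chord\<close>.\<close>
    then have "0 \<le> (2 * W1 * r - vol K - W2 * r\<^sup>2) * (\<xi> y)\<^sup>2"
      by (simp add: bonnesen0_def quermass_0[OF bodies] W1_def W2_def)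
    also have "\<dots> = 2 * W1 * \<xi> y - vol K * (\<xi> y)\<^sup>2 - W2"
      using x by (simp add: r field_simps power2_eq_square)
    finally show "vol K * (\<xi> y)\<^sup>2 - 2 * W1 * \<xi> y + W2 \<le> 0" by simp
  qed
  have lnm: "(\<lambda>y. ln (\<xi> y)) \<in> borel_measurable borel" using xi_measurable by measurable
  \<comment> \<open>Needed for the final comparison of integrals, since the Bochner integral of a
    nonintegrable function is 0 by convention.\<close>
  have iln: "integrable lborel (\<lambda>y. indicator (K \<inter> Rg) y * ln (\<xi> y))"
  proof (rule integrable_bounded_on_K[OF lnm])
    fix y assume "y \<in> K \<inter> Rg"
    then have "ln l \<le> ln (\<xi> y)" "ln (\<xi> y) \<le> ln u" using lu(1,2) lu(3)[of y] lu(4)[of y] by auto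
    then show "\<bar>ln (\<xi> y)\<bar> \<le> \<bar>ln l\<bar> + \<bar>ln u\<bar>" by linarith
  qed
  have ione: "integrable lborel (\<lambda>y. indicator (K \<inter> Rg) y :: real)"
    using integrable_bounded_on_K[of "\<lambda>y. 1" 1] by simp
  have "vol K * ln ((vol L / vol K) powr (1/3)) = vol K * (ln (vol L / vol K) / 3)" using V by (simp add: ln_powr)
  also have "\<dots> \<le> vol K * (ln (W2 / vol K) / 2)"
  proof (rule mult_left_mono)
    \<comment> \<open>Minkowski's inequality for the volume ratios; the exponents 2 and 3 become the
      factors 1/3 and 1/2 of the logarithms.\<close>
    have "(vol L / vol K) ^ 2 \<le> (W2 / vol K) ^ 3"
      using W23 V by (simp add: power_divide field_simps power2_eq_square power3_eq_cube)
    then have "ln ((vol L / vol K) ^ 2) \<le> ln ((W2 / vol K) ^ 3)" using V W2 by (subst ln_le_cancel_iff) auto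
    then show "ln (vol L / vol K) / 3 \<le> ln (W2 / vol K) / 2" using V W2 by (simp add: ln_realpow)
  qed (use V in simp)
  also have "\<dots> = \<alpha> * vol K + \<beta> * W1" unfolding ab(2)[symmetric] using V by (simp add: field_simps)
  \<comment> \<open>The nonnegative slope permits replacing \<open>W1\<close> by the larger integral
    of \<open>\<xi>\<close>.\<close>
  also have "\<dots> \<le> \<alpha> * vol K + \<beta> * (\<integral>y. indicator (K \<inter> Rg) y * \<xi> y \<partial>lborel)"
    using ab(1) quermass_1_le by (simp add: W1_def mult_left_mono)
  also have "\<dots> = (\<integral>y. \<alpha> * indicator (K \<inter> Rg) y + \<beta> * (indicator (K \<inter> Rg) y * \<xi> y) \<partial>lborel)"
    using ione xi_integrable measure_K_regular by simp
  also have "\<dots> \<le> (\<integral>y. indicator (K \<inter> Rg) y * ln (\<xi> y) \<partial>lborel)"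
  proof (rule integral_mono)
    show "integrable lborel (\<lambda>y. \<alpha> * indicator (K \<inter> Rg) y + \<beta> * (indicator (K \<inter> Rg) y * \<xi> y))"
      using ione xi_integrable by simp
    show "\<alpha> * indicator (K \<inter> Rg) y + \<beta> * (indicator (K \<inter> Rg) y * \<xi> y) \<le> indicator (K \<inter> Rg) y * ln (\<xi> y)" for y
      using low[of y] by (auto simp: indicator_def)
  qed (rule iln)
  finally show ?thesis .
qed

text \<open>For dilates \<open>\<xi>\<close> is the constant \<open>1 / c\<close> on the regular
  points, and the volume ratio is its cube.\<close>

lemma log_integral_dilates:
  assumes c: "c > 0" "K = (*\<^sub>R) c ` L"
  shows "(\<integral>y. indicator (K \<inter> Rg) y * ln (\<xi> y) \<partial>lborel) = vol K * ln ((vol L / vol K) powr (1/3))"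
proof -
  have "\<xi> y = 1 / c" if y: "y \<in> Rg" for y
  proof -
    obtain l u where "0 < l" "\<And>y. y \<in> Rg \<Longrightarrow> l \<le> \<xi> y" using xi_bounds by metis
    then have "\<xi> y > 0" using y by (meson less_le_trans)
    then have "support_fun L (nu y) \<noteq> 0" using xi_ratio[OF y] by auto
    moreover have "support_fun K (nu y) = c * support_fun L (nu y)"
      unfolding c(2) by (rule support_fun_dilate[OF L(1) L_ne c(1)])
    ultimately show ?thesis using xi_ratio[OF y] by simp
  qed
  then have "(\<integral>y. indicator (K \<inter> Rg) y * ln (\<xi> y) \<partial>lborel) = (\<integral>y. indicator (K \<inter> Rg) y * ln (1 / c) \<partial>lborel)"
    by (intro Bochner_Integration.integral_cong refl) (auto simp: indicator_def)
  also have "\<dots> = vol K * ln (1 / c)" using measure_K_regular by simp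
  also have "ln (1 / c) = ln ((vol L / vol K) powr (1/3))"
  proof -
    have "vol K = c ^ 3 * vol L" unfolding c(2) using c(1) by (simp add: vol_scale)
    then have "vol L / vol K = (1 / c) ^ 3" using vol_pos[OF bodies(2)] c(1) by (simp add: power_divide)
    then show ?thesis using c(1) by (simp add: ln_powr ln_realpow)
  qed
  finally show ?thesis .
qed

end

theorem theorem3p2:
  fixes K L :: "(real^3) set"
  assumes "convex_body K" and "convex_body L"
    and "class_R1 K L"
  shows "(\<integral>u. ln (support_fun L u / support_fun K u) \<partial>cone_volume_measure K)
           \<ge> vol K * ln ((vol L / vol K) powr (1/3)) \<and>
         (dilates K L \<longrightarrow>
           (\<integral>u. ln (support_fun L u / support_fun K u) \<partial>cone_volume_measure K)
           = vol K * ln ((vol L / vol K) powr (1/3)))"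
proof -
  have "0 \<in> interior K" "0 \<in> interior L" using assms(3) by (auto simp: class_R1_def)
  then interpret body_pair K L
    using assms(1,2) by unfold_locales (auto simp: convex_body_def)
  have R1: "\<forall>r\<in>{inradius_o K L..circumradius_o K L}. 0 \<le> bonnesen0 K L r"
    using assms(3) by (simp add: class_R1_def)
  show ?thesis unfolding log_integral_eq
    using log_integral_ge[OF R1] log_integral_dilates by (auto simp: dilates_def)
qed

end
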